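(* Let $n\ge2$, let $p<0$, let $u_1,\ldots,u_N\in S^{n-1}$ satisfy $u_i\neq\pm u_j$ whenever $i\neq j$, and let $\alpha_i^+,\alpha_i^->0$ for $1\le i\le N$. Set $$\mu=\sum_{i=1}^N\bigl(\alpha_i^+\delta_{u_i}+\alpha_i^-\delta_{-u_i}\bigr).$$ There exists a polytope $K\subset\mathbb{R}^n$ containing the origin in its interior such that $$S_p(K,\cdot)=\mu$$ if and only if $$\operatorname{span}\{u_1,\ldots,u_N\}=\mathbb{R}^n.$$
   Context: $S^{n-1}$ is the unit sphere of $\mathbb{R}^n$ and $\delta_u$ is the Dirac measure at $u$. For a convex body (compact convex set with nonempty interior) $K\subset\mathbb{R}^n$ containing the origin in its interior, $h_K(u)=\max_{x\in K}\langle x,u\rangle$ is the support function, $S_K$ is the surface area measure on $S^{n-1}$, i.e. $S_K(\omega)=\mathcal{H}^{n-1}(\nu_K^{-1}(\omega))$ with $\nu_K$ the $\mathcal{H}^{n-1}$-a.e. defined outer unit normal map on $\partial K$, and the $L_p$ surface area measure is $dS_p(K,\cdot)=h_K^{1-p}\,dS_K$. For a polytope $P$ with the origin in its interior and a facet with outer unit normal $u$ and area $a_P(u)$, $S_p(P,\{u\})=h_P(u)^{1-p}a_P(u)$. *)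

theory Defs
  imports "HOL-Probability.Probability"
begin

section \<open>Hausdorff measure\<close>

text \<open>
  \<open>unit_ball_vol s / 2 ^ s\<close> is the usual constant that makes the \<open>s\<close>-dimensional Hausdorff
  measure agree with \<open>s\<close>-dimensional Lebesgue measure on \<open>s\<close>-dimensional affine subspaces.
  The empty set is treated separately only because \<open>0 ^ 0 = 1\<close>; boundedness is required
  because \<^const>\<open>diameter\<close> has no meaningful value on unbounded sets.
\<close>

definition hausdorff_content :: "nat \<Rightarrow> real \<Rightarrow> 'a::metric_space set \<Rightarrow> ennreal" where
  "hausdorff_content s \<delta> A =
     (INF U \<in> {U :: nat \<Rightarrow> 'a set. A \<subseteq> (\<Union>i. U i) \<and> (\<forall>i. bounded (U i) \<and> diameter (U i) \<le> \<delta>)}.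
        \<Sum>i. if U i = {} then 0
            else ennreal (unit_ball_vol (real s) * (diameter (U i) / 2) ^ s))"

definition hausdorff :: "nat \<Rightarrow> 'a::metric_space set \<Rightarrow> ennreal" where
  "hausdorff s A = (SUP \<delta>\<in>{0<..}. hausdorff_content s \<delta> A)"


section \<open>Support function, Gauss map, and surface area measures\<close>

definition support_fun :: "'a::euclidean_space set \<Rightarrow> 'a \<Rightarrow> real" where
  "support_fun K u = (SUP x\<in>K. x \<bullet> u)"

definition outer_unit_normal :: "'a::euclidean_space set \<Rightarrow> 'a \<Rightarrow> 'a \<Rightarrow> bool" where
  "outer_unit_normal K x u \<longleftrightarrow> norm u = 1 \<and> (\<forall>y\<in>K. (y - x) \<bullet> u \<le> 0)"

text \<open>The domain of the Gauss map: boundary points at which the outer unit normal is unique.\<close>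

definition regular_points :: "'a::euclidean_space set \<Rightarrow> 'a set" where
  "regular_points K = {x \<in> frontier K. \<exists>!u. outer_unit_normal K x u}"

definition gauss_map :: "'a::euclidean_space set \<Rightarrow> 'a \<Rightarrow> 'a" where
  "gauss_map K x = (THE u. outer_unit_normal K x u)"

definition sphere_borel :: "'a::euclidean_space measure" where
  "sphere_borel = restrict_space borel (sphere 0 1)"

definition surface_area_measure :: "'a::euclidean_space set \<Rightarrow> 'a measure" where
  "surface_area_measure K =
     measure_of (space sphere_borel) (sets sphere_borel)
       (\<lambda>\<omega>. hausdorff (DIM('a) - 1) {x \<in> regular_points K. gauss_map K x \<in> \<omega>})"

definition Lp_surface_area_measure :: "real \<Rightarrow> 'a::euclidean_space set \<Rightarrow> 'a measure" where
  "Lp_surface_area_measure p K =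
     density (surface_area_measure K) (\<lambda>u. ennreal (support_fun K u powr (1 - p)))"


section \<open>Finite sums of Dirac measures at antipodal points\<close>

definition antipodal_measure ::
    "nat \<Rightarrow> (nat \<Rightarrow> 'a::euclidean_space) \<Rightarrow> (nat \<Rightarrow> real) \<Rightarrow> (nat \<Rightarrow> real) \<Rightarrow> 'a measure" where
  "antipodal_measure N u a b =
     measure_of (space sphere_borel) (sets sphere_borel)
       (\<lambda>\<omega>. \<Sum>i=1..N. ennreal (a i) * emeasure (return sphere_borel (u i)) \<omega>
                    + ennreal (b i) * emeasure (return sphere_borel (- u i)) \<omega>)"

lemma emeasure_antipodal_measure:
  assumes "\<omega> \<in> sets sphere_borel"
  shows "emeasure (antipodal_measure N u a b) \<omega> =
    (\<Sum>i=1..N. ennreal (a i) * indicator \<omega> (u i) + ennreal (b i) * indicator \<omega> (- u i))"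
proof -
  let ?f = "\<lambda>\<omega>. \<Sum>i=1..N. ennreal (a i) * emeasure (return sphere_borel (u i)) \<omega>
                    + ennreal (b i) * emeasure (return sphere_borel (- u i)) \<omega>"
  have "countably_additive (sets sphere_borel) ?f"
  proof (rule countably_additiveI)
    fix A :: "nat \<Rightarrow> 'a set"
    assume A: "range A \<subseteq> sets sphere_borel" "disjoint_family A"
    have *: "(\<Sum>j. emeasure (return sphere_borel v) (A j)) = emeasure (return sphere_borel v) (\<Union>j. A j)"
      for v by (rule suminf_emeasure) (use A in auto)
    have "(\<Sum>j. ?f (A j)) = (\<Sum>i=1..N. \<Sum>j. ennreal (a i) * emeasure (return sphere_borel (u i)) (A j)
                    + ennreal (b i) * emeasure (return sphere_borel (- u i)) (A j))"
      by (subst suminf_sum) auto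
    also have "\<dots> = ?f (\<Union>j. A j)"
      by (intro sum.cong refl) (simp add: suminf_add[symmetric] *)
    finally show "(\<Sum>j. ?f (A j)) = ?f (\<Union>j. A j)" .
  qed
  then have "emeasure (antipodal_measure N u a b) \<omega> = ?f \<omega>"
    unfolding antipodal_measure_def
    by (intro emeasure_measure_of_sigma) (use assms in \<open>auto simp: positive_def sets.sigma_algebra_axioms\<close>)
  then show ?thesis using assms by simp
qed

end

theory Submission
  imports Defs
begin

text \<open>
  Write \<open>v 0, \<dots>, v (m - 1)\<close> for the \<open>2 N\<close> prescribed normals and let \<open>vol h\<close> be the volume of the body
  \<open>{x. x \<bullet> v i \<le> h i}\<close>. Its partial derivatives are the facet areas, so a critical point of
  \<open>vol h + (\<Sum>i. \<alpha> i / (- p) * h i powr p)\<close> on the positive orthant is a polytope with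
  \<open>h i powr (1 - p)\<close> times the \<open>i\<close>-th area equal to \<open>\<alpha> i\<close>. The critical point is a saddle, found by
  linking. Choose a basis \<open>b k\<close> among the normals. The parallelepipeds with normals \<open>b k\<close>, \<open>- b k\<close> form
  a sheet parametrised by their own support numbers, on which the energy tends to infinity at the ends.
  Successive sections of a body by the flag of subspaces orthogonal to the first few \<open>b k\<close> give
  coordinates that retract all support numbers onto this sheet, and the energy is bounded on
  the set where all these coordinates are 1, because every normal has a last nonzero coefficient in the basis.
  Without a critical point the sheet could be pushed up to energies above that bound while its
  ends stay fixed, yet by Brouwer it always meets that set.

  The constant relating the Hausdorff measure on a hyperplane to Lebesgue measure never
  has to be computed: it is positive and finite and can be absorbed into \<open>\<alpha>\<close>.

  Conversely, if \<open>e\<close> is orthogonal to all prescribed normals, every facet of the polytope has a normal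
  orthogonal to \<open>e\<close>, and the polytope would be unbounded in direction \<open>e\<close>.
\<close>

section \<open>Hausdorff measure as a Borel measure\<close>

text \<open>Minimising the energy cannot work: a support number above the true support value of the
  body leaves the volume unchanged and lowers the energy, so descent makes prescribed facets
  disappear. Replacing the numbers by the true support values (\<open>reduce\<close>) can only raise
  the energy, so the deformation goes upward and \<open>reduce\<close> may follow each push without
  undoing it. On reduced numbers the sublevel sets are compact: \<open>p < 0\<close> bounds the
  numbers from below, and the volume then bounds the diameter. The support values of the whole body
  in the directions \<open>b k\<close>, \<open>- b k\<close> would be bad coordinates: a thin body
  along a diagonal can have all of them equal to 1 while a further normal has a support number close
  to 0, so the energy is not bounded there. Taking them on successive sections excludes such bodies.
  Antipodality keeps every body bounded and puts the parallelepipeds among the admissible bodies. At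
  a critical point every area equals \<open>\<alpha> i * h i powr (p - 1)\<close>, which is
  positive, so no separate argument that the facets persist is called for.\<close>

definition hausdorff_weight :: "nat \<Rightarrow> 'a::metric_space set \<Rightarrow> ennreal" where
  "hausdorff_weight s U = (if U = {} then 0 else ennreal (unit_ball_vol (real s) * (diameter U / 2) ^ s))"

definition hausdorff_covers :: "real \<Rightarrow> 'a::metric_space set \<Rightarrow> (nat \<Rightarrow> 'a set) set" where
  "hausdorff_covers \<delta> A = {U. A \<subseteq> (\<Union>i. U i) \<and> (\<forall>i. bounded (U i) \<and> diameter (U i) \<le> \<delta>)}"

lemma hausdorff_content_alt:
  "hausdorff_content s \<delta> A = (INF U \<in> hausdorff_covers \<delta> A. \<Sum>i. hausdorff_weight s (U i))"
  by (simp add: hausdorff_content_def hausdorff_weight_def hausdorff_covers_def)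

lemma hausdorff_content_le:
  "U \<in> hausdorff_covers \<delta> A \<Longrightarrow> hausdorff_content s \<delta> A \<le> (\<Sum>i. hausdorff_weight s (U i))"
  unfolding hausdorff_content_alt by (rule INF_lower)

lemma hausdorff_content_mono: "A \<subseteq> B \<Longrightarrow> hausdorff_content s \<delta> A \<le> hausdorff_content s \<delta> B"
  unfolding hausdorff_content_alt
  by (rule INF_superset_mono) (auto simp: hausdorff_covers_def)

lemma hausdorff_content_antimono: "\<delta> \<le> \<delta>' \<Longrightarrow> hausdorff_content s \<delta>' A \<le> hausdorff_content s \<delta> A"
  unfolding hausdorff_content_alt
  by (rule INF_superset_mono) (auto simp: hausdorff_covers_def intro: order_trans)

lemma hausdorff_content_empty: "0 \<le> \<delta> \<Longrightarrow> hausdorff_content s \<delta> {} = 0"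
  using hausdorff_content_le[of "\<lambda>_. {}" \<delta> "{}" s]
  by (auto simp: hausdorff_covers_def hausdorff_weight_def diameter_def)

lemma hausdorff_content_subadditive:
  "hausdorff_content s \<delta> (\<Union>i. A i) \<le> (\<Sum>i. hausdorff_content s \<delta> (A i))"
proof (rule ennreal_le_epsilon)
  fix e :: real assume e: "0 < e" and fin: "(\<Sum>i. hausdorff_content s \<delta> (A i)) < top"
  have "\<exists>U \<in> hausdorff_covers \<delta> (A i).
      (\<Sum>j. hausdorff_weight s (U j)) < hausdorff_content s \<delta> (A i) + ennreal (e * (1/2) ^ Suc i)" for i
  proof -
    have "hausdorff_content s \<delta> (A i) < top"
      using fin by (rule ennreal_suminf_lessD)
    then have "hausdorff_content s \<delta> (A i) < hausdorff_content s \<delta> (A i) + ennreal (e * (1/2) ^ Suc i)"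
      using e by (cases "hausdorff_content s \<delta> (A i)") (auto simp flip: ennreal_plus simp: ennreal_less_iff)
    then show ?thesis unfolding hausdorff_content_alt INF_less_iff by auto
  qed
  then obtain U where U: "\<And>i. U i \<in> hausdorff_covers \<delta> (A i)"
    "\<And>i. (\<Sum>j. hausdorff_weight s (U i j)) < hausdorff_content s \<delta> (A i) + ennreal (e * (1/2) ^ Suc i)"
    by metis
  let ?W = "\<lambda>k. case prod_decode k of (i, j) \<Rightarrow> U i j"
  have "?W \<in> hausdorff_covers \<delta> (\<Union>i. A i)"
  proof -
    have "(\<Union>i. A i) \<subseteq> (\<Union>k. ?W k)"
    proof
      fix x assume "x \<in> (\<Union>i. A i)"
      then obtain i j where "x \<in> U i j" using U(1) by (fastforce simp: hausdorff_covers_def)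
      then have "x \<in> ?W (prod_encode (i, j))" by simp
      then show "x \<in> (\<Union>k. ?W k)" by (rule UN_I[OF UNIV_I])
    qed
    moreover have "bounded (?W k) \<and> diameter (?W k) \<le> \<delta>" for k
      using U(1)[of "fst (prod_decode k)"] by (simp add: hausdorff_covers_def split_beta)
    ultimately show ?thesis by (simp add: hausdorff_covers_def)
  qed
  then have "hausdorff_content s \<delta> (\<Union>i. A i) \<le> (\<Sum>k. hausdorff_weight s (?W k))"
    by (rule hausdorff_content_le)
  also have "\<dots> = (\<Sum>i. \<Sum>j. hausdorff_weight s (U i j))"
    using suminf_ennreal_2dimen[of "\<lambda>i. \<Sum>j. hausdorff_weight s (U i j)"
        "\<lambda>p. hausdorff_weight s (case p of (i, j) \<Rightarrow> U i j)"] by simp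
  also have "\<dots> \<le> (\<Sum>i. hausdorff_content s \<delta> (A i) + ennreal (e * (1/2) ^ Suc i))"
    by (intro suminf_le) (use U(2) in \<open>auto intro: less_imp_le\<close>)
  also have "\<dots> = (\<Sum>i. hausdorff_content s \<delta> (A i)) + (\<Sum>i. ennreal (e * (1/2) ^ Suc i))"
    by (rule suminf_add[symmetric]) auto
  also have "(\<Sum>i. ennreal (e * (1/2) ^ Suc i)) = ennreal e"
    using sums_mult[OF power_half_series, of e] e by (intro suminf_ennreal_eq) auto
  finally show "hausdorff_content s \<delta> (\<Union>i. A i) \<le> (\<Sum>i. hausdorff_content s \<delta> (A i)) + ennreal e" .
qed

lemma hausdorff_content_le_hausdorff: "0 < \<delta> \<Longrightarrow> hausdorff_content s \<delta> A \<le> hausdorff s A"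
  unfolding hausdorff_def by (rule SUP_upper) auto

lemma hausdorff_leI:
  "(\<And>\<delta>. 0 < \<delta> \<Longrightarrow> hausdorff_content s \<delta> A \<le> c) \<Longrightarrow> hausdorff s A \<le> c"
  unfolding hausdorff_def by (rule SUP_least) auto

lemma hausdorff_mono: "A \<subseteq> B \<Longrightarrow> hausdorff s A \<le> hausdorff s B"
  by (intro hausdorff_leI order_trans[OF hausdorff_content_mono hausdorff_content_le_hausdorff])

lemma hausdorff_empty: "hausdorff s {} = 0"
  using hausdorff_leI[of s "{}" 0] by (auto simp: hausdorff_content_empty)

lemma hausdorff_subadditive: "hausdorff s (\<Union>i. A i) \<le> (\<Sum>i. hausdorff s (A i))"
  by (intro hausdorff_leI order_trans[OF hausdorff_content_subadditive] suminf_le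
      hausdorff_content_le_hausdorff) auto

lemma hausdorff_Un_le: "hausdorff s (A \<union> B) \<le> hausdorff s A + hausdorff s B"
proof -
  have "hausdorff s (A \<union> B) = hausdorff s (\<Union>i. binaryset A B i)" by (simp add: UN_binaryset_eq)
  also have "\<dots> \<le> (\<Sum>i. hausdorff s (binaryset A B i))" by (rule hausdorff_subadditive)
  also have "\<dots> = hausdorff s A + hausdorff s B"
    by (rule suminf_binaryset_eq) (rule hausdorff_empty)
  finally show ?thesis .
qed

text \<open>Along the mesh sizes \<open>1 / real (Suc n)\<close> the contents increase with
  \<open>n\<close>, so the supremum becomes a monotone limit and can be exchanged with
  addition.\<close>

lemma hausdorff_eq_SUP_nat: "hausdorff s A = (SUP n::nat. hausdorff_content s (1 / real (Suc n)) A)"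
proof (rule antisym)
  show "hausdorff s A \<le> (SUP n::nat. hausdorff_content s (1 / real (Suc n)) A)"
  proof (rule hausdorff_leI)
    fix \<delta> :: real assume "0 < \<delta>"
    then obtain n where "1 / real (Suc n) < \<delta>" using reals_Archimedean[of \<delta>] by (auto simp: field_simps)
    then have "hausdorff_content s \<delta> A \<le> hausdorff_content s (1 / real (Suc n)) A"
      by (intro hausdorff_content_antimono) simp
    also have "\<dots> \<le> (SUP n::nat. hausdorff_content s (1 / real (Suc n)) A)" by (rule SUP_upper) simp
    finally show "hausdorff_content s \<delta> A \<le> \<dots>" .
  qed
  show "(SUP n::nat. hausdorff_content s (1 / real (Suc n)) A) \<le> hausdorff s A"
    by (intro SUP_least hausdorff_content_le_hausdorff) simp
qed

text \<open>A covering set of diameter below \<open>d\<close> cannot meet both \<open>A\<close> and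
  \<open>B\<close>, so a fine cover of the union splits into covers of \<open>A\<close> and of
  \<open>B\<close> of no larger total weight.\<close>

lemma hausdorff_metric_additive:
  fixes A B :: "'a::metric_space set"
  assumes d: "0 < d" "\<And>a b. a \<in> A \<Longrightarrow> b \<in> B \<Longrightarrow> d \<le> dist a b"
  shows "hausdorff s A + hausdorff s B \<le> hausdorff s (A \<union> B)"
proof -
  have step: "hausdorff_content s \<delta> A + hausdorff_content s \<delta> B \<le> hausdorff_content s \<delta> (A \<union> B)"
    if \<delta>: "0 < \<delta>" "\<delta> < d" for \<delta>
    unfolding hausdorff_content_alt[of s \<delta> "A \<union> B"]
  proof (rule INF_greatest)
    fix U assume U: "U \<in> hausdorff_covers \<delta> (A \<union> B)"
    define UA where "UA i = (if U i \<inter> A = {} then {} else U i)" for i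
    define UB where "UB i = (if U i \<inter> B = {} then {} else U i)" for i
    have cov: "UA \<in> hausdorff_covers \<delta> A" "UB \<in> hausdorff_covers \<delta> B"
      using U \<delta> unfolding hausdorff_covers_def UA_def UB_def by (auto, force+)
    have "hausdorff_weight s (UA i) + hausdorff_weight s (UB i) \<le> hausdorff_weight s (U i)" for i
    proof -
      have "U i \<inter> A = {} \<or> U i \<inter> B = {}"
      proof (rule ccontr)
        assume "\<not> ?thesis"
        then obtain a b where ab: "a \<in> U i" "a \<in> A" "b \<in> U i" "b \<in> B" by auto
        have "dist a b \<le> diameter (U i)"
          using U ab by (intro diameter_bounded_bound) (auto simp: hausdorff_covers_def)
        also have "\<dots> \<le> \<delta>" using U by (auto simp: hausdorff_covers_def)
        finally show False using d(2)[OF ab(2,4)] \<delta> by simp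
      qed
      then show ?thesis by (auto simp: UA_def UB_def hausdorff_weight_def)
    qed
    then have "(\<Sum>i. hausdorff_weight s (UA i) + hausdorff_weight s (UB i)) \<le> (\<Sum>i. hausdorff_weight s (U i))"
      by (intro suminf_le) auto
    moreover have "(\<Sum>i. hausdorff_weight s (UA i)) + (\<Sum>i. hausdorff_weight s (UB i)) =
        (\<Sum>i. hausdorff_weight s (UA i) + hausdorff_weight s (UB i))"
      by (rule suminf_add) auto
    ultimately show "hausdorff_content s \<delta> A + hausdorff_content s \<delta> B \<le> (\<Sum>i. hausdorff_weight s (U i))"
      using add_mono[OF hausdorff_content_le[OF cov(1)] hausdorff_content_le[OF cov(2)], of s s] by simp
  qed
  have inc: "incseq (\<lambda>n. hausdorff_content s (1 / real (Suc n)) X)" for X :: "'a set"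
    by (intro monoI hausdorff_content_antimono) (auto simp: field_simps)
  have "hausdorff s A + hausdorff s B =
      (SUP n. hausdorff_content s (1 / real (Suc n)) A + hausdorff_content s (1 / real (Suc n)) B)"
    unfolding hausdorff_eq_SUP_nat by (rule ennreal_SUP_add[symmetric, OF inc inc])
  also have "\<dots> \<le> hausdorff s (A \<union> B)"
  proof (rule SUP_least)
    fix n :: nat
    obtain m where m: "1 / real (Suc m) < d" using reals_Archimedean[of d] d by (auto simp: field_simps)
    let ?\<delta> = "min (1 / real (Suc n)) (1 / real (Suc m))"
    have "hausdorff_content s (1 / real (Suc n)) A + hausdorff_content s (1 / real (Suc n)) B
        \<le> hausdorff_content s ?\<delta> A + hausdorff_content s ?\<delta> B"
      by (intro add_mono hausdorff_content_antimono) auto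
    also have "\<dots> \<le> hausdorff_content s ?\<delta> (A \<union> B)" by (rule step) (use m in auto)
    also have "\<dots> \<le> hausdorff s (A \<union> B)" by (rule hausdorff_content_le_hausdorff) auto
    finally show "hausdorff_content s (1 / real (Suc n)) A + hausdorff_content s (1 / real (Suc n)) B \<le> \<dots>" .
  qed
  finally show ?thesis .
qed

lemma hausdorff_metric_additive_finite:
  fixes R :: "nat \<Rightarrow> 'a::metric_space set"
  assumes "\<And>i j. i < j \<Longrightarrow> \<exists>d>0. \<forall>a\<in>R i. \<forall>b\<in>R j. d \<le> dist a b"
  shows "(\<Sum>i<n. hausdorff s (R i)) \<le> hausdorff s (\<Union>i<n. R i)"
proof (induction n)
  case (Suc n)
  have "\<exists>d>0. \<forall>a\<in>(\<Union>i<k. R i). \<forall>b\<in>R n. d \<le> dist a b" if "k \<le> n" for k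
    using that
  proof (induction k)
    case 0 then show ?case by (auto intro: exI[of _ 1])
  next
    case (Suc k)
    then obtain d where d: "d > 0" "\<forall>a\<in>(\<Union>i<k. R i). \<forall>b\<in>R n. d \<le> dist a b" by auto
    obtain d' where d': "d' > 0" "\<forall>a\<in>R k. \<forall>b\<in>R n. d' \<le> dist a b"
      using assms[of k n] Suc.prems by auto
    have "\<forall>a\<in>(\<Union>i<Suc k. R i). \<forall>b\<in>R n. min d d' \<le> dist a b"
      using d d' by (auto simp: lessThan_Suc min_le_iff_disj)
    then show ?case using d(1) d'(1) by (intro exI[of _ "min d d'"]) auto
  qed
  from this[of n] obtain d where d: "d > 0" "\<forall>a\<in>(\<Union>i<n. R i). \<forall>b\<in>R n. d \<le> dist a b" by auto
  have "(\<Sum>i<Suc n. hausdorff s (R i)) \<le> hausdorff s (\<Union>i<n. R i) + hausdorff s (R n)"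
    using Suc by (auto intro: add_right_mono)
  also have "\<dots> \<le> hausdorff s ((\<Union>i<n. R i) \<union> R n)"
    by (rule hausdorff_metric_additive[OF d(1)]) (use d in auto)
  also have "(\<Union>i<n. R i) \<union> R n = (\<Union>i<Suc n. R i)" by (auto simp: lessThan_Suc)
  finally show ?case .
qed simp

text \<open>Caratheodory's criterion for closed sets: the part of \<open>X\<close> outside \<open>F\<close> is cut into the shells
  \<open>R k\<close>; shells two apart have positive distance, so the total measure of all shells is finite.\<close>

lemma hausdorff_closed_split:
  fixes F :: "'a::metric_space set"
  assumes F: "closed F" "F \<noteq> {}"
  shows "hausdorff s (X \<inter> F) + hausdorff s (X - F) \<le> hausdorff s X"
proof (cases "hausdorff s X = top")
  case False
  define Y where "Y k = {x \<in> X. 1 / real (Suc k) \<le> infdist x F}" for k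
  define R where "R k = Y (Suc k) - Y k" for k
  have sep: "\<exists>d>0. \<forall>a\<in>R i. \<forall>b\<in>R j. d \<le> dist a b" if "i + 2 \<le> j" for i j
  proof (intro exI[of _ "1 / real (Suc (Suc i)) - 1 / real (Suc j)"] conjI ballI)
    show "0 < 1 / real (Suc (Suc i)) - 1 / real (Suc j)"  using that by (simp add: frac_less2)
    fix a b assume "a \<in> R i" "b \<in> R j"
    then have "1 / real (Suc (Suc i)) \<le> infdist a F" "infdist b F < 1 / real (Suc j)"
      by (auto simp: R_def Y_def)
    then show "1 / real (Suc (Suc i)) - 1 / real (Suc j) \<le> dist a b"
      using infdist_triangle[of a F b] by simp
  qed
  \<comment> \<open>Shells of equal parity are pairwise separated; \<open>c = 0\<close> and
    \<open>c = 1\<close> collect the even and the odd ones.\<close>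
  have parity: "(\<Sum>i. hausdorff s (R (2 * i + c))) \<le> hausdorff s X" for c
  proof (rule suminf_le_const)
    fix n
    have "(\<Sum>i<n. hausdorff s (R (2 * i + c))) \<le> hausdorff s (\<Union>i<n. R (2 * i + c))"
      by (rule hausdorff_metric_additive_finite) (use sep in simp)
    also have "\<dots> \<le> hausdorff s X" by (rule hausdorff_mono) (auto simp: R_def Y_def)
    finally show "(\<Sum>i<n. hausdorff s (R (2 * i + c))) \<le> hausdorff s X" .
  qed auto
  have fin: "(\<Sum>i. hausdorff s (R i)) \<noteq> top"
  proof -
    have "(\<Sum>i<n. hausdorff s (R i)) \<le> hausdorff s X + hausdorff s X" for n
    proof -
      have "(\<Sum>i<n. hausdorff s (R i)) \<le> (\<Sum>i<2 * n. hausdorff s (R i))"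
        by (intro sum_mono2) auto
      also have "\<dots> = (\<Sum>i<n. hausdorff s (R (2 * i + 0))) + (\<Sum>i<n. hausdorff s (R (2 * i + 1)))"
        by (induction n) (auto simp: algebra_simps)
      also have "\<dots> \<le> (\<Sum>i. hausdorff s (R (2 * i + 0))) + (\<Sum>i. hausdorff s (R (2 * i + 1)))"
        by (intro add_mono sum_le_suminf) auto
      also have "\<dots> \<le> hausdorff s X + hausdorff s X" by (intro add_mono parity)
      finally show ?thesis .
    qed
    then have "(\<Sum>i. hausdorff s (R i)) \<le> hausdorff s X + hausdorff s X"
      by (intro suminf_le_const) auto
    then show ?thesis using False by (auto simp: top_unique)
  qed
  have XF: "X - F \<subseteq> Y k \<union> (\<Union>i. R (i + k))" for k
  proof
    fix x assume x: "x \<in> X - F"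
    then have "infdist x F > 0"
      using F by (metis DiffD2 in_closed_iff_infdist_zero infdist_nonneg less_eq_real_def)
    then obtain j where j: "1 / real (Suc j) < infdist x F"
      using reals_Archimedean[of "infdist x F"] by (auto simp: field_simps)
    have "x \<in> Y k \<union> (\<Union>i. R (i + k))" if "x \<in> Y (k + j)" for j
      using that
    proof (induction j)
      case (Suc j)
      show ?case
      proof (cases "x \<in> Y (k + j)")
        case False
        with Suc.prems have "x \<in> R (j + k)" by (simp add: R_def add.commute)
        then show ?thesis by blast
      qed (rule Suc.IH)
    qed auto
    moreover have "x \<in> Y (k + j)"
    proof -
      have "1 / real (Suc (k + j)) \<le> 1 / real (Suc j)" by (simp add: field_simps)
      then show ?thesis using x j by (auto simp: Y_def)
    qed
    ultimately show "x \<in> Y k \<union> (\<Union>i. R (i + k))" by blast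
  qed
  \<comment> \<open>\<open>Y k\<close> keeps distance \<open>1 / Suc k\<close> from
    \<open>F\<close>, so metric additivity applies to it; the rest of \<open>X - F\<close> lies in
    the tail of the shells, whose measure vanishes as \<open>k\<close> grows.\<close>
  have bound: "hausdorff s (X \<inter> F) + hausdorff s (X - F) \<le> hausdorff s X + (\<Sum>i. hausdorff s (R (i + k)))" for k
  proof -
    have "hausdorff s (X - F) \<le> hausdorff s (Y k) + hausdorff s (\<Union>i. R (i + k))"
      using hausdorff_mono[OF XF] hausdorff_Un_le order_trans by blast
    also have "\<dots> \<le> hausdorff s (Y k) + (\<Sum>i. hausdorff s (R (i + k)))"
      by (intro add_left_mono hausdorff_subadditive)
    finally have "hausdorff s (X \<inter> F) + hausdorff s (X - F)
        \<le> (hausdorff s (X \<inter> F) + hausdorff s (Y k)) + (\<Sum>i. hausdorff s (R (i + k)))"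
      by (simp add: add.assoc add_left_mono)
    also have "hausdorff s (X \<inter> F) + hausdorff s (Y k) \<le> hausdorff s (X \<inter> F \<union> Y k)"
    proof (rule hausdorff_metric_additive)
      show "0 < 1 / real (Suc k)" by simp
      fix a b assume "a \<in> X \<inter> F" "b \<in> Y k"
      then show "1 / real (Suc k) \<le> dist a b"
        using infdist_le[of a F b] by (auto simp: Y_def dist_commute)
    qed
    also have "\<dots> \<le> hausdorff s X" by (rule hausdorff_mono) (auto simp: Y_def)
    finally show ?thesis by (simp add: add_right_mono)
  qed
  have "(\<lambda>k. \<Sum>i. hausdorff s (R (i + k))) \<longlonglongrightarrow> 0"
  proof -
    define r where "r i = enn2real (hausdorff s (R i))" for i
    have "hausdorff s (R i) \<noteq> top" for i
      using fin by (metis ennreal_suminf_lessD less_top)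
    then have r: "hausdorff s (R i) = ennreal (r i)" "0 \<le> r i" for i
      by (auto simp: r_def less_top)
    have "summable r" using fin r by (intro summable_suminf_not_top) auto
    then have "(\<lambda>k. \<Sum>i. r (i + k)) \<longlonglongrightarrow> 0" by (rule suminf_exist_split2)
    then have "(\<lambda>k. ennreal (\<Sum>i. r (i + k))) \<longlonglongrightarrow> 0" by (simp add: tendsto_ennreal_iff flip: ennreal_0)
    moreover have "(\<Sum>i. hausdorff s (R (i + k))) = ennreal (\<Sum>i. r (i + k))" for k
      using \<open>summable r\<close> r by (simp add: suminf_ennreal2 summable_iff_shift)
    ultimately show ?thesis by simp
  qed
  then have "(\<lambda>k. hausdorff s X + (\<Sum>i. hausdorff s (R (i + k)))) \<longlonglongrightarrow> hausdorff s X + 0"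
    by (intro tendsto_intros) auto
  then show ?thesis using bound by (intro LIMSEQ_le_const) auto
qed simp

section \<open>Restriction of the outer measure to the Borel sets\<close>

definition hausdorff_measure :: "nat \<Rightarrow> 'a::metric_space measure" where
  "hausdorff_measure s = measure_of UNIV (sets borel) (hausdorff s)"

lemma sets_hausdorff_measure [simp, measurable_cong]: "sets (hausdorff_measure s) = sets borel"
  by (simp add: hausdorff_measure_def) (metis sets.sigma_sets_eq space_borel)

lemma space_hausdorff_measure [simp]: "space (hausdorff_measure s) = UNIV"
  by (simp add: hausdorff_measure_def)

text \<open>Closed sets split every set additively, so they lie in the Caratheodory sigma-algebra;
  hence so do all Borel sets, and the outer measure is countably additive there.\<close>

lemma emeasure_hausdorff_measure:
  assumes "A \<in> sets borel"
  shows "emeasure (hausdorff_measure s :: 'a::metric_space measure) A = hausdorff s A"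
proof -
  let ?L = "lambda_system UNIV UNIV (hausdorff s) :: 'a set set"
  have oms: "outer_measure_space UNIV (hausdorff s :: 'a set \<Rightarrow> ennreal)"
    by (auto simp: outer_measure_space_def positive_def increasing_def countably_subadditive_def
        hausdorff_empty hausdorff_subadditive intro: hausdorff_mono)
  interpret sigma_algebra UNIV "UNIV :: 'a set set" using sigma_algebra_Pow[of UNIV] by simp
  have ms: "measure_space UNIV ?L (hausdorff s)" by (rule caratheodory_lemma[OF oms])
  have "F \<in> ?L" if "closed F" for F
    unfolding lambda_system_def
  proof (clarsimp, rule antisym)
    fix X
    show "hausdorff s X \<le> hausdorff s (F \<inter> X) + hausdorff s ((UNIV - F) \<inter> X)"
      by (rule order_trans[OF hausdorff_mono hausdorff_Un_le]) auto
    show "hausdorff s (F \<inter> X) + hausdorff s ((UNIV - F) \<inter> X) \<le> hausdorff s X"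
    proof (cases "F = {}")
      case False
      moreover have "(UNIV - F) \<inter> X = X - F" by auto
      ultimately show ?thesis using hausdorff_closed_split[OF that False, of s X] by (simp add: Int_commute)
    qed (simp add: hausdorff_empty)
  qed
  then have "sigma_sets UNIV (Collect closed) \<subseteq> ?L"
    using ms by (intro sigma_algebra.sigma_sets_subset) (auto simp: measure_space_def)
  then have sub: "sets (borel :: 'a measure) \<subseteq> ?L" by (simp add: borel_eq_closed)
  have "measure_space UNIV (sets borel) (hausdorff s :: 'a set \<Rightarrow> ennreal)"
    by (rule measure_down[OF ms _ sub]) (metis sets.sigma_algebra_axioms space_borel)
  then show ?thesis unfolding hausdorff_measure_def
    by (intro emeasure_measure_of_sigma) (use assms in \<open>auto simp: measure_space_def\<close>)
qed

section \<open>Hyperplanes and cylinders\<close>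

text \<open>A form of uniqueness of Haar measure, covering both \<open>P = id\<close> and the projection \<open>P\<close> onto a
  hyperplane carrying \<open>M\<close>: in a double integral shift \<open>x\<close> by \<open>P y\<close>, then \<open>y\<close> by \<open>x\<close>.\<close>

lemma invariant_measure_times_lborel:
  fixes M :: "'a::euclidean_space measure" and P :: "'a \<Rightarrow> 'a"
  assumes "sigma_finite_measure M" and sets [measurable_cong, simp]: "sets M = sets borel"
    and P [measurable]: "P \<in> borel \<rightarrow>\<^sub>M borel"
    and inv: "\<And>z E. E \<in> sets borel \<Longrightarrow> emeasure M ((\<lambda>x. x + P z) -` E) = emeasure M E"
    and conc: "AE x in M. \<forall>y. P (x + y) = x + P y"
    and E [measurable]: "E \<in> sets borel" and C [measurable]: "C \<in> sets borel"
  shows "emeasure M E * emeasure lborel C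
       = (\<integral>\<^sup>+y. indicator E (P y) * emeasure M ((\<lambda>x. y - x) -` C) \<partial>lborel)"
proof -
  interpret M: sigma_finite_measure M by fact
  interpret Ml: pair_sigma_finite M lborel ..
  interpret lM: pair_sigma_finite lborel M ..
  have sp: "space M = UNIV" using sets_eq_imp_space_eq[OF sets] by simp
  have "emeasure M E * emeasure lborel C = (\<integral>\<^sup>+y. (\<integral>\<^sup>+x. indicator E (x + P y) * indicator C y \<partial>M) \<partial>lborel)"
  proof -
    have "(\<integral>\<^sup>+x. indicator E (x + P y) * indicator C y \<partial>M) = emeasure M E * indicator C y" for y
    proof -
      have "(\<integral>\<^sup>+x. indicator E (x + P y) * indicator C y \<partial>M) =
          (\<integral>\<^sup>+x. indicator ((\<lambda>x. x + P y) -` E) x \<partial>M) * indicator C y"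
        by (subst nn_integral_multc) (auto simp: indicator_def[abs_def])
      also have "(\<integral>\<^sup>+x. indicator ((\<lambda>x. x + P y) -` E) x \<partial>M) = emeasure M ((\<lambda>x. x + P y) -` E)"
        by (rule nn_integral_indicator) (use measurable_sets[of "\<lambda>x. x + P y" M borel E] sp in auto)
      finally show ?thesis using inv by simp
    qed
    then show ?thesis by (simp add: nn_integral_cmult)
  qed
  also have "\<dots> = (\<integral>\<^sup>+x. (\<integral>\<^sup>+y. indicator E (x + P y) * indicator C y \<partial>lborel) \<partial>M)"
    by (rule Ml.Fubini') measurable
  \<comment> \<open>For a measure carried by a hyperplane, \<open>P (x + y) = x + P y\<close> holds
    only for \<open>x\<close> in that hyperplane, hence the almost-everywhere form of the
    hypothesis.\<close>
  also have "\<dots> = (\<integral>\<^sup>+x. (\<integral>\<^sup>+y. indicator E (P y) * indicator C (y - x) \<partial>lborel) \<partial>M)"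
  proof (rule nn_integral_cong_AE, use conc in eventually_elim)
    fix x assume x: "\<forall>y. P (x + y) = x + P y"
    have "(\<integral>\<^sup>+y. indicator E (P y) * indicator C (y - x) \<partial>lborel)
        = (\<integral>\<^sup>+y. indicator E (P y) * indicator C (y - x) \<partial>distr lborel borel ((+) x))"
      using lborel_distr_plus[of x] by simp
    also have "\<dots> = (\<integral>\<^sup>+y. indicator E (P (x + y)) * indicator C (x + y - x) \<partial>lborel)"
      by (subst nn_integral_distr) auto
    finally show "(\<integral>\<^sup>+y. indicator E (x + P y) * indicator C y \<partial>lborel)
        = (\<integral>\<^sup>+y. indicator E (P y) * indicator C (y - x) \<partial>lborel)" using x by simp
  qed
  also have "\<dots> = (\<integral>\<^sup>+y. (\<integral>\<^sup>+x. indicator E (P y) * indicator C (y - x) \<partial>M) \<partial>lborel)"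
    by (rule lM.Fubini') measurable
  also have "\<dots> = (\<integral>\<^sup>+y. indicator E (P y) * emeasure M ((\<lambda>x. y - x) -` C) \<partial>lborel)"
  proof (rule nn_integral_cong)
    fix y :: 'a
    have "(\<integral>\<^sup>+x. indicator C (y - x) \<partial>M) = (\<integral>\<^sup>+x. indicator ((\<lambda>x. y - x) -` C) x \<partial>M)"
      by (simp add: indicator_def[abs_def])
    also have "\<dots> = emeasure M ((\<lambda>x. y - x) -` C)"
      by (rule nn_integral_indicator) (use measurable_sets[of "\<lambda>x. y - x" M borel C] sp in auto)
    finally show "(\<integral>\<^sup>+x. indicator E (P y) * indicator C (y - x) \<partial>M)
        = indicator E (P y) * emeasure M ((\<lambda>x. y - x) -` C)"
      by (subst nn_integral_cmult) auto
  qed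
  finally show ?thesis .
qed

lemma sigma_finite_measure_if_finite_on_cball:
  fixes M :: "'a::euclidean_space measure"
  assumes sets: "sets M = sets borel" and fin: "\<And>k. 0 \<le> k \<Longrightarrow> emeasure M (cball 0 k) \<noteq> \<infinity>"
  shows "sigma_finite_measure M"
proof
  show "\<exists>A. countable A \<and> A \<subseteq> sets M \<and> \<Union> A = space M \<and> (\<forall>a\<in>A. emeasure M a \<noteq> \<infinity>)"
  proof (intro exI[of _ "range (\<lambda>k::nat. cball 0 (real k))"] conjI)
    show "\<Union> (range (\<lambda>k::nat. cball 0 (real k))) = space M"
      using real_arch_simple sets_eq_imp_space_eq[OF sets] by (fastforce simp: dist_norm)
  qed (use sets fin in auto)
qed

text \<open>The image of Lebesgue measure under \<open>g\<close> is translation invariant, hence a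
  multiple of Lebesgue measure; the factor is 1 because preimages of unit balls under
  \<open>g\<close> are unit balls.\<close>

lemma emeasure_lborel_orthogonal_vimage:
  fixes g :: "'a::euclidean_space \<Rightarrow> 'a"
  assumes g: "orthogonal_transformation g" and E [measurable]: "E \<in> sets borel"
  shows "emeasure lborel (g -` E) = emeasure lborel E"
proof -
  have lin: "linear g" using g by (rule orthogonal_transformation_linear)
  have gm [measurable]: "g \<in> borel \<rightarrow>\<^sub>M borel"
    using linear_continuous_on[of g UNIV] lin
    by (intro borel_measurable_continuous_onI) (simp add: linear_conv_bounded_linear)
  have norm_g: "norm (g x) = norm x" for x using g by (rule orthogonal_transformation_norm)
  have surj: "surj g" using g by (rule orthogonal_transformation_surj)
  let ?M = "distr lborel borel g"
  have sf: "sigma_finite_measure ?M"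
  proof (rule sigma_finite_measure_if_finite_on_cball)
    have "g -` cball 0 k = cball 0 k" for k by (auto simp: norm_g)
    then show "emeasure ?M (cball 0 k) \<noteq> \<infinity>" for k
      using emeasure_lborel_cball_finite[of "0::'a" k] by (simp add: emeasure_distr)
  qed simp
  have "emeasure ?M E * emeasure lborel (ball (0::'a) 1) =
      (\<integral>\<^sup>+y. indicator E (id y) * emeasure ?M ((\<lambda>x. y - x) -` ball 0 1) \<partial>lborel)"
  proof (rule invariant_measure_times_lborel[OF sf, where P = id])
    fix z :: 'a and A :: "'a set" assume A [measurable]: "A \<in> sets borel"
    obtain w where w: "z = g w" using surj by (metis surjD)
    have "emeasure ?M ((\<lambda>x. x + id z) -` A) = emeasure lborel ((\<lambda>x. w + x) -` (g -` A))"
      using measurable_sets[of "\<lambda>x. x + z" borel borel A]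
      by (simp add: emeasure_distr vimage_def w linear_add[OF lin] add.commute)
    also have "\<dots> = emeasure (distr lborel borel ((+) w)) (g -` A)"
      by (subst emeasure_distr) (use measurable_sets[OF gm A] in auto)
    also have "\<dots> = emeasure ?M A"
      by (simp add: lborel_distr_plus emeasure_distr)
    finally show "emeasure ?M ((\<lambda>x. x + id z) -` A) = emeasure ?M A" .
  qed auto
  also have "\<dots> = emeasure lborel E * emeasure lborel (ball (0::'a) 1)"
  proof -
    have "emeasure ?M ((\<lambda>x. y - x) -` ball 0 1) = emeasure lborel (ball (0::'a) 1)" for y
    proof -
      obtain w where w: "y = g w" using surj by (metis surjD)
      have b: "(\<lambda>x. y - x) -` ball 0 1 = ball y 1" by (auto simp: dist_norm norm_minus_commute)
      have "g -` ball y 1 = ball w 1"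
        by (auto simp: w dist_norm norm_g simp flip: linear_diff[OF lin])
      then show ?thesis unfolding b by (simp add: emeasure_distr emeasure_ball)
    qed
    then show ?thesis by (simp add: nn_integral_multc)
  qed
  finally have "emeasure lborel (g -` E) * emeasure lborel (ball (0::'a) 1)
      = emeasure lborel E * emeasure lborel (ball (0::'a) 1)"
    by (simp add: emeasure_distr)
  then show ?thesis
    using ennreal_mult_cancel_left[of "emeasure lborel (ball (0::'a) 1)" "emeasure lborel (g -` E)" "emeasure lborel E"]
    by (simp add: mult.commute emeasure_ball) (metis unit_ball_vol_pos of_nat_0_le_iff less_irrefl)
qed

section \<open>Projection along a unit vector and volumes of cylinders\<close>

definition hyp_proj :: "'a::real_inner \<Rightarrow> 'a \<Rightarrow> 'a" where
  "hyp_proj v x = x - (x \<bullet> v) *\<^sub>R v"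

lemma linear_hyp_proj: "linear (hyp_proj v)"
  by (rule linearI) (auto simp: hyp_proj_def algebra_simps inner_add_left)

lemma continuous_hyp_proj [continuous_intros]:
  "continuous_on A f \<Longrightarrow> continuous_on A (\<lambda>x. hyp_proj v (f x))"
  unfolding hyp_proj_def by (intro continuous_intros)

lemma borel_measurable_hyp_proj [measurable]:
  "hyp_proj (v :: 'a::euclidean_space) \<in> borel \<rightarrow>\<^sub>M borel"
  by (intro borel_measurable_continuous_onI continuous_intros)

lemma hyp_proj_inner: "norm v = 1 \<Longrightarrow> hyp_proj v x \<bullet> v = 0"
  by (simp add: hyp_proj_def inner_diff_left norm_eq_1)

lemma norm_hyp_proj_le: "norm v = 1 \<Longrightarrow> norm (hyp_proj v x) \<le> norm x"
proof -
  assume v: "norm v = 1"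
  have "hyp_proj v x \<bullet> hyp_proj v x = x \<bullet> x - (x \<bullet> v) * (x \<bullet> v)"
    using v by (simp add: hyp_proj_def norm_eq_1 inner_diff_left inner_diff_right inner_commute)
  then show ?thesis by (simp add: norm_le)
qed

lemma hyp_proj_fixes: "x \<bullet> v = 0 \<Longrightarrow> hyp_proj v x = x"
  by (simp add: hyp_proj_def)

lemma hyp_proj_self: "norm v = 1 \<Longrightarrow> hyp_proj v v = 0"
  by (simp add: hyp_proj_def norm_eq_1)

lemma hyp_proj_decompose: "hyp_proj v x + (x \<bullet> v) *\<^sub>R v = x"
  by (simp add: hyp_proj_def)

text \<open>An orthogonal map carrying a coordinate axis to \<open>v\<close> conjugates the stretch
  along \<open>v\<close> into a diagonal map with determinant \<open>s\<close>.\<close>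

lemma emeasure_lborel_stretch_direction:
  fixes v :: "real ^ 'n"
  assumes v: "norm v = 1" and s: "0 < s" and E [measurable]: "E \<in> sets borel"
  shows "emeasure lborel E = ennreal s * emeasure lborel ((\<lambda>x. hyp_proj v x + (s * (x \<bullet> v)) *\<^sub>R v) -` E)"
proof -
  obtain k :: 'n where True by simp
  let ?b = "axis k 1 :: real ^ 'n"
  have b: "?b \<in> Basis" "norm ?b = 1" by (auto simp: axis_in_Basis_iff)
  obtain g where g: "orthogonal_transformation g" "g ?b = v"
    using orthogonal_transformation_exists_1[OF b(2) v] by blast
  have lin: "linear g" using g(1) by (rule orthogonal_transformation_linear)
  have gm [measurable]: "g \<in> borel \<rightarrow>\<^sub>M borel"
    using linear_continuous_on[of g UNIV] lin
    by (intro borel_measurable_continuous_onI) (simp add: linear_conv_bounded_linear)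
  \<comment> \<open>The leading \<open>0 +\<close> and the sum over \<open>Basis\<close> give
    \<open>D\<close> the shape of \<open>lborel_affine_euclidean\<close>.\<close>
  define D where "D x = 0 + (\<Sum>j\<in>Basis. ((if j = ?b then s else 1) * (x \<bullet> j)) *\<^sub>R j)" for x :: "real ^ 'n"
  have D: "D x = x + ((s - 1) * (x \<bullet> ?b)) *\<^sub>R ?b" for x
  proof -
    have "D x = (\<Sum>j\<in>Basis. (x \<bullet> j) *\<^sub>R j + (if j = ?b then ((s - 1) * (x \<bullet> j)) *\<^sub>R j else 0))"
      unfolding D_def by (auto intro!: sum.cong simp: algebra_simps)
    also have "\<dots> = (\<Sum>j\<in>Basis. (x \<bullet> j) *\<^sub>R j) + ((s - 1) * (x \<bullet> ?b)) *\<^sub>R ?b"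
      using b(1) by (simp add: sum.distrib)
    finally show ?thesis by (simp add: euclidean_representation)
  qed
  have Dm [measurable]: "D \<in> borel \<rightarrow>\<^sub>M borel" unfolding D by measurable
  have stretch: "emeasure lborel F = ennreal s * emeasure lborel (D -` F)" if F [measurable]: "F \<in> sets borel" for F
  proof -
    have "lborel = density (distr lborel borel D) (\<lambda>_. ennreal (\<Prod>j\<in>Basis. \<bar>if j = ?b then s else 1\<bar>))"
      unfolding D_def by (rule lborel_affine_euclidean) (use s in auto)
    also have "(\<Prod>j\<in>Basis. \<bar>if j = ?b then s else 1\<bar>) = s"
      using s b(1) by (subst prod.remove[OF _ b(1)]) (auto intro!: prod.neutral)
    finally have "emeasure lborel F = emeasure (density (distr lborel borel D) (\<lambda>_. ennreal s)) F" by simp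
    also have "\<dots> = ennreal s * emeasure (distr lborel borel D) F"
      by (subst emeasure_density_const) auto
    finally show ?thesis by (simp add: emeasure_distr)
  qed
  have eq: "(\<lambda>x. hyp_proj v x + (s * (x \<bullet> v)) *\<^sub>R v) (g y) = g (D y)" for y
  proof -
    have "g y \<bullet> v = y \<bullet> ?b"
      using g by (metis orthogonal_transformation_def)
    then show ?thesis
      by (simp add: D hyp_proj_def linear_add[OF lin] linear_cmul[OF lin] linear_diff[OF lin] g(2) algebra_simps)
  qed
  let ?f = "\<lambda>x. hyp_proj v x + (s * (x \<bullet> v)) *\<^sub>R v"
  have fm: "?f -` E \<in> sets borel"
    using measurable_sets[of ?f borel borel E] by simp
  have "emeasure lborel (?f -` E) = emeasure lborel (g -` (?f -` E))"
    by (rule emeasure_lborel_orthogonal_vimage[OF g(1) fm, symmetric])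
  also have "g -` (?f -` E) = D -` (g -` E)" using eq by auto
  finally have "ennreal s * emeasure lborel (?f -` E) = emeasure lborel (g -` E)"
    using stretch[of "g -` E"] measurable_sets[OF gm E] by simp
  then show ?thesis by (simp add: emeasure_lborel_orthogonal_vimage[OF g(1) E])
qed

text \<open>A stretch by \<open>e / d\<close> along \<open>v\<close> followed by a homothety of
  ratio \<open>d\<close>. Every later change of variables for volumes is an instance: discs to unit
  discs, slabs to cylinders of height 1, dilations, and the lower volume bound.\<close>

lemma emeasure_lborel_affine_direction:
  fixes v a :: "real ^ 'n"
  assumes v: "norm v = 1" and d: "0 < d" and e: "0 < e" and E [measurable]: "E \<in> sets borel"
  shows "emeasure lborel E = ennreal (d ^ (CARD('n) - 1) * e) *
      emeasure lborel ((\<lambda>x. a + d *\<^sub>R hyp_proj v x + (e * (x \<bullet> v)) *\<^sub>R v) -` E)"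
proof -
  let ?T = "\<lambda>x. a + d *\<^sub>R x"
  let ?L = "\<lambda>x. hyp_proj v x + ((e / d) * (x \<bullet> v)) *\<^sub>R v"
  have vm: "?T -` E \<in> sets borel" using measurable_sets[of ?T borel borel E] by simp
  have "emeasure lborel E = emeasure (density (distr lborel borel ?T) (\<lambda>_. \<bar>d\<bar> ^ DIM(real ^ 'n))) E"
    using lborel_affine[of d a] d by (metis less_irrefl)
  also have "\<dots> = ennreal (d ^ CARD('n)) * emeasure lborel (?T -` E)"
    using d by (subst emeasure_density_const) (auto simp: emeasure_distr)
  also have "emeasure lborel (?T -` E) = ennreal (e / d) * emeasure lborel (?L -` (?T -` E))"
    by (rule emeasure_lborel_stretch_direction[OF v _ vm]) (use d e in simp)
  also have "?L -` (?T -` E) = (\<lambda>x. a + d *\<^sub>R hyp_proj v x + (e * (x \<bullet> v)) *\<^sub>R v) -` E"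
    using d by (auto simp: scaleR_add_right add.assoc)
  also have "ennreal (d ^ CARD('n)) * (ennreal (e / d) * X) = ennreal (d ^ (CARD('n) - 1) * e) * X" for X
  proof -
    have "d ^ CARD('n) * (e / d) = d ^ (CARD('n) - 1) * e"
      using d by (cases "CARD('n)") auto
    then show ?thesis using d e by (simp add: mult.assoc[symmetric] flip: ennreal_mult)
  qed
  finally show ?thesis .
qed

text \<open>Areas inside the hyperplane orthogonal to \<open>v\<close> are measured by the full-dimensional volume of the
  cylinder of height 1 over them.\<close>

definition cylinder :: "'a::real_inner \<Rightarrow> 'a set \<Rightarrow> 'a set" where
  "cylinder v E = {y. 0 < y \<bullet> v \<and> y \<bullet> v \<le> 1 \<and> hyp_proj v y \<in> E}"

lemma cylinder_borel [measurable]: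
  fixes v :: "'a::euclidean_space"
  assumes [measurable]: "E \<in> sets borel"
  shows "cylinder v E \<in> sets borel"
  unfolding cylinder_def by measurable

lemma emeasure_cylinder_cball:
  fixes v x :: "real ^ 'n"
  assumes v: "norm v = 1" and x: "x \<bullet> v = 0" and d: "0 < d"
  shows "emeasure lborel (cylinder v (cball x d)) =
    ennreal (d ^ (CARD('n) - 1)) * emeasure lborel (cylinder v (cball 0 1))"
proof -
  let ?f = "\<lambda>y. x + d *\<^sub>R hyp_proj v y + (y \<bullet> v) *\<^sub>R v"
  have "?f -` cylinder v (cball x d) = cylinder v (cball 0 1)"
  proof -
    have 1: "?f y \<bullet> v = y \<bullet> v" for y
      using v x by (simp add: inner_add_left hyp_proj_inner norm_eq_1 del: add.commute)
    have "hyp_proj v (?f y) = x + d *\<^sub>R hyp_proj v y" for y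
      unfolding hyp_proj_def[of v "?f y"] 1 by simp
    then have "norm (x - hyp_proj v (?f y)) = d * norm (hyp_proj v y)" for y
      using d by simp
    then show ?thesis using d unfolding cylinder_def vimage_def mem_Collect_eq 1 by (simp add: dist_norm)
  qed
  then show ?thesis
    using emeasure_lborel_affine_direction[OF v d, of 1 "cylinder v (cball x d)" x] by simp
qed

lemma bounded_cylinder:
  assumes "norm v = 1" "bounded E"
  shows "bounded (cylinder v E)"
proof -
  obtain B where B: "\<And>x. x \<in> E \<Longrightarrow> norm x \<le> B" using assms(2) by (auto simp: bounded_iff)
  have "norm y \<le> B + 1" if "y \<in> cylinder v E" for y
  proof -
    have "norm y = norm (hyp_proj v y + (y \<bullet> v) *\<^sub>R v)" by (simp add: hyp_proj_decompose)
    also have "\<dots> \<le> norm (hyp_proj v y) + \<bar>y \<bullet> v\<bar>"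
      using norm_triangle_ineq[of "hyp_proj v y" "(y \<bullet> v) *\<^sub>R v"] assms(1) by simp
    also have "\<dots> \<le> B + 1" using that B by (intro add_mono) (auto simp: cylinder_def)
    finally show ?thesis .
  qed
  then show ?thesis by (auto simp: bounded_iff)
qed

lemma emeasure_unit_cylinder:
  fixes v :: "'a::euclidean_space"
  assumes v: "norm v = 1"
  shows "emeasure lborel (cylinder v (cball 0 1)) \<noteq> 0" "emeasure lborel (cylinder v (cball 0 1)) \<noteq> \<infinity>"
proof -
  let ?z = "(1/2) *\<^sub>R v"
  have "ball ?z (1/2) \<subseteq> cylinder v (cball 0 1)"
  proof
    fix y assume "y \<in> ball ?z (1/2)"
    then have n: "norm (y - ?z) < 1/2" by (simp add: dist_norm norm_minus_commute)
    have "\<bar>(y - ?z) \<bullet> v\<bar> < 1/2" using Cauchy_Schwarz_ineq2[of "y - ?z" v] n v by simp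
    then have "\<bar>y \<bullet> v - 1/2\<bar> < 1/2" using v by (simp add: inner_diff_left norm_eq_1)
    then have "0 < y \<bullet> v" "y \<bullet> v \<le> 1" by linarith+
    moreover have "hyp_proj v y = hyp_proj v (y - ?z)"
      using v by (simp add: linear_diff[OF linear_hyp_proj] linear_cmul[OF linear_hyp_proj] hyp_proj_self)
    then have "norm (hyp_proj v y) \<le> 1" using norm_hyp_proj_le[OF v, of "y - ?z"] n by simp
    ultimately show "y \<in> cylinder v (cball 0 1)" by (simp add: cylinder_def)
  qed
  then have "emeasure lborel (ball ?z (1/2)) \<le> emeasure lborel (cylinder v (cball 0 1))"
    by (rule emeasure_mono) simp
  moreover have "emeasure lborel (ball ?z (1/2)) \<noteq> 0"
    by (simp add: emeasure_ball ennreal_eq_0_iff not_le)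
  ultimately show "emeasure lborel (cylinder v (cball 0 1)) \<noteq> 0" by auto
  show "emeasure lborel (cylinder v (cball 0 1)) \<noteq> \<infinity>"
    using emeasure_bounded_finite[OF bounded_cylinder[OF v, of "cball 0 1"]] by auto
qed

section \<open>Hausdorff measure on hyperplanes\<close>

lemma hausdorff_content_translation_le:
  fixes a :: "'a::real_normed_vector"
  shows "hausdorff_content s \<delta> ((+) a ` A) \<le> hausdorff_content s \<delta> A"
  unfolding hausdorff_content_alt[of s \<delta> A]
proof (rule INF_greatest)
  fix U assume U: "U \<in> hausdorff_covers \<delta> A"
  have diam: "diameter ((+) a ` U i) \<le> diameter (U i)" for i
  proof (cases "U i = {}")
    case False
    then show ?thesis
      using diameter_bounded_bound[of "U i"] U
      by (intro diameter_le) (auto simp: hausdorff_covers_def dist_norm)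
  qed simp
  have cov: "(\<lambda>i. (+) a ` U i) \<in> hausdorff_covers \<delta> ((+) a ` A)"
  proof -
    have "diameter ((+) a ` U i) \<le> \<delta>" for i
      using diam[of i] U by (auto simp: hausdorff_covers_def intro: order_trans)
    moreover have "(+) a ` A \<subseteq> (\<Union>i. (+) a ` U i)"
      using U unfolding hausdorff_covers_def image_UN[symmetric] by (intro image_mono) simp
    ultimately show ?thesis using U by (simp add: hausdorff_covers_def bounded_translation)
  qed
  have "hausdorff_weight s ((+) a ` U i) \<le> hausdorff_weight s (U i)" for i
  proof -
    have "bounded ((+) a ` U i)" using cov by (auto simp: hausdorff_covers_def)
    then show ?thesis
      using diam[of i] diameter_ge_0[of "(+) a ` U i"]
      by (auto simp: hausdorff_weight_def intro!: ennreal_leI mult_left_mono power_mono)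
  qed
  then have "(\<Sum>i. hausdorff_weight s ((+) a ` U i)) \<le> (\<Sum>i. hausdorff_weight s (U i))"
    by (intro suminf_le) auto
  with hausdorff_content_le[OF cov] show "hausdorff_content s \<delta> ((+) a ` A) \<le> (\<Sum>i. hausdorff_weight s (U i))"
    by (rule order_trans)
qed

lemma hausdorff_translation:
  fixes a :: "'a::real_normed_vector"
  shows "hausdorff s ((+) a ` A) = hausdorff s A"
proof -
  have le: "hausdorff s ((+) b ` B) \<le> hausdorff s B" for b and B :: "'a set"
    by (intro hausdorff_leI order_trans[OF hausdorff_content_translation_le] hausdorff_content_le_hausdorff)
  have "(+) (- a) ` (+) a ` A = A" by (force simp: image_image)
  then show ?thesis using le[of a A] le[of "- a" "(+) a ` A"] by (simp add: antisym)
qed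

text \<open>Covering sets may be single points, so radius 0 has to be allowed. Then the right-hand
  side is 0, and the cylinder is a segment, which lies in a hyperplane since the dimension is at
  least 2.\<close>

lemma emeasure_cylinder_cball_le:
  fixes v x :: "real ^ 'n"
  assumes n: "CARD('n) \<ge> 2" and v: "norm v = 1" and x: "x \<bullet> v = 0" and d: "0 \<le> d"
  shows "emeasure lborel (cylinder v (cball x d)) \<le>
    ennreal (d ^ (CARD('n) - 1)) * emeasure lborel (cylinder v (cball 0 1))"
proof (cases "d = 0")
  case True
  obtain b where b: "b \<noteq> 0" "orthogonal v b"
    using orthogonal_to_vector_exists[of v] n by auto
  have "cylinder v (cball x d) \<subseteq> {y. b \<bullet> y = b \<bullet> x}"
  proof
    fix y assume "y \<in> cylinder v (cball x d)"
    then have "hyp_proj v y = x" using True by (simp add: cylinder_def)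
    then have "b \<bullet> x = b \<bullet> (y - (y \<bullet> v) *\<^sub>R v)" by (simp add: hyp_proj_def)
    then show "y \<in> {y. b \<bullet> y = b \<bullet> x}" using b(2) by (simp add: inner_diff_right orthogonal_def inner_commute)
  qed
  then have "negligible (cylinder v (cball x d))"
    using negligible_hyperplane[of b "b \<bullet> x"] b(1) negligible_subset by blast
  then have "emeasure lborel (cylinder v (cball x d)) = 0"
    by (auto simp: negligible_iff_null_sets null_sets_completion_iff)
  then show ?thesis by simp
qed (use emeasure_cylinder_cball[OF v x] d in simp)

text \<open>Packing against covering: the cylinders over balls of radius \<open>\<delta> / 3\<close>
  around a \<open>\<delta>\<close>-separated set are disjoint, so their volume bounds its
  cardinality; the balls of radius \<open>\<delta>\<close> around a largest such set cover the disc.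
  The resulting bound is independent of \<open>\<delta>\<close>.\<close>

lemma hausdorff_hyperplane_cball_finite:
  fixes v :: "real ^ 'n"
  assumes v: "norm v = 1" and r: "0 \<le> r"
  shows "hausdorff (CARD('n) - 1) ({x. x \<bullet> v = 0} \<inter> cball 0 r) < \<infinity>"
proof -
  let ?m = "CARD('n) - 1"
  let ?D = "{x. x \<bullet> v = 0} \<inter> cball 0 r"
  let ?C = "cylinder v (cball 0 1) :: (real ^ 'n) set"
  let ?w = "unit_ball_vol (real ?m)"
  \<comment> \<open>The 3 comes from the packing radius \<open>\<delta> / 3\<close>;
    \<open>r + 1\<close> leaves room for the packed balls, as
    \<open>\<delta> \<le> 1\<close>.\<close>
  define B where "B = ?w * (3 * (r + 1)) ^ ?m"
  have B: "hausdorff_content ?m (2 * \<delta>) ?D \<le> ennreal B" if \<delta>: "0 < \<delta>" "\<delta> \<le> 1" for \<delta>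
  proof -
    define separated where "separated X \<longleftrightarrow> finite X \<and> X \<subseteq> ?D \<and> (\<forall>x\<in>X. \<forall>y\<in>X. x \<noteq> y \<longrightarrow> \<delta> < dist x y)" for X
    have card_le: "real (card X) * \<delta> ^ ?m \<le> (3 * (r + 1)) ^ ?m" if X: "separated X" for X
    proof -
      have fin: "finite X" and XD: "X \<subseteq> ?D" using X by (auto simp: separated_def)
      have disj: "disjoint_family_on (\<lambda>x. cylinder v (cball x (\<delta> / 3))) X"
        unfolding disjoint_family_on_def
      proof (intro ballI impI equals0I)
        fix x y z assume xy: "x \<in> X" "y \<in> X" "x \<noteq> y"
          and z: "z \<in> cylinder v (cball x (\<delta> / 3)) \<inter> cylinder v (cball y (\<delta> / 3))"
        have "dist x y \<le> dist x (hyp_proj v z) + dist y (hyp_proj v z)" by (rule dist_triangle2)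
        also have "\<dots> \<le> \<delta> / 3 + \<delta> / 3" using z by (intro add_mono) (auto simp: cylinder_def)
        finally show False using xy X \<delta> by (force simp: separated_def)
      qed
      have sub: "(\<Union>x\<in>X. cylinder v (cball x (\<delta> / 3))) \<subseteq> cylinder v (cball 0 (r + 1))"
      proof
        fix z assume "z \<in> (\<Union>x\<in>X. cylinder v (cball x (\<delta> / 3)))"
        then obtain x where x: "x \<in> X" "z \<in> cylinder v (cball x (\<delta> / 3))" by auto
        then have "norm x \<le> r" using XD by auto
        moreover have "norm (hyp_proj v z) \<le> norm x + dist x (hyp_proj v z)"
          by (metis dist_norm norm_minus_commute norm_triangle_sub add.commute)
        moreover have "dist x (hyp_proj v z) \<le> \<delta> / 3" using x(2) by (simp add: cylinder_def)
        ultimately have "norm (hyp_proj v z) \<le> r + 1" using \<delta> by linarith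
        then show "z \<in> cylinder v (cball 0 (r + 1))" using x(2) by (simp add: cylinder_def)
      qed
      have "ennreal (real (card X) * (\<delta> / 3) ^ ?m) * emeasure lborel ?C
          = (\<Sum>x\<in>X. emeasure lborel (cylinder v (cball x (\<delta> / 3))))"
      proof -
        have "emeasure lborel (cylinder v (cball x (\<delta> / 3))) = ennreal ((\<delta> / 3) ^ ?m) * emeasure lborel ?C"
          if "x \<in> X" for x
          using emeasure_cylinder_cball[OF v, of x "\<delta> / 3"] that XD \<delta> by auto
        then show ?thesis using \<delta> by (simp add: ennreal_mult ennreal_of_nat_eq_real_of_nat mult.assoc)
      qed
      also have "\<dots> = emeasure lborel (\<Union>x\<in>X. cylinder v (cball x (\<delta> / 3)))"
        by (rule sum_emeasure[OF _ disj fin]) auto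
      also have "\<dots> \<le> emeasure lborel (cylinder v (cball 0 (r + 1)))"
        by (rule emeasure_mono[OF sub]) simp
      also have "\<dots> = ennreal ((r + 1) ^ ?m) * emeasure lborel ?C"
        by (rule emeasure_cylinder_cball[OF v]) (use r in auto)
      finally have "ennreal (real (card X) * (\<delta> / 3) ^ ?m) * emeasure lborel ?C \<le> ennreal ((r + 1) ^ ?m) * emeasure lborel ?C" .
      moreover obtain c where c: "emeasure lborel ?C = ennreal c" "c > 0"
        using emeasure_unit_cylinder[OF v] by (cases "emeasure lborel ?C") (auto simp: less_le)
      ultimately have "real (card X) * (\<delta> / 3) ^ ?m * c \<le> (r + 1) ^ ?m * c"
        using \<delta> r by (simp flip: ennreal_mult add: ennreal_le_iff)
      then have "real (card X) * (\<delta> / 3) ^ ?m \<le> (r + 1) ^ ?m" using c(2) by simp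
      then have "real (card X) * \<delta> ^ ?m \<le> 3 ^ ?m * (r + 1) ^ ?m"
        by (simp add: power_divide field_simps)
      then show ?thesis by (simp only: power_mult_distrib)
    qed
    have "separated {}" by (simp add: separated_def)
    moreover have "\<forall>X. separated X \<longrightarrow> card X < Suc (nat \<lceil>(3 * (r + 1)) ^ ?m / \<delta> ^ ?m\<rceil>)"
    proof (intro allI impI)
      fix X assume "separated X"
      then have "real (card X) \<le> (3 * (r + 1)) ^ ?m / \<delta> ^ ?m"
        using card_le[of X] \<delta> by (simp add: field_simps)
      then show "card X < Suc (nat \<lceil>(3 * (r + 1)) ^ ?m / \<delta> ^ ?m\<rceil>)" by linarith
    qed
    ultimately obtain X where X: "separated X" "\<And>Y. separated Y \<Longrightarrow> card Y \<le> card X"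
      using ex_has_greatest_nat[of separated "{}" card] by metis
    have cover: "\<exists>y\<in>X. dist y x \<le> \<delta>" if x: "x \<in> ?D" for x
    proof (rule ccontr)
      assume "\<not> ?thesis"
      then have far: "\<And>y. y \<in> X \<Longrightarrow> \<delta> < dist y x" by force
      then have "x \<notin> X" using \<delta> by force
      moreover have "separated (insert x X)"
        using X(1) x far by (auto simp: separated_def dist_commute)
      ultimately show False using X(2)[of "insert x X"] X(1) by (simp add: separated_def)
    qed
    obtain f where f: "bij_betw f {0..<card X} X"
      using X(1) ex_bij_betw_nat_finite[of X] by (auto simp: separated_def)
    define U where "U i = (if i < card X then cball (f i) \<delta> else {})" for i
    have "U \<in> hausdorff_covers (2 * \<delta>) ?D"
    proof -
      have "x \<in> (\<Union>i. U i)" if x: "x \<in> ?D" for x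
      proof -
        obtain y where y: "y \<in> X" "dist y x \<le> \<delta>" using cover[OF x] by auto
        have "y \<in> f ` {0..<card X}" using bij_betw_imp_surj_on[OF f] y(1) by simp
        then obtain i where "i < card X" "f i = y" by auto
        then have "x \<in> U i" using y by (simp add: U_def)
        then show ?thesis by blast
      qed
      then show ?thesis using \<delta> by (auto simp: hausdorff_covers_def U_def diameter_cball)
    qed
    then have "hausdorff_content ?m (2 * \<delta>) ?D \<le> (\<Sum>i. hausdorff_weight ?m (U i))"
      by (rule hausdorff_content_le)
    also have "\<dots> = (\<Sum>i<card X. hausdorff_weight ?m (U i))"
      by (rule suminf_finite) (auto simp: U_def hausdorff_weight_def)
    also have "\<dots> = (\<Sum>i<card X. ennreal (?w * \<delta> ^ ?m))"
      using \<delta> by (intro sum.cong) (auto simp: U_def hausdorff_weight_def diameter_cball)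
    also have "\<dots> = ennreal (?w * (real (card X) * \<delta> ^ ?m))"
      using \<delta> by (simp add: ennreal_of_nat_eq_real_of_nat mult_ac flip: ennreal_mult)
    also have "\<dots> \<le> ennreal B"
      unfolding B_def by (intro ennreal_leI mult_left_mono card_le X) simp
    finally show ?thesis .
  qed
  have "hausdorff ?m ?D \<le> ennreal B"
  proof (rule hausdorff_leI)
    fix \<delta> :: real assume "0 < \<delta>"
    have "hausdorff_content ?m \<delta> ?D \<le> hausdorff_content ?m (2 * min (\<delta> / 2) 1) ?D"
      by (rule hausdorff_content_antimono) simp
    also have "\<dots> \<le> ennreal B" by (rule B) (use \<open>0 < \<delta>\<close> in auto)
    finally show "hausdorff_content ?m \<delta> ?D \<le> ennreal B" .
  qed
  also have "\<dots> < \<infinity>" by simp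
  finally show ?thesis .
qed

text \<open>A cover of the disc by sets of diameters \<open>d i\<close> yields a cover of the unit
  cylinder by cylinders over balls of radii \<open>d i\<close>; comparing volumes shows that the
  powers of the \<open>d i\<close> sum to at least 1.\<close>

lemma hausdorff_hyperplane_cball_pos:
  fixes v :: "real ^ 'n"
  assumes n: "CARD('n) \<ge> 2" and v: "norm v = 1"
  shows "hausdorff (CARD('n) - 1) ({x. x \<bullet> v = 0} \<inter> cball 0 1) \<noteq> 0"
proof -
  let ?m = "CARD('n) - 1"
  let ?D = "{x. x \<bullet> v = 0} \<inter> cball 0 1"
  let ?C = "cylinder v (cball 0 1) :: (real ^ 'n) set"
  define w where "w = unit_ball_vol (real ?m) / 2 ^ ?m"
  have w: "0 < w" by (simp add: w_def)
  have "ennreal w \<le> hausdorff_content ?m 1 ?D"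
    unfolding hausdorff_content_alt
  proof (rule INF_greatest)
    fix U assume U: "U \<in> hausdorff_covers 1 ?D"
    define e where "e i = (if U i = {} then 0 else ennreal (diameter (U i) ^ ?m))" for i
    have weight: "hausdorff_weight ?m (U i) = ennreal w * e i" for i
    proof -
      have "bounded (U i)" using U by (simp add: hausdorff_covers_def)
      then show ?thesis using diameter_ge_0[of "U i"]
        by (auto simp: hausdorff_weight_def e_def w_def power_divide simp flip: ennreal_mult)
    qed
    \<comment> \<open>A covering set may leave the hyperplane; its chosen point is projected back,
      which does not increase distances to points of the disc.\<close>
    define c where "c i = (if U i = {} then {} else
        cylinder v (cball (hyp_proj v (SOME x. x \<in> U i)) (diameter (U i))))" for i
    have c_le: "emeasure lborel (c i) \<le> e i * emeasure lborel ?C" for i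
      unfolding c_def e_def
      using emeasure_cylinder_cball_le[OF n v] hyp_proj_inner[OF v] diameter_ge_0[of "U i"] U
      by (auto simp: hausdorff_covers_def)
    have "?C \<subseteq> (\<Union>i. c i)"
    proof
      fix y assume y: "y \<in> ?C"
      let ?p = "hyp_proj v y"
      have "?p \<in> ?D" using y hyp_proj_inner[OF v] by (auto simp: cylinder_def)
      then obtain i where i: "?p \<in> U i" using U by (auto simp: hausdorff_covers_def)
      define x where "x = (SOME x. x \<in> U i)"
      have x: "x \<in> U i" unfolding x_def using i by (rule someI)
      have "?p \<bullet> v = 0" by (rule hyp_proj_inner[OF v])
      then have "dist (hyp_proj v x) ?p = norm (hyp_proj v (x - ?p))"
        by (simp add: dist_norm linear_diff[OF linear_hyp_proj] hyp_proj_fixes)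
      also have "\<dots> \<le> dist x ?p" using norm_hyp_proj_le[OF v] by (simp add: dist_norm)
      also have "\<dots> \<le> diameter (U i)"
        using U x i by (intro diameter_bounded_bound) (auto simp: hausdorff_covers_def)
      finally have "y \<in> c i" using y i by (auto simp: c_def cylinder_def x_def)
      then show "y \<in> (\<Union>i. c i)" by blast
    qed
    then have "emeasure lborel ?C \<le> emeasure lborel (\<Union>i. c i)"
      by (rule emeasure_mono) (auto simp: c_def)
    also have "\<dots> \<le> (\<Sum>i. emeasure lborel (c i))"
      by (rule emeasure_subadditive_countably) (auto simp: c_def)
    also have "\<dots> \<le> (\<Sum>i. e i * emeasure lborel ?C)" by (intro suminf_le c_le) auto
    also have "\<dots> = (\<Sum>i. e i) * emeasure lborel ?C" by simp
    finally have "1 * emeasure lborel ?C \<le> (\<Sum>i. e i) * emeasure lborel ?C" by simp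
    then have "1 \<le> (\<Sum>i. e i)"
      using emeasure_unit_cylinder[OF v] ennreal_mult_le_mult_iff[of "emeasure lborel ?C" 1 "\<Sum>i. e i"]
      by (simp add: mult.commute)
    then have "ennreal w * 1 \<le> ennreal w * (\<Sum>i. e i)" by (rule mult_left_mono) simp
    then show "ennreal w \<le> (\<Sum>i. hausdorff_weight ?m (U i))"
      by (simp only: weight ennreal_suminf_cmult mult_1_right)
  qed
  also have "\<dots> \<le> hausdorff ?m ?D" by (rule hausdorff_content_le_hausdorff) simp
  finally show ?thesis using w by (auto simp: ennreal_eq_0_iff)
qed

text \<open>Uniqueness of the invariant measure, applied to Hausdorff measure restricted to the
  hyperplane. A slice of the reflected and translated unit cylinder is empty or a translate of the
  unit disc, so the integrand collapses to the indicator of the cylinder over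
  \<open>E\<close>.\<close>

lemma hausdorff_hyperplane:
  fixes v :: "real ^ 'n" and E :: "(real ^ 'n) set"
  assumes v: "norm v = 1" and E [measurable]: "E \<in> sets borel" and EH: "E \<subseteq> {x. x \<bullet> v = 0}"
  shows "hausdorff (CARD('n) - 1) E * emeasure lborel (cylinder v (cball 0 1)) =
    emeasure lborel (cylinder v E) * hausdorff (CARD('n) - 1) ({x. x \<bullet> v = 0} \<inter> cball 0 1)"
proof -
  let ?m = "CARD('n) - 1"
  let ?Y = "{x. x \<bullet> v = 0} :: (real ^ 'n) set"
  let ?H = "hausdorff_measure ?m :: (real ^ 'n) measure"
  define M where "M = density ?H (indicator ?Y)"
  have Y [measurable]: "?Y \<in> sets borel" by measurable
  have sets_M [simp, measurable_cong]: "sets M = sets borel" by (simp add: M_def)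
  have sp: "space M = UNIV" by (simp add: M_def)
  have M: "emeasure M A = hausdorff ?m (A \<inter> ?Y)" if [measurable]: "A \<in> sets borel" for A
  proof -
    have "emeasure M A = (\<integral>\<^sup>+x. indicator (A \<inter> ?Y) x \<partial>?H)"
      unfolding M_def by (subst emeasure_density)
        (auto intro!: nn_integral_cong split: split_indicator simp del: nn_integral_indicator)
    also have "\<dots> = emeasure ?H (A \<inter> ?Y)" by (rule nn_integral_indicator) simp
    finally show ?thesis by (simp add: emeasure_hausdorff_measure)
  qed
  have "sigma_finite_measure M"
  proof (rule sigma_finite_measure_if_finite_on_cball)
    show "emeasure M (cball 0 k) \<noteq> \<infinity>" if "0 \<le> k" for k
      using hausdorff_hyperplane_cball_finite[OF v that] by (simp add: M Int_commute less_top)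
  qed simp
  then have "emeasure M E * emeasure lborel (cylinder v (cball 0 1)) =
      (\<integral>\<^sup>+y. indicator E (hyp_proj v y) * emeasure M ((\<lambda>x. y - x) -` cylinder v (cball 0 1)) \<partial>lborel)"
  proof (rule invariant_measure_times_lborel)
    fix z and A :: "(real ^ 'n) set" assume A [measurable]: "A \<in> sets borel"
    let ?z = "hyp_proj v z"
    have "(+) (- ?z) ` (A \<inter> ?Y) = ((\<lambda>x. x + ?z) -` A) \<inter> ?Y"
      using hyp_proj_inner[OF v, of z] by (force simp: inner_diff_left inner_add_left image_iff)
    then show "emeasure M ((\<lambda>x. x + ?z) -` A) = emeasure M A"
      using measurable_sets[of "\<lambda>x. x + ?z" borel borel A] hausdorff_translation[of ?m "- ?z" "A \<inter> ?Y"]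
      by (simp add: M)
  next
    show "AE x in M. \<forall>y. hyp_proj v (x + y) = x + hyp_proj v y"
      unfolding M_def by (subst AE_density) (auto simp: hyp_proj_def inner_add_left indicator_def split: if_splits)
  qed auto
  also have "\<dots> = (\<integral>\<^sup>+y. indicator (cylinder v E) y * hausdorff ?m (?Y \<inter> cball 0 1) \<partial>lborel)"
  proof (rule nn_integral_cong)
    fix y :: "real ^ 'n"
    have "(\<lambda>x. y - x) -` cylinder v (cball 0 1) \<inter> ?Y =
        (if 0 < y \<bullet> v \<and> y \<bullet> v \<le> 1 then (+) (hyp_proj v y) ` (?Y \<inter> cball 0 1) else {})"
    proof -
      have "hyp_proj v (y - x) = hyp_proj v y - x" if "x \<bullet> v = 0" for x
        using that by (simp add: hyp_proj_def inner_diff_left)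
      moreover have "x \<in> (+) (hyp_proj v y) ` (?Y \<inter> cball 0 1) \<longleftrightarrow> x \<bullet> v = 0 \<and> norm (hyp_proj v y - x) \<le> 1" for x
        using hyp_proj_inner[OF v, of y]
        by (auto simp: image_iff inner_add_left inner_diff_left norm_minus_commute intro!: bexI[of _ "x - hyp_proj v y"])
      ultimately show ?thesis
        by (intro set_eqI, case_tac "x \<bullet> v = 0") (simp_all add: cylinder_def inner_diff_left, blast)
    qed
    moreover have "(\<lambda>x. y - x) -` cylinder v (cball 0 1) \<in> sets borel"
      using measurable_sets[of "\<lambda>x. y - x" borel borel "cylinder v (cball 0 1)"] by simp
    ultimately have "emeasure M ((\<lambda>x. y - x) -` cylinder v (cball 0 1)) =
        (if 0 < y \<bullet> v \<and> y \<bullet> v \<le> 1 then hausdorff ?m (?Y \<inter> cball 0 1) else 0)"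
      by (simp add: M hausdorff_translation hausdorff_empty)
    then show "indicator E (hyp_proj v y) * emeasure M ((\<lambda>x. y - x) -` cylinder v (cball 0 1)) =
        indicator (cylinder v E) y * hausdorff ?m (?Y \<inter> cball 0 1)"
      by (auto simp: indicator_def cylinder_def)
  qed
  also have "\<dots> = emeasure lborel (cylinder v E) * hausdorff ?m (?Y \<inter> cball 0 1)"
    by (simp add: nn_integral_multc)
  finally show ?thesis using EH by (simp add: M Int_absorb2)
qed

text \<open>The constant may depend on \<open>v\<close> but not on the offset \<open>c\<close> or on
  \<open>E\<close>, so it can be divided out of the weight of that normal before the body is
  known.\<close>

lemma hausdorff_hyperplane_constant:
  fixes v :: "real ^ 'n"
  assumes n: "CARD('n) \<ge> 2" and v: "norm v = 1"
  obtains \<kappa> :: real where "0 < \<kappa>"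
    "\<And>c E. E \<in> sets borel \<Longrightarrow> E \<subseteq> {x. x \<bullet> v = c} \<Longrightarrow>
      hausdorff (CARD('n) - 1) E = ennreal \<kappa> * emeasure lborel (cylinder v ((\<lambda>z. z + c *\<^sub>R v) -` E))"
proof -
  let ?C = "emeasure lborel (cylinder v (cball 0 1) :: (real ^ 'n) set)"
  let ?D = "hausdorff (CARD('n) - 1) ({x. x \<bullet> v = 0} \<inter> cball 0 1)"
  obtain C where C: "?C = ennreal C" "0 < C"
    using emeasure_unit_cylinder[OF v] by (cases ?C) (auto simp: less_le)
  obtain D where D: "?D = ennreal D" "0 < D"
    using hausdorff_hyperplane_cball_pos[OF n v] hausdorff_hyperplane_cball_finite[OF v, of 1]
    by (cases ?D) (auto simp: less_le)
  show ?thesis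
  proof
    show "0 < D / C" using C D by simp
    fix c and E :: "(real ^ 'n) set" assume E: "E \<in> sets borel" "E \<subseteq> {x. x \<bullet> v = c}"
    let ?E = "(\<lambda>z. z + c *\<^sub>R v) -` E"
    have "?E \<in> sets borel" using measurable_sets[of "\<lambda>z. z + c *\<^sub>R v" borel borel E] E by simp
    moreover have "?E \<subseteq> {x. x \<bullet> v = 0}" using E(2) v by (auto simp: inner_add_left norm_eq_1)
    ultimately have eq: "hausdorff (CARD('n) - 1) ?E * ennreal C = emeasure lborel (cylinder v ?E) * ennreal D"
      using hausdorff_hyperplane[OF v] C D by simp
    have "(+) (c *\<^sub>R v) ` ?E = E" by (force simp: image_iff add.commute intro!: exI[of _ "x - c *\<^sub>R v" for x])
    then have "hausdorff (CARD('n) - 1) ?E = hausdorff (CARD('n) - 1) E"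
      using hausdorff_translation by metis
    then have "hausdorff (CARD('n) - 1) E * ennreal C * ennreal (1 / C) = emeasure lborel (cylinder v ?E) * ennreal D * ennreal (1 / C)"
      using eq by simp
    then show "hausdorff (CARD('n) - 1) E = ennreal (D / C) * emeasure lborel (cylinder v ?E)"
      using C D by (simp add: mult_ac divide_inverse ennreal_mult)
        (simp add: ennreal_mult[symmetric] mult.assoc[symmetric])
  qed
qed

section \<open>Surface area measure of a polytope\<close>

definition hbody :: "nat \<Rightarrow> (nat \<Rightarrow> 'a::euclidean_space) \<Rightarrow> (nat \<Rightarrow> real) \<Rightarrow> 'a set" where
  "hbody m v h = {x. \<forall>i<m. x \<bullet> v i \<le> h i}"

text \<open>Exactly one constraint is tight: these are the facet points at which the outer normal is
  unique. The set may be empty.\<close>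

definition open_facet :: "nat \<Rightarrow> (nat \<Rightarrow> 'a::euclidean_space) \<Rightarrow> (nat \<Rightarrow> real) \<Rightarrow> nat \<Rightarrow> 'a set" where
  "open_facet m v h i = {x. x \<bullet> v i = h i \<and> (\<forall>j<m. j \<noteq> i \<longrightarrow> x \<bullet> v j < h j)}"

lemma closed_hbody: "closed (hbody m v h)"
proof -
  have "hbody m v h = (\<Inter>i<m. {x. x \<bullet> v i \<le> h i})" by (auto simp: hbody_def)
  then show ?thesis by (auto intro!: closed_Collect_le continuous_intros)
qed

lemma convex_hbody: "convex (hbody m v h)"
proof -
  have "hbody m v h = (\<Inter>i<m. {x. v i \<bullet> x \<le> h i})" by (auto simp: hbody_def inner_commute)
  then show ?thesis by (auto intro!: convex_INT convex_halfspace_le)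
qed

lemma polyhedron_hbody: "polyhedron (hbody m v h)"
proof -
  have "hbody m v h = (\<Inter>i<m. {x. v i \<bullet> x \<le> h i})" by (auto simp: hbody_def inner_commute)
  then show ?thesis by (auto intro!: polyhedron_Inter polyhedron_halfspace_le)
qed

lemma hbody_borel [measurable]: "hbody m v h \<in> sets borel"
  by (intro borel_closed closed_hbody)

lemma open_facet_borel [measurable]: "open_facet m v h i \<in> sets borel"
  unfolding open_facet_def by measurable

lemma open_facet_subset: "i < m \<Longrightarrow> open_facet m v h i \<subseteq> hbody m v h"
  by (force simp: open_facet_def hbody_def)

lemma interior_hbody:
  assumes v: "\<And>i. i < m \<Longrightarrow> v i \<noteq> 0"
  shows "interior (hbody m v h) = {x. \<forall>i<m. x \<bullet> v i < h i}"
proof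
  have "{x. \<forall>i<m. x \<bullet> v i < h i} = (\<Inter>i<m. {x. x \<bullet> v i < h i})" by auto
  then have "open {x. \<forall>i<m. x \<bullet> v i < h i}"
    by (auto intro!: open_INT open_Collect_less continuous_intros)
  then show "{x. \<forall>i<m. x \<bullet> v i < h i} \<subseteq> interior (hbody m v h)"
    by (intro interior_maximal) (auto simp: hbody_def intro: less_imp_le)
  show "interior (hbody m v h) \<subseteq> {x. \<forall>i<m. x \<bullet> v i < h i}"
  proof clarify
    fix x i assume x: "x \<in> interior (hbody m v h)" and i: "i < m"
    then obtain e where e: "e > 0" "cball x e \<subseteq> hbody m v h" by (auto simp: mem_interior_cball)
    let ?y = "x + (e / norm (v i)) *\<^sub>R v i"
    have "?y \<in> hbody m v h" using e v[OF i] by (intro subsetD[OF e(2)]) (simp add: dist_norm)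
    then have "?y \<bullet> v i \<le> h i" using i by (auto simp: hbody_def)
    moreover have "?y \<bullet> v i = x \<bullet> v i + e * norm (v i)"
      using v[OF i] by (simp add: inner_add_left dot_square_norm power2_eq_square)
    ultimately show "x \<bullet> v i < h i" using e(1) v[OF i] by (smt (verit) mult_pos_pos zero_less_norm_iff)
  qed
qed

text \<open>Near \<open>x\<close> only constraint \<open>i\<close> matters, so every
  \<open>z\<close> with \<open>z \<bullet> v i \<le> 0\<close> is a feasible direction and
  \<open>u\<close> is nonpositive on that half-space. Testing \<open>- v i\<close> and the component
  of \<open>u\<close> orthogonal to \<open>v i\<close> forces \<open>u = v i\<close>.\<close>

lemma outer_unit_normal_open_facet:
  assumes i: "i < m" and v: "norm (v i) = 1" and x: "x \<in> open_facet m v h i"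
  shows "outer_unit_normal (hbody m v h) x u \<longleftrightarrow> u = v i"
proof
  assume u: "outer_unit_normal (hbody m v h) x u"
  have dir: "z \<bullet> u \<le> 0" if z: "z \<bullet> v i \<le> 0" for z
  proof -
    have "\<forall>\<^sub>F e in at_right 0. (x + e *\<^sub>R z) \<bullet> v j \<le> h j" if "j < m" for j
    proof (cases "j = i")
      case True
      have "(x + e *\<^sub>R z) \<bullet> v i \<le> h i" if "e > 0" for e
        using x z that by (simp add: open_facet_def inner_add_left mult_nonneg_nonpos)
      then show ?thesis unfolding True by (auto simp: eventually_at_filter)
    next
      case False
      have "((\<lambda>e. (x + e *\<^sub>R z) \<bullet> v j) \<longlongrightarrow> (x + 0 *\<^sub>R z) \<bullet> v j) (at_right 0)"
        by (intro tendsto_intros)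
      moreover have "(x + 0 *\<^sub>R z) \<bullet> v j < h j" using x that False by (simp add: open_facet_def)
      ultimately have "\<forall>\<^sub>F e in at_right 0. (x + e *\<^sub>R z) \<bullet> v j < h j" by (rule order_tendstoD)
      then show ?thesis by eventually_elim simp
    qed
    then have "\<forall>\<^sub>F e in at_right 0. \<forall>j\<in>{..<m}. (x + e *\<^sub>R z) \<bullet> v j \<le> h j"
      by (intro eventually_ball_finite) auto
    moreover have "\<forall>\<^sub>F e in at_right (0::real). e > 0" by (rule eventually_at_right_less)
    ultimately have "\<forall>\<^sub>F e in at_right 0. e > 0 \<and> x + e *\<^sub>R z \<in> hbody m v h"
      by eventually_elim (auto simp: hbody_def)
    then obtain e where e: "e > 0" "x + e *\<^sub>R z \<in> hbody m v h"
      using eventually_happens'[OF trivial_limit_at_right_real] by blast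
    then have "(x + e *\<^sub>R z - x) \<bullet> u \<le> 0" using u unfolding outer_unit_normal_def by blast
    then show ?thesis using e(1) by (simp add: mult_le_0_iff)
  qed
  have nu: "norm u = 1" using u by (simp add: outer_unit_normal_def)
  have "0 \<le> v i \<bullet> u" using dir[of "- v i"] v by (simp add: norm_eq_1)
  moreover have "(u - (u \<bullet> v i) *\<^sub>R v i) \<bullet> u \<le> 0" using v by (intro dir) (simp add: inner_diff_left norm_eq_1)
  then have "1 \<le> (v i \<bullet> u) * (v i \<bullet> u)"
    using nu by (simp add: inner_diff_left norm_eq_1 inner_commute[of u "v i"])
  ultimately have "1 \<le> v i \<bullet> u"
    using mult_right_mono[of "v i \<bullet> u" 1 "v i \<bullet> u"] by linarith
  then have "(u - v i) \<bullet> (u - v i) \<le> 0"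
    using nu v by (simp add: inner_diff_left inner_diff_right norm_eq_1 inner_commute)
  then show "u = v i" by (metis inner_ge_zero inner_eq_zero_iff antisym right_minus_eq)
next
  assume "u = v i"
  then show "outer_unit_normal (hbody m v h) x u"
    using i v x by (auto simp: outer_unit_normal_def hbody_def open_facet_def inner_diff_left)
qed

text \<open>Every tight constraint supplies an outer normal, and distinct constraints have distinct
  normals; so uniqueness of the normal means exactly one tight constraint.\<close>

lemma regular_points_hbody:
  assumes v: "\<And>i. i < m \<Longrightarrow> norm (v i) = 1" and inj: "inj_on v {..<m}"
  shows "{x \<in> regular_points (hbody m v h). gauss_map (hbody m v h) x \<in> \<omega>} =
    (\<Union>i\<in>{i. i < m \<and> v i \<in> \<omega>}. open_facet m v h i)" (is "?L = ?R")
proof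
  let ?Q = "hbody m v h"
  have nz: "\<And>i. i < m \<Longrightarrow> v i \<noteq> 0" using v by force
  have front: "frontier ?Q = ?Q - {x. \<forall>i<m. x \<bullet> v i < h i}"
    using closed_hbody[of m v h] by (simp add: frontier_def interior_hbody[OF nz])
  have gauss: "gauss_map ?Q x = v i" if "i < m" "x \<in> open_facet m v h i" for i x
    unfolding gauss_map_def using outer_unit_normal_open_facet[OF that(1) v[OF that(1)] that(2)]
    by (intro the_equality) auto
  show "?L \<subseteq> ?R"
  proof
    fix x assume x: "x \<in> ?L"
    then have xQ: "x \<in> ?Q" and uniq: "\<exists>!u. outer_unit_normal ?Q x u"
      by (auto simp: regular_points_def front)
    obtain i where i: "i < m" "h i \<le> x \<bullet> v i" using x by (auto simp: regular_points_def front not_less)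
    have tight: "outer_unit_normal ?Q x (v j)" if "j < m" "h j \<le> x \<bullet> v j" for j
      using that v by (auto simp: outer_unit_normal_def inner_diff_left hbody_def)
    have "x \<bullet> v j < h j" if "j < m" "j \<noteq> i" for j
    proof (rule ccontr)
      assume "\<not> ?thesis"
      then have "v j = v i" using tight[of j] tight[of i] that i uniq by auto
      then show False using inj that i by (auto simp: inj_on_def)
    qed
    moreover have "x \<bullet> v i = h i" using xQ i by (auto simp: hbody_def intro: antisym)
    ultimately have "x \<in> open_facet m v h i" by (simp add: open_facet_def)
    then show "x \<in> ?R" using i x gauss[OF i(1)] by auto
  qed
  show "?R \<subseteq> ?L"
  proof
    fix x assume "x \<in> ?R"
    then obtain i where i: "i < m" "v i \<in> \<omega>" "x \<in> open_facet m v h i" by auto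
    then have "x \<in> frontier ?Q"
      using open_facet_subset[of i m v h] by (auto simp: front open_facet_def)
    then show "x \<in> ?L"
      using i gauss outer_unit_normal_open_facet[OF i(1) v[OF i(1)] i(3)] by (auto simp: regular_points_def)
  qed
qed

section \<open>The surface area measures as finite sums of atoms\<close>

lemma sets_surface_area_measure [simp]: "sets (surface_area_measure K) = sets sphere_borel"
  by (simp add: surface_area_measure_def)

lemma space_surface_area_measure [simp]: "space (surface_area_measure K) = space sphere_borel"
  by (simp add: surface_area_measure_def)

lemma sets_sphere_borelI: "A \<in> sets borel \<Longrightarrow> A \<inter> sphere 0 1 \<in> sets sphere_borel"
  by (auto simp: sphere_borel_def sets_restrict_space)

lemma emeasure_surface_area_measure_hbody:
  fixes v :: "nat \<Rightarrow> 'a::euclidean_space"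
  assumes v: "\<And>i. i < m \<Longrightarrow> norm (v i) = 1" and inj: "inj_on v {..<m}" and \<omega>: "\<omega> \<in> sets sphere_borel"
  shows "emeasure (surface_area_measure (hbody m v h)) \<omega> =
    (\<Sum>i<m. indicator \<omega> (v i) * hausdorff (DIM('a) - 1) (open_facet m v h i))"
proof -
  let ?Q = "hbody m v h"
  let ?H = "hausdorff_measure (DIM('a) - 1) :: 'a measure"
  let ?f = "\<lambda>\<omega>. hausdorff (DIM('a) - 1) {x \<in> regular_points ?Q. gauss_map ?Q x \<in> \<omega>}"
  have disj: "disjoint_family_on (open_facet m v h) {..<m}"
    by (auto simp: disjoint_family_on_def open_facet_def)
  have eq: "?f \<omega> = (\<Sum>i<m. indicator \<omega> (v i) * hausdorff (DIM('a) - 1) (open_facet m v h i))" for \<omega>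
  proof -
    have "?f \<omega> = emeasure ?H (\<Union>i\<in>{i. i < m \<and> v i \<in> \<omega>}. open_facet m v h i)"
      using regular_points_hbody[of m v h \<omega>] v inj by (subst emeasure_hausdorff_measure) auto
    also have "\<dots> = (\<Sum>i\<in>{i. i < m \<and> v i \<in> \<omega>}. emeasure ?H (open_facet m v h i))"
      by (rule sum_emeasure[symmetric]) (auto intro: disjoint_family_on_mono[OF _ disj])
    also have "\<dots> = (\<Sum>i<m. indicator \<omega> (v i) * hausdorff (DIM('a) - 1) (open_facet m v h i))"
      by (rule sum.mono_neutral_cong_left) (auto simp: emeasure_hausdorff_measure)
    finally show ?thesis .
  qed
  \<comment> \<open>\<open>measure_of\<close> yields the zero measure when its argument is not a
    measure, so countable additivity comes before reading off the value.\<close>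
  have "countably_additive (sets sphere_borel) ?f"
    unfolding eq
  proof (rule countably_additiveI)
    fix A :: "nat \<Rightarrow> 'a set"
    assume A: "range A \<subseteq> sets sphere_borel" "disjoint_family A"
    have "(\<Sum>j. \<Sum>i<m. indicator (A j) (v i) * hausdorff (DIM('a) - 1) (open_facet m v h i))
        = (\<Sum>i<m. \<Sum>j. indicator (A j) (v i) * hausdorff (DIM('a) - 1) (open_facet m v h i))"
      by (rule suminf_sum) auto
    also have "\<dots> = (\<Sum>i<m. indicator (\<Union>j. A j) (v i) * hausdorff (DIM('a) - 1) (open_facet m v h i))"
      by (simp add: suminf_indicator[OF A(2)])
    finally show "(\<Sum>j. \<Sum>i<m. indicator (A j) (v i) * hausdorff (DIM('a) - 1) (open_facet m v h i))
      = (\<Sum>i<m. indicator (\<Union>j. A j) (v i) * hausdorff (DIM('a) - 1) (open_facet m v h i))" .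
  qed
  then have "emeasure (surface_area_measure ?Q) \<omega> = ?f \<omega>"
    unfolding surface_area_measure_def
    by (intro emeasure_measure_of_sigma)
      (use \<omega> in \<open>auto simp: positive_def sets.sigma_algebra_axioms hausdorff_empty\<close>)
  from this eq show ?thesis by (rule trans)
qed

lemma nn_integral_finite_atoms:
  assumes emeasure: "\<And>\<omega>. \<omega> \<in> sets S \<Longrightarrow> emeasure S \<omega> = (\<Sum>i<m. indicator \<omega> (v i) * c i)"
    and atoms: "\<And>i. i < m \<Longrightarrow> {v i} \<in> sets S" and inj: "inj_on v {..<m::nat}"
    and f [measurable]: "f \<in> borel_measurable S"
  shows "(\<integral>\<^sup>+x. f x \<partial>S) = (\<Sum>i<m. f (v i) * c i)"
proof -
  let ?V = "v ` {..<m}"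
  have V: "?V \<in> sets S"
  proof -
    have "?V = (\<Union>i<m. {v i})" by auto
    then show ?thesis using atoms by auto
  qed
  have "emeasure S (space S - ?V) = 0"
    using V by (subst emeasure) (auto simp: indicator_def)
  then have "AE x in S. x \<in> ?V"
    using V by (intro AE_I[of _ _ "space S - ?V"]) auto
  then have "(\<integral>\<^sup>+x. f x \<partial>S) = (\<integral>\<^sup>+x. (\<Sum>i<m. f (v i) * indicator {v i} x) \<partial>S)"
  proof (intro nn_integral_cong_AE, eventually_elim)
    fix x assume "x \<in> ?V"
    then obtain i where i: "i < m" "x = v i" by auto
    have "(\<Sum>j<m. f (v j) * indicator {v j} x) = (\<Sum>j<m. if j = i then f (v i) else 0)"
      using inj i by (intro sum.cong) (auto simp: indicator_def inj_on_def)
    then show "f x = (\<Sum>i<m. f (v i) * indicator {v i} x)" using i by simp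
  qed
  also have "\<dots> = (\<Sum>i<m. f (v i) * emeasure S {v i})"
    using atoms by (subst nn_integral_sum) (auto intro!: sum.cong nn_integral_cmult_indicator)
  also have "\<dots> = (\<Sum>i<m. f (v i) * c i)"
  proof (intro sum.cong refl)
    fix i assume i: "i \<in> {..<m}"
    have "(\<Sum>j<m. indicator {v i} (v j) * c j) = (\<Sum>j<m. if j = i then c i else 0)"
      using inj i by (intro sum.cong) (auto simp: indicator_def inj_on_def)
    then show "f (v i) * emeasure S {v i} = f (v i) * c i"
      using i atoms by (simp add: emeasure)
  qed
  finally show ?thesis .
qed

text \<open>Supplies measurability of the density of the \<open>p\<close>-surface area
  measure.\<close>

lemma continuous_on_support_fun:
  assumes K: "bounded K"
  shows "continuous_on UNIV (support_fun K)"
proof (cases "K = {}")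
  case False
  obtain R where R: "R > 0" "\<And>x. x \<in> K \<Longrightarrow> norm x \<le> R" using K by (auto simp: bounded_pos)
  have bdd: "bdd_above ((\<lambda>x. x \<bullet> u) ` K)" for u
    by (rule bdd_aboveI2[of _ _ "R * norm u"])
      (meson R(2) Cauchy_Schwarz_ineq2 abs_le_D1 mult_right_mono norm_ge_zero order_trans)
  have le: "support_fun K u - support_fun K w \<le> R * dist u w" for u w
  proof -
    have "support_fun K u \<le> support_fun K w + R * dist u w"
      unfolding support_fun_def[of K u]
    proof (rule cSUP_least[OF False])
      fix x assume x: "x \<in> K"
      have "x \<bullet> u = x \<bullet> w + x \<bullet> (u - w)" by (simp add: inner_diff_right)
      also have "x \<bullet> (u - w) \<le> norm x * norm (u - w)" using Cauchy_Schwarz_ineq2 abs_le_D1 by blast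
      also have "\<dots> \<le> R * dist u w" using R(2)[OF x] by (simp add: dist_norm mult_right_mono)
      also have "x \<bullet> w \<le> support_fun K w" unfolding support_fun_def using x bdd by (rule cSUP_upper)
      finally show "x \<bullet> u \<le> support_fun K w + R * dist u w" by simp
    qed
    then show ?thesis by simp
  qed
  have "R-lipschitz_on UNIV (support_fun K)"
  proof (rule lipschitz_onI)
    show "dist (support_fun K u) (support_fun K w) \<le> R * dist u w" for u w
      using le[of u w] le[of w u] by (simp add: dist_real_def dist_commute)
  qed (use R in simp)
  then show ?thesis by (rule lipschitz_on_continuous_on)
qed (simp add: support_fun_def)

lemma sets_Lp_surface_area_measure [simp]: "sets (Lp_surface_area_measure p K) = sets sphere_borel"
  by (simp add: Lp_surface_area_measure_def)

lemma emeasure_Lp_surface_area_measure_hbody: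
  fixes v :: "nat \<Rightarrow> 'a::euclidean_space"
  assumes v: "\<And>i. i < m \<Longrightarrow> norm (v i) = 1" and inj: "inj_on v {..<m}"
    and bdd: "bounded (hbody m v h)" and \<omega>: "\<omega> \<in> sets sphere_borel"
  shows "emeasure (Lp_surface_area_measure p (hbody m v h)) \<omega> =
    (\<Sum>i<m. indicator \<omega> (v i) * ennreal (support_fun (hbody m v h) (v i) powr (1 - p))
      * hausdorff (DIM('a) - 1) (open_facet m v h i))"
proof -
  let ?Q = "hbody m v h"
  let ?S = "surface_area_measure ?Q"
  have [measurable]: "support_fun ?Q \<in> borel_measurable borel"
    by (intro borel_measurable_continuous_onI continuous_on_support_fun bdd)
  have "(\<lambda>u. ennreal (support_fun ?Q u powr (1 - p))) \<in> borel_measurable borel" by measurable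
  then have "(\<lambda>u. ennreal (support_fun ?Q u powr (1 - p))) \<in> borel_measurable sphere_borel"
    unfolding sphere_borel_def by (rule measurable_restrict_space1)
  then have meas [measurable]: "(\<lambda>u. ennreal (support_fun ?Q u powr (1 - p))) \<in> borel_measurable ?S"
    by (simp cong: measurable_cong_sets)
  have "emeasure (Lp_surface_area_measure p ?Q) \<omega> =
      (\<integral>\<^sup>+u. ennreal (support_fun ?Q u powr (1 - p)) * indicator \<omega> u \<partial>?S)"
    unfolding Lp_surface_area_measure_def by (rule emeasure_density[OF meas]) (use \<omega> in simp)
  also have "\<dots> = (\<Sum>i<m. ennreal (support_fun ?Q (v i) powr (1 - p)) * indicator \<omega> (v i)
      * hausdorff (DIM('a) - 1) (open_facet m v h i))"
  proof (rule nn_integral_finite_atoms[OF _ _ inj])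
    show "emeasure ?S \<omega> = (\<Sum>i<m. indicator \<omega> (v i) * hausdorff (DIM('a) - 1) (open_facet m v h i))"
      if "\<omega> \<in> sets ?S" for \<omega>
      using that by (intro emeasure_surface_area_measure_hbody v inj) auto
    fix i assume "i < m"
    then have "{v i} \<inter> sphere 0 1 = {v i}" using v by auto
    then show "{v i} \<in> sets ?S" using sets_sphere_borelI[of "{v i}"] by simp
  next
    show "(\<lambda>u. ennreal (support_fun ?Q u powr (1 - p)) * indicator \<omega> u) \<in> borel_measurable ?S"
      by (intro borel_measurable_times_ennreal meas borel_measurable_indicator) (use \<omega> in simp)
  qed
  finally show ?thesis by (simp add: mult_ac)
qed

text \<open>The strict inequalities defining the facet persist nearby: the cylinder over it contains
  a nonempty open set, found around the point \<open>x\<close> moved to height 1/2, and so has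
  positive volume.\<close>

lemma hausdorff_open_facet_pos:
  fixes v :: "nat \<Rightarrow> real ^ 'n"
  assumes n: "CARD('n) \<ge> 2" and i: "norm (v i) = 1" and x: "x \<in> open_facet m v h i"
  shows "hausdorff (CARD('n) - 1) (open_facet m v h i) \<noteq> 0"
proof -
  let ?F = "open_facet m v h i"
  let ?W = "{y. 0 < y \<bullet> v i \<and> y \<bullet> v i < 1 \<and> (\<forall>j\<in>{..<m} - {i}. (hyp_proj (v i) y + h i *\<^sub>R v i) \<bullet> v j < h j)}"
  have "?W = {y. 0 < y \<bullet> v i} \<inter> {y. y \<bullet> v i < 1} \<inter>
      (\<Inter>j\<in>{..<m} - {i}. {y. (hyp_proj (v i) y + h i *\<^sub>R v i) \<bullet> v j < h j})" by auto
  then have "open ?W"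
    by (auto intro!: open_Int open_INT open_Collect_less continuous_intros)
  moreover have "x - h i *\<^sub>R v i + (1/2) *\<^sub>R v i \<in> ?W"
  proof -
    have p: "hyp_proj (v i) (x - h i *\<^sub>R v i + (1/2) *\<^sub>R v i) = x - h i *\<^sub>R v i"
      using i x by (simp add: hyp_proj_def inner_add_left inner_diff_left norm_eq_1 open_facet_def)
    show ?thesis
      unfolding mem_Collect_eq p using i x by (auto simp: inner_add_left inner_diff_left norm_eq_1 open_facet_def)
  qed
  ultimately have W: "\<not> negligible ?W" using open_not_negligible by blast
  have "?W \<subseteq> cylinder (v i) ((\<lambda>z. z + h i *\<^sub>R v i) -` ?F)"
    using hyp_proj_inner[OF i] i by (auto simp: cylinder_def open_facet_def inner_add_left norm_eq_1)
  then have "\<not> negligible (cylinder (v i) ((\<lambda>z. z + h i *\<^sub>R v i) -` ?F))"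
    using W negligible_subset by blast
  moreover have "(\<lambda>z. z + h i *\<^sub>R v i) -` ?F \<in> sets borel"
    using measurable_sets[of "\<lambda>z. z + h i *\<^sub>R v i" borel borel ?F] by simp
  ultimately have pos: "emeasure lborel (cylinder (v i) ((\<lambda>z. z + h i *\<^sub>R v i) -` ?F)) \<noteq> 0"
    using cylinder_borel by (auto simp: negligible_iff_null_sets null_sets_completion_iff null_sets_def)
  obtain \<kappa> where \<kappa>: "0 < \<kappa>"
    "\<And>c E. E \<in> sets borel \<Longrightarrow> E \<subseteq> {x. x \<bullet> v i = c} \<Longrightarrow>
      hausdorff (CARD('n) - 1) E = ennreal \<kappa> * emeasure lborel (cylinder (v i) ((\<lambda>z. z + c *\<^sub>R v i) -` E))"
    using hausdorff_hyperplane_constant[OF n i] by blast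
  have "?F \<subseteq> {x. x \<bullet> v i = h i}" by (auto simp: open_facet_def)
  then show ?thesis using \<kappa>(1) pos by (subst \<kappa>(2)[of ?F "h i"]) auto
qed

section \<open>Necessity of the spanning condition\<close>

text \<open>Among all descriptions by unit normals one with the fewest half-spaces is chosen; if a
  facet were empty, its half-space could be dropped.\<close>

lemma polytope_minimal_hbody:
  fixes K :: "'a::euclidean_space set"
  assumes K: "polytope K" "0 \<in> interior K"
  obtains m v h where "K = hbody m v h" "\<And>i. i < m \<Longrightarrow> norm (v i) = 1" "inj_on v {..<m}"
    "\<And>i. i < m \<Longrightarrow> 0 < h i" "\<And>i. i < m \<Longrightarrow> open_facet m v h i \<noteq> {}"
proof -
  define rep where "rep m v h \<longleftrightarrow> K = hbody m v h \<and> (\<forall>i<m. norm (v i) = 1 \<and> 0 < h i)"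
    for m and v :: "nat \<Rightarrow> 'a" and h
  have "\<exists>m v h. rep m v h"
  proof -
    obtain F where F: "finite F" "K = \<Inter>F" "\<And>H. H \<in> F \<Longrightarrow> \<exists>a b. a \<noteq> 0 \<and> H = {x. a \<bullet> x \<le> b}"
      using polytope_imp_polyhedron[OF K(1)] unfolding polyhedron_def by metis
    have "\<exists>w c. norm w = 1 \<and> 0 < c \<and> H = {x. x \<bullet> w \<le> c}" if H: "H \<in> F" for H
    proof -
      obtain a b where ab: "a \<noteq> 0" "H = {x. a \<bullet> x \<le> b}" using F(3)[OF H] by blast
      have "0 \<in> interior H" using K(2) F(2) H by (meson Inter_lower interior_mono subsetD)
      then have "0 < b" using ab by (simp add: interior_halfspace_le)
      moreover have "H = {x. x \<bullet> (a /\<^sub>R norm a) \<le> b / norm a}"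
        using ab by (auto simp: inner_commute field_simps)
      ultimately show ?thesis using ab(1) by (intro exI[of _ "a /\<^sub>R norm a"] exI[of _ "b / norm a"]) auto
    qed
    then obtain w c where wc: "\<And>H. H \<in> F \<Longrightarrow> norm (w H) = 1 \<and> 0 < c H \<and> H = {x. x \<bullet> w H \<le> c H}" by metis
    obtain f where f: "bij_betw f {0..<card F} F" using ex_bij_betw_nat_finite[OF F(1)] by blast
    have "K = (\<Inter>i<card F. f i)"
      using bij_betw_imp_surj_on[OF f] F(2) by (simp add: atLeast0LessThan)
    moreover have fF: "f i \<in> F" if "i < card F" for i using f that by (auto simp: bij_betw_def)
    ultimately have "K = hbody (card F) (w \<circ> f) (c \<circ> f)"
      using wc by (auto simp: hbody_def)
    then have "rep (card F) (w \<circ> f) (c \<circ> f)" using wc fF by (auto simp: rep_def)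
    then show ?thesis by blast
  qed
  then obtain m where m: "\<exists>v h. rep m v h" "\<And>k. k < m \<Longrightarrow> \<not> (\<exists>v h. rep k v h)"
    using exists_least_iff[of "\<lambda>m. \<exists>v h. rep m v h"] by blast
  then obtain v h where vh: "rep m v h" by blast
  have facet: "open_facet m v h i \<noteq> {}" if i: "i < m" for i
  proof -
    let ?k = "m - 1"
    \<comment> \<open>Constraint \<open>i\<close> is deleted by moving the last constraint into its
      place, which keeps the indices an initial segment.\<close>
    let ?v = "v(i := v ?k)" and ?h = "h(i := h ?k)"
    have "\<exists>y. h i < y \<bullet> v i \<and> (\<forall>j<m. j \<noteq> i \<longrightarrow> y \<bullet> v j \<le> h j)"
    proof (rule ccontr)
      assume non: "\<not> ?thesis"
      have "hbody m v h = hbody ?k ?v ?h"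
      proof
        show "hbody m v h \<subseteq> hbody ?k ?v ?h" using i by (auto simp: hbody_def)
        show "hbody ?k ?v ?h \<subseteq> hbody m v h"
        proof
          fix y assume y: "y \<in> hbody ?k ?v ?h"
          have others: "y \<bullet> v j \<le> h j" if "j < m" "j \<noteq> i" for j
          proof (cases "j = ?k")
            case True
            then have "i < ?k" using i that by auto
            then show ?thesis using y True by (auto simp: hbody_def split: if_splits)
          next
            case False
            then have "j < ?k" using that by auto
            then have "y \<bullet> ?v j \<le> ?h j" using y unfolding hbody_def by blast
            then show ?thesis using that(2) by simp
          qed
          then have "y \<bullet> v i \<le> h i" using non by force
          then show "y \<in> hbody m v h" using others by (auto simp: hbody_def)
        qed
      qed
      then have "rep ?k ?v ?h" using vh i by (auto simp: rep_def)
      then show False using m(2)[of ?k] i by auto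
    qed
    then obtain y where y: "h i < y \<bullet> v i" "\<And>j. j < m \<Longrightarrow> j \<noteq> i \<Longrightarrow> y \<bullet> v j \<le> h j" by blast
    have hpos: "\<And>j. j < m \<Longrightarrow> 0 < h j" using vh by (auto simp: rep_def)
    \<comment> \<open>\<open>y\<close> violates constraint \<open>i\<close> only. The segment from 0
      to \<open>y\<close> crosses the hyperplane of \<open>i\<close> at
      \<open>s *\<^sub>R y\<close>, and there the other constraints are strict because
      \<open>s < 1\<close> and their right-hand sides are positive.\<close>
    define s where "s = h i / (y \<bullet> v i)"
    have s: "0 < s" "s < 1" using y(1) hpos[OF i] by (auto simp: s_def)
    have "s * (y \<bullet> v j) < h j" if "j < m" "j \<noteq> i" for j
    proof (cases "y \<bullet> v j \<le> 0")
      case True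
      then have "s * (y \<bullet> v j) \<le> 0" using s by (simp add: mult_nonneg_nonpos)
      then show ?thesis using hpos[OF that(1)] by simp
    next
      case False
      then have "s * (y \<bullet> v j) < 1 * (y \<bullet> v j)" using s by (intro mult_strict_right_mono) auto
      then show ?thesis using y(2)[OF that] by simp
    qed
    then have "s *\<^sub>R y \<in> open_facet m v h i"
      using y(1) hpos[OF i] by (auto simp: open_facet_def s_def)
    then show ?thesis by blast
  qed
  have "inj_on v {..<m}"
  proof (rule inj_onI, rule ccontr)
    fix i j assume ij: "i \<in> {..<m}" "j \<in> {..<m}" "v i = v j" "i \<noteq> j"
    obtain x y where "x \<in> open_facet m v h i" "y \<in> open_facet m v h j" using facet ij by blast
    then have "x \<bullet> v i = h i" "x \<bullet> v j < h j" "y \<bullet> v j = h j" "y \<bullet> v i < h i"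
      using ij by (auto simp: open_facet_def)
    then show False using ij(3) by simp
  qed
  then show ?thesis using that[of m v h] facet vh by (auto simp: rep_def)
qed

lemma support_fun_eq_of_mem:
  assumes "x \<in> K" "x \<bullet> u = c" "\<And>y. y \<in> K \<Longrightarrow> y \<bullet> u \<le> c"
  shows "support_fun K u = c"
  unfolding support_fun_def using assms by (intro cSup_eq_maximum) force+

lemma sets_antipodal_measure [simp]: "sets (antipodal_measure N u a b) = sets sphere_borel"
  by (simp add: antipodal_measure_def)

lemma span_if_Lp_surface_area_measure_antipodal:
  fixes K :: "(real ^ 'n) set"
  assumes n: "CARD('n) \<ge> 2" and K: "polytope K" "0 \<in> interior K"
    and eq: "Lp_surface_area_measure p K = antipodal_measure N u a b"
  shows "span (u ` {1..N}) = UNIV"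
proof (rule ccontr)
  assume "span (u ` {1..N}) \<noteq> UNIV"
  then have "span (u ` {1..N}) \<subset> UNIV" by blast
  then obtain e where e: "e \<noteq> 0" "\<And>x. x \<in> span (u ` {1..N}) \<Longrightarrow> orthogonal e x"
    using orthogonal_to_subspace_exists_gen[of "u ` {1..N}" UNIV] by auto
  have ue: "u i \<bullet> e = 0" if "i \<in> {1..N}" for i
    using e(2)[of "u i"] that by (auto simp: span_base orthogonal_def inner_commute)
  obtain m v h where Q: "K = hbody m v h" and v: "\<And>i. i < m \<Longrightarrow> norm (v i) = 1" and inj: "inj_on v {..<m}"
    and h: "\<And>i. i < m \<Longrightarrow> 0 < h i" and facet: "\<And>i. i < m \<Longrightarrow> open_facet m v h i \<noteq> {}"
    using polytope_minimal_hbody[OF K] by metis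
  have bdd: "bounded (hbody m v h)" using K Q polytope_imp_bounded by blast
  \<comment> \<open>The unit vectors not orthogonal to \<open>e\<close>: this set contains no atom
    of the prescribed measure, so no facet normal of the polytope may lie in it.\<close>
  define \<omega> where "\<omega> = {x. x \<bullet> e \<noteq> 0} \<inter> sphere 0 1"
  have \<omega>: "\<omega> \<in> sets sphere_borel" unfolding \<omega>_def by (rule sets_sphere_borelI) measurable
  have "emeasure (antipodal_measure N u a b) \<omega> = 0"
    unfolding emeasure_antipodal_measure[OF \<omega>] using ue by (intro sum.neutral) (auto simp: \<omega>_def)
  then have "emeasure (Lp_surface_area_measure p (hbody m v h)) \<omega> = 0" using eq Q by simp
  then have zero: "(\<Sum>i<m. indicator \<omega> (v i) * ennreal (support_fun (hbody m v h) (v i) powr (1 - p))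
      * hausdorff (CARD('n) - 1) (open_facet m v h i)) = 0"
    using emeasure_Lp_surface_area_measure_hbody[OF v inj bdd \<omega>, of p] by simp
  have "v i \<bullet> e = 0" if i: "i < m" for i
  proof (rule ccontr)
    assume "v i \<bullet> e \<noteq> 0"
    then have "v i \<in> \<omega>" using v[OF i] by (simp add: \<omega>_def)
    obtain x where x: "x \<in> open_facet m v h i" using facet[OF i] by blast
    have "support_fun (hbody m v h) (v i) = h i"
      using x open_facet_subset[OF i, of v h] i
      by (intro support_fun_eq_of_mem[of x]) (auto simp: open_facet_def hbody_def)
    moreover have "hausdorff (CARD('n) - 1) (open_facet m v h i) \<noteq> 0"
      by (rule hausdorff_open_facet_pos[where v = v, OF n v[OF i] x])
    moreover have "indicator \<omega> (v i) * ennreal (support_fun (hbody m v h) (v i) powr (1 - p))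
        * hausdorff (CARD('n) - 1) (open_facet m v h i) = 0"
      using zero i by (simp only: sum_eq_0_iff finite_lessThan) blast
    ultimately show False
      using \<open>v i \<in> \<omega>\<close> h[OF i] by simp
  qed
  then have "t *\<^sub>R e \<in> K" for t
    using h by (auto simp: Q hbody_def inner_commute intro: less_imp_le)
  moreover obtain B where "\<And>x. x \<in> K \<Longrightarrow> norm x \<le> B" using bdd Q by (auto simp: bounded_iff)
  ultimately have "norm (((\<bar>B\<bar> + 1) / norm e) *\<^sub>R e) \<le> B" by blast
  then show False using e(1) by simp
qed

section \<open>Volume as a function of the support numbers\<close>

lemma tendsto_coordinate:
  fixes f :: "'a \<Rightarrow> 'b \<Rightarrow> 'c::topological_space"
  assumes "(f \<longlongrightarrow> g) F"
  shows "((\<lambda>x. f x i) \<longlongrightarrow> g i) F"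
  by (rule continuous_on_tendsto_compose[OF continuous_on_product_coordinates assms]) auto

definition orthant :: "nat \<Rightarrow> (nat \<Rightarrow> real) set" where
  "orthant m = {h. \<forall>i<m. 0 < h i}"

text \<open>On the open orthant, convergence means that the numbers agree up to a factor
  \<open>l\<close> arbitrarily close to 1; monotone homogeneity then squeezes \<open>f\<close>
  between \<open>f a / l ^ d\<close> and \<open>l ^ d * f a\<close>. Used for the volume and for
  supports of sections.\<close>

lemma continuous_on_orthant_homogeneous:
  fixes f :: "(nat \<Rightarrow> real) \<Rightarrow> real"
  assumes f: "\<And>h h' l. h \<in> orthant m \<Longrightarrow> h' \<in> orthant m \<Longrightarrow> 0 < l \<Longrightarrow> (\<forall>i<m. h' i \<le> l * h i) \<Longrightarrow> f h' \<le> l ^ d * f h"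
  shows "continuous_on (orthant m) f"
proof (rule continuous_on_sequentiallyI)
  fix u a assume u: "\<forall>n. u n \<in> orthant m" and a: "a \<in> orthant m" and ua: "u \<longlonglongrightarrow> a"
  have near: "\<forall>\<^sub>F n in sequentially. f (u n) \<le> l ^ d * f a \<and> f a / l ^ d \<le> f (u n)" if l: "1 < l" for l
  proof -
    have "\<forall>\<^sub>F n in sequentially. u n i \<le> l * a i \<and> a i \<le> l * u n i" if i: "i < m" for i
    proof -
      have ai: "0 < a i" using a i by (simp add: orthant_def)
      have lim: "(\<lambda>n. u n i) \<longlonglongrightarrow> a i" by (rule tendsto_coordinate[OF ua])
      have "a i < l * a i" "a i / l < a i" using ai l by (auto simp: field_simps)
      then have "\<forall>\<^sub>F n in sequentially. u n i < l * a i" "\<forall>\<^sub>F n in sequentially. a i / l < u n i"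
        using order_tendstoD[OF lim] by auto
      then show ?thesis by eventually_elim (use l in \<open>auto simp: field_simps\<close>)
    qed
    then have "\<forall>\<^sub>F n in sequentially. \<forall>i\<in>{..<m}. u n i \<le> l * a i \<and> a i \<le> l * u n i"
      by (intro eventually_ball_finite) auto
    then show ?thesis
    proof eventually_elim
      fix n assume n: "\<forall>i\<in>{..<m}. u n i \<le> l * a i \<and> a i \<le> l * u n i"
      then have "f (u n) \<le> l ^ d * f a" using u a l by (intro f) auto
      moreover have "f a \<le> l ^ d * f (u n)" using u a l n by (intro f) auto
      ultimately show "f (u n) \<le> l ^ d * f a \<and> f a / l ^ d \<le> f (u n)"
        using l by (simp add: field_simps)
    qed
  qed
  show "(\<lambda>n. f (u n)) \<longlonglongrightarrow> f a"
  proof (rule order_tendstoI)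
    fix c assume c: "c < f a"
    have "((\<lambda>l. f a / l ^ d) \<longlongrightarrow> f a / 1 ^ d) (at_right 1)" by (intro tendsto_intros) auto
    then have "\<forall>\<^sub>F l in at_right 1. c < f a / l ^ d" by (rule order_tendstoD) (use c in simp)
    moreover have "\<forall>\<^sub>F l in at_right 1. (1::real) < l" by (rule eventually_at_right_less)
    ultimately have "\<forall>\<^sub>F l in at_right 1. c < f a / l ^ d \<and> 1 < l" by eventually_elim simp
    then obtain l where l: "c < f a / l ^ d" "1 < l"
      using eventually_happens'[OF trivial_limit_at_right_real] by blast
    from near[OF l(2)] show "\<forall>\<^sub>F n in sequentially. c < f (u n)"
      by eventually_elim (use l(1) in linarith)
  next
    fix c assume c: "f a < c"
    have "((\<lambda>l. l ^ d * f a) \<longlongrightarrow> 1 ^ d * f a) (at_right 1)" by (intro tendsto_intros)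
    then have "\<forall>\<^sub>F l in at_right 1. l ^ d * f a < c" by (rule order_tendstoD) (use c in simp)
    moreover have "\<forall>\<^sub>F l in at_right 1. (1::real) < l" by (rule eventually_at_right_less)
    ultimately have "\<forall>\<^sub>F l in at_right 1. l ^ d * f a < c \<and> 1 < l" by eventually_elim simp
    then obtain l where l: "l ^ d * f a < c" "1 < l"
      using eventually_happens'[OF trivial_limit_at_right_real] by blast
    from near[OF l(2)] show "\<forall>\<^sub>F n in sequentially. f (u n) < c"
      by eventually_elim (use l(1) in linarith)
  qed
qed

text \<open>Having \<open>x \<bullet> y\<close> controlled by the numbers
  \<open>x \<bullet> v i\<close> passes to linear combinations in \<open>y\<close>, hence reaches
  the coordinate vectors.\<close>

lemma span_norm_bound:
  fixes v :: "nat \<Rightarrow> 'a::euclidean_space"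
  assumes span: "span (v ` {..<m}) = UNIV"
  obtains B where "0 < B" "\<And>x r. (\<And>i. i < m \<Longrightarrow> \<bar>x \<bullet> v i\<bar> \<le> r) \<Longrightarrow> norm x \<le> B * r"
proof -
  have ex: "\<exists>B. \<forall>x r. (\<forall>i<m. \<bar>x \<bullet> v i\<bar> \<le> r) \<longrightarrow> \<bar>x \<bullet> y\<bar> \<le> B * r" for y
  proof -
    have "y \<in> span (v ` {..<m})" using span by simp
    then show ?thesis
    proof (induction rule: span_induct_alt)
      case base
      show ?case by (intro exI[of _ 0]) auto
    next
      case (step c z y)
      then obtain i where i: "i < m" "z = v i" by auto
      obtain B where B: "\<And>x r. (\<forall>i<m. \<bar>x \<bullet> v i\<bar> \<le> r) \<Longrightarrow> \<bar>x \<bullet> y\<bar> \<le> B * r" using step by blast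
      show ?case
      proof (intro exI[of _ "\<bar>c\<bar> + B"] allI impI)
        fix x r assume r: "\<forall>i<m. \<bar>x \<bullet> v i\<bar> \<le> r"
        have "\<bar>x \<bullet> (c *\<^sub>R z + y)\<bar> \<le> \<bar>c\<bar> * \<bar>x \<bullet> v i\<bar> + \<bar>x \<bullet> y\<bar>"
          using abs_triangle_ineq[of "c * (x \<bullet> v i)" "x \<bullet> y"] by (simp add: i inner_add_right abs_mult)
        also have "\<dots> \<le> \<bar>c\<bar> * r + B * r" using r i B by (intro add_mono mult_left_mono) auto
        finally show "\<bar>x \<bullet> (c *\<^sub>R z + y)\<bar> \<le> (\<bar>c\<bar> + B) * r" by (simp add: algebra_simps)
      qed
    qed
  qed
  then obtain B where B: "\<And>y x r. (\<forall>i<m. \<bar>x \<bullet> v i\<bar> \<le> r) \<Longrightarrow> \<bar>x \<bullet> y\<bar> \<le> B y * r" by metis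
  have m: "0 < m"
  proof (rule ccontr)
    assume "\<not> 0 < m"
    then have "(UNIV :: 'a set) = {0}" using span by simp
    then show False using nonzero_Basis SOME_Basis by (metis UNIV_I singletonD)
  qed
  show ?thesis
  proof
    show "0 < (\<Sum>b\<in>Basis. \<bar>B b\<bar>) + 1" by (simp add: add_nonneg_pos sum_nonneg)
    fix x r assume r: "\<And>i. i < m \<Longrightarrow> \<bar>x \<bullet> v i\<bar> \<le> r"
    then have "0 \<le> r" using m by force
    have "norm x \<le> (\<Sum>b\<in>Basis. \<bar>x \<bullet> b\<bar>)" by (rule norm_le_l1)
    also have "\<dots> \<le> (\<Sum>b\<in>Basis. \<bar>B b\<bar> * r)"
    proof (rule sum_mono)
      fix b :: 'a
      have "\<bar>x \<bullet> b\<bar> \<le> B b * r" using B r by blast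
      also have "\<dots> \<le> \<bar>B b\<bar> * r" using \<open>0 \<le> r\<close> by (intro mult_right_mono) auto
      finally show "\<bar>x \<bullet> b\<bar> \<le> \<bar>B b\<bar> * r" .
    qed
    also have "\<dots> \<le> ((\<Sum>b\<in>Basis. \<bar>B b\<bar>) + 1) * r"
      using \<open>0 \<le> r\<close> by (simp add: distrib_right flip: sum_distrib_right)
    finally show "norm x \<le> ((\<Sum>b\<in>Basis. \<bar>B b\<bar>) + 1) * r" .
  qed
qed

section \<open>The volume is differentiable in each support number\<close>

locale antipodal_normals =
  fixes m :: nat and v :: "nat \<Rightarrow> real ^ 'n"
  assumes unit: "\<And>i. i < m \<Longrightarrow> norm (v i) = 1"
    and inj: "inj_on v {..<m}"
    and antipodal: "\<And>i. i < m \<Longrightarrow> \<exists>j<m. v j = - v i"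
    and spanning: "span (v ` {..<m}) = UNIV"
    and dim_ge_2: "CARD('n) \<ge> 2"
begin

lemma norm_bound:
  obtains B where "0 < B" "\<And>x r h. x \<in> hbody m v h \<Longrightarrow> (\<And>i. i < m \<Longrightarrow> h i \<le> r) \<Longrightarrow> norm x \<le> B * r"
proof -
  obtain B where B: "0 < B" "\<And>x r. (\<And>i. i < m \<Longrightarrow> \<bar>x \<bullet> v i\<bar> \<le> r) \<Longrightarrow> norm x \<le> B * r"
    using span_norm_bound[OF spanning] by blast
  show ?thesis
  proof
    fix x r h assume x: "x \<in> hbody m v h" and r: "\<And>i. i < m \<Longrightarrow> h i \<le> r"
    show "norm x \<le> B * r"
    proof (rule B(2))
      fix i assume i: "i < m"
      obtain j where j: "j < m" "v j = - v i" using antipodal[OF i] by blast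
      have "x \<bullet> v i \<le> r" "- (x \<bullet> v i) \<le> r"
        using x i j r[OF i] r[OF j(1)] by (fastforce simp: hbody_def)+
      then show "\<bar>x \<bullet> v i\<bar> \<le> r" by simp
    qed
  qed (rule B(1))
qed

lemma bounded_hbody: "bounded (hbody m v h)"
proof -
  obtain B where B: "0 < B" "\<And>x r h. x \<in> hbody m v h \<Longrightarrow> (\<And>i. i < m \<Longrightarrow> h i \<le> r) \<Longrightarrow> norm x \<le> B * r"
    using norm_bound by blast
  have "norm x \<le> B * Max (h ` {..<m})" if "x \<in> hbody m v h" for x
    by (rule B(2)[OF that]) auto
  then show ?thesis by (auto simp: bounded_iff)
qed

lemma compact_hbody: "compact (hbody m v h)"
  using bounded_hbody closed_hbody by (simp add: compact_eq_bounded_closed)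

abbreviation lift :: "nat \<Rightarrow> real \<Rightarrow> real ^ 'n \<Rightarrow> real ^ 'n" where
  "lift i c y \<equiv> hyp_proj (v i) y + c *\<^sub>R v i"

definition vol :: "(nat \<Rightarrow> real) \<Rightarrow> real" where
  "vol h = measure lborel (hbody m v h)"

text \<open>For \<open>s = 0\<close> this is the cylinder over the \<open>i\<close>-th facet; for \<open>s > 0\<close> it is the slab between the
  bodies with \<open>i\<close>-th support numbers \<open>h i\<close> and \<open>h i + s\<close>, stretched to height 1.\<close>

definition tilted :: "nat \<Rightarrow> (nat \<Rightarrow> real) \<Rightarrow> real \<Rightarrow> (real ^ 'n) set" where
  "tilted i h s = {y. 0 < y \<bullet> v i \<and> y \<bullet> v i \<le> 1 \<and>
     (\<forall>j\<in>{..<m} - {i}. lift i (h i + s * (y \<bullet> v i)) y \<bullet> v j \<le> h j)}"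

definition area :: "nat \<Rightarrow> (nat \<Rightarrow> real) \<Rightarrow> real" where
  "area i h = measure lborel (tilted i h 0)"

lemma tilted_borel [measurable]: "tilted i h s \<in> sets borel"
  unfolding tilted_def by measurable

lemma vol_nonneg: "0 \<le> vol h" by (simp add: vol_def)

text \<open>A ball common to all bounded support numbers and tilts, which serves as the dominating
  function below.\<close>

lemma bounded_tilted:
  obtains B where "0 < B"
    "\<And>i h s r y. i < m \<Longrightarrow> y \<in> tilted i h s \<Longrightarrow> (\<And>j. j < m \<Longrightarrow> h j \<le> r) \<Longrightarrow> \<bar>s\<bar> \<le> r' \<Longrightarrow> norm y \<le> B * (r + r') + 1"
proof -
  obtain B where B: "0 < B" "\<And>x r h. x \<in> hbody m v h \<Longrightarrow> (\<And>i. i < m \<Longrightarrow> h i \<le> r) \<Longrightarrow> norm x \<le> B * r"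
    using norm_bound by blast
  show ?thesis
  proof
    fix i h s r y
    assume i: "i < m" and y: "y \<in> tilted i h s" and h: "\<And>j. j < m \<Longrightarrow> h j \<le> r" and s: "\<bar>s\<bar> \<le> r'"
    let ?x = "hyp_proj (v i) y + (h i + s * (y \<bullet> v i)) *\<^sub>R v i"
    have r': "0 \<le> r'" using s by simp
    have xi: "?x \<bullet> v i = h i + s * (y \<bullet> v i)"
      using unit[OF i] by (simp add: inner_add_left hyp_proj_inner norm_eq_1)
    have "\<bar>s * (y \<bullet> v i)\<bar> \<le> r' * 1" unfolding abs_mult using y s by (intro mult_mono) (auto simp: tilted_def)
    then have "?x \<bullet> v i \<le> r + r'" using xi h[OF i] by linarith
    moreover have "?x \<bullet> v j \<le> r + r'" if "j < m" "j \<noteq> i" for j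
      using y that h[of j] r' by (force simp: tilted_def)
    ultimately have "?x \<in> hbody m v (\<lambda>_. r + r')" by (auto simp: hbody_def)
    then have "norm ?x \<le> B * (r + r')" using B(2) by blast
    moreover have "hyp_proj (v i) ?x = hyp_proj (v i) y"
      unfolding hyp_proj_def[of "v i" ?x] xi by simp
    ultimately have "norm (hyp_proj (v i) y) \<le> B * (r + r')"
      using norm_hyp_proj_le[OF unit[OF i], of ?x] by simp
    moreover have "norm y \<le> norm (hyp_proj (v i) y) + \<bar>y \<bullet> v i\<bar>"
      using norm_triangle_ineq[of "hyp_proj (v i) y" "(y \<bullet> v i) *\<^sub>R v i"] unit[OF i]
      by (simp add: hyp_proj_decompose)
    moreover have "\<bar>y \<bullet> v i\<bar> \<le> 1" using y by (simp add: tilted_def)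
    ultimately show "norm y \<le> B * (r + r') + 1" by linarith
  qed (rule B(1))
qed

lemma negligible_facet_hyperplane:
  assumes i: "i < m" and j: "j < m" "j \<noteq> i" "v j \<noteq> - v i"
  shows "negligible {y. lift i c y \<bullet> v j = d}"
proof -
  let ?w = "v j - (v i \<bullet> v j) *\<^sub>R v i"
  have "?w \<noteq> 0"
  proof
    assume "?w = 0"
    then have eq: "v j = (v i \<bullet> v j) *\<^sub>R v i" by simp
    then have "\<bar>v i \<bullet> v j\<bar> = 1" using unit[OF i] unit[OF j(1)] by (metis norm_scaleR mult.right_neutral)
    then have "v j = v i \<or> v j = - v i" using eq by (auto simp: abs_if split: if_splits)
    then show False using inj i j by (auto simp: inj_on_def)
  qed
  moreover have "{y. lift i c y \<bullet> v j = d} = {y. ?w \<bullet> y = d - c * (v i \<bullet> v j)}"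
    by (auto simp: hyp_proj_def inner_add_left inner_diff_left inner_commute algebra_simps)
  ultimately show ?thesis by (simp add: negligible_hyperplane)
qed

text \<open>For \<open>v j = - v i\<close> the hyperplanes are parallel and the equation does not
  involve \<open>y\<close>; positivity of both support numbers excludes it. In all other cases it
  describes a hyperplane.\<close>

lemma AE_off_facet_hyperplanes:
  assumes i: "i < m" and h: "h \<in> orthant m"
  shows "AE y in lborel. \<forall>j\<in>{..<m} - {i}. lift i (h i) y \<bullet> v j \<noteq> h j"
proof -
  define Z where "Z = (\<Union>j\<in>{j. j < m \<and> j \<noteq> i \<and> v j \<noteq> - v i}. {y. lift i (h i) y \<bullet> v j = h j})"
  have "negligible Z"
    unfolding Z_def using negligible_facet_hyperplane[OF i] by (intro negligible_Union) auto
  moreover have "Z \<in> sets borel"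
    unfolding Z_def by (intro sets.finite_UN) auto
  ultimately have Z: "AE y in lborel. y \<notin> Z"
    by (intro AE_not_in) (auto simp: negligible_iff_null_sets null_sets_completion_iff)
  from Z show ?thesis
  proof (eventually_elim, intro ballI)
    fix y j assume y: "y \<notin> Z" and j: "j \<in> {..<m} - {i}"
    show "lift i (h i) y \<bullet> v j \<noteq> h j"
    proof (cases "v j = - v i")
      case True
      have "lift i (h i) y \<bullet> v j = - h i"
        using hyp_proj_inner[OF unit[OF i], of y] unit[OF i] by (simp add: True inner_add_left norm_eq_1)
      moreover have "0 < h i" "0 < h j" using h i j by (auto simp: orthant_def)
      ultimately show ?thesis by simp
    qed (use y j in \<open>auto simp: Z_def\<close>)
  qed
qed

text \<open>Off a null set none of the limiting inequalities is an equality, so each inequality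
  eventually has its limiting truth value, and dominated convergence applies.\<close>

lemma tendsto_measure_tilted:
  assumes i: "i < m" and h: "h \<in> orthant m" and lim: "\<And>j. j < m \<Longrightarrow> (\<lambda>n. g n j) \<longlonglongrightarrow> h j"
    and s: "s \<longlonglongrightarrow> 0" "\<And>n. 0 \<le> s n"
  shows "(\<lambda>n. measure lborel (tilted i (g n) (s n))) \<longlonglongrightarrow> area i h"
proof -
  have "\<exists>r. \<forall>n. g n j \<le> r" if j: "j < m" for j
    using convergent_imp_Bseq[OF convergentI[OF lim[OF j]]] by (auto simp: Bseq_def) (metis abs_le_D1)
  then obtain R where R: "\<And>j n. j < m \<Longrightarrow> g n j \<le> R j" by metis
  define r where "r = Max (R ` {..<m})"
  have r: "g n j \<le> r" if "j < m" for n j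
  proof -
    have "R j \<le> r" unfolding r_def using that by (intro Max_ge) auto
    then show ?thesis using R[OF that, of n] by simp
  qed
  have hr: "h j \<le> r" if "j < m" for j
    by (rule LIMSEQ_le_const2[OF lim[OF that]]) (use r[OF that] in auto)
  obtain r' where r': "\<And>n. \<bar>s n\<bar> \<le> r'"
    using convergent_imp_Bseq[OF convergentI[OF s(1)]] by (auto simp: Bseq_def)
  have r'0: "\<bar>0::real\<bar> \<le> r'" using r'[of 0] by simp
  obtain B where B: "0 < B"
    "\<And>i h s r y. i < m \<Longrightarrow> y \<in> tilted i h s \<Longrightarrow> (\<And>j. j < m \<Longrightarrow> h j \<le> r) \<Longrightarrow> \<bar>s\<bar> \<le> r' \<Longrightarrow> norm y \<le> B * (r + r') + 1"
    using bounded_tilted by blast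
  let ?C = "cball 0 (B * (r + r') + 1) :: (real ^ 'n) set"
  have "(\<lambda>n. integral\<^sup>L lborel (indicat_real (tilted i (g n) (s n)))) \<longlonglongrightarrow> integral\<^sup>L lborel (indicat_real (tilted i h 0))"
  proof (rule integral_dominated_convergence[where w = "indicat_real ?C"])
    show "integrable lborel (indicat_real ?C)"
      using emeasure_lborel_cball_finite[of 0 "B * (r + r') + 1"] by (intro integrable_real_indicator) auto
    show "AE y in lborel. norm (indicat_real (tilted i (g n) (s n)) y) \<le> indicat_real ?C y" for n
      using B(2)[OF i _ _ r', of _ "g n"] r by (auto simp: indicator_def)
    show "AE y in lborel. (\<lambda>n. indicat_real (tilted i (g n) (s n)) y) \<longlonglongrightarrow> indicat_real (tilted i h 0) y"
      using AE_off_facet_hyperplanes[OF i h]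
    proof eventually_elim
      fix y assume y: "\<forall>j\<in>{..<m} - {i}. lift i (h i) y \<bullet> v j \<noteq> h j"
      show "(\<lambda>n. indicat_real (tilted i (g n) (s n)) y) \<longlonglongrightarrow> indicat_real (tilted i h 0) y"
      proof (cases "0 < y \<bullet> v i \<and> y \<bullet> v i \<le> 1")
        case True
        have "\<forall>\<^sub>F n in sequentially.
            (lift i (g n i + s n * (y \<bullet> v i)) y \<bullet> v j \<le> g n j) =
            (lift i (h i + 0 * (y \<bullet> v i)) y \<bullet> v j \<le> h j)" if j: "j \<in> {..<m} - {i}" for j
        proof (cases "v j = - v i")
          case True
          \<comment> \<open>Opposite facets: the inequality reads
            \<open>- (g n i + s n * (y \<bullet> v i)) \<le> g n j\<close> and holds as soon as both
            support numbers are positive; this is where \<open>s n\<close> has to be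
            nonnegative.\<close>
          have vi: "v i \<bullet> v i = 1" using unit[OF i] by (simp add: norm_eq_1)
          have p: "lift i c y \<bullet> v j = - c" for c
            using hyp_proj_inner[OF unit[OF i], of y] vi by (simp add: True inner_add_left)
          have "0 < h i" "0 < h j" using h i j by (auto simp: orthant_def)
          then have "\<forall>\<^sub>F n in sequentially. 0 < g n i" "\<forall>\<^sub>F n in sequentially. 0 < g n j"
            using order_tendstoD(1)[OF lim[OF i]] order_tendstoD(1)[OF lim[of j]] j by auto
          then show ?thesis
          proof eventually_elim
            fix n assume g: "0 < g n i" "0 < g n j"
            have "0 \<le> s n * (y \<bullet> v i)" using s(2)[of n] \<open>0 < y \<bullet> v i \<and> y \<bullet> v i \<le> 1\<close> by simp
            then show "(lift i (g n i + s n * (y \<bullet> v i)) y \<bullet> v j \<le> g n j) =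
              (lift i (h i + 0 * (y \<bullet> v i)) y \<bullet> v j \<le> h j)"
              unfolding p using g \<open>0 < h i\<close> \<open>0 < h j\<close> by simp
          qed
        next
          case False
          let ?d = "lift i (h i + 0 * (y \<bullet> v i)) y \<bullet> v j - h j"
          let ?dn = "\<lambda>n. lift i (g n i + s n * (y \<bullet> v i)) y \<bullet> v j - g n j"
          have dlim: "?dn \<longlonglongrightarrow> ?d" using j by (intro tendsto_intros lim i s(1)) auto
          have "?d \<noteq> 0" using y j by simp
          then consider "?d < 0" | "0 < ?d" by linarith
          then show ?thesis
          proof cases
            case 1
            from order_tendstoD(2)[OF dlim this] show ?thesis by eventually_elim (use 1 in auto)
          next
            case 2
            from order_tendstoD(1)[OF dlim this] show ?thesis by eventually_elim (use 2 in auto)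
          qed
        qed
        then have "\<forall>\<^sub>F n in sequentially. \<forall>j\<in>{..<m} - {i}.
            (lift i (g n i + s n * (y \<bullet> v i)) y \<bullet> v j \<le> g n j) =
            (lift i (h i + 0 * (y \<bullet> v i)) y \<bullet> v j \<le> h j)"
          by (intro eventually_ball_finite) auto
        then have "\<forall>\<^sub>F n in sequentially. indicat_real (tilted i (g n) (s n)) y = indicat_real (tilted i h 0) y"
          by eventually_elim (simp add: tilted_def indicator_def)
        then show ?thesis by (rule tendsto_eventually)
      next
        case False
        then have "indicat_real (tilted i h s) y = 0" for h s by (auto simp: tilted_def)
        then show ?thesis by simp
      qed
    qed
  qed auto
  then show ?thesis by (simp add: area_def)
qed

text \<open>The two bodies differ by the slab \<open>t < x \<bullet> v i \<le> t + s\<close>, and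
  \<open>tilted\<close> is its preimage under an affine map with determinant \<open>s\<close>. The
  formula is exact, so the derivative is a matter of continuity only.\<close>

lemma vol_difference:
  assumes i: "i < m" and s: "0 < s"
  shows "vol (h(i := t + s)) - vol (h(i := t)) = s * measure lborel (tilted i (h(i := t)) s)"
proof -
  let ?Q = "hbody m v (h(i := t + s))" and ?R = "hbody m v (h(i := t))"
  let ?f = "\<lambda>y. t *\<^sub>R v i + 1 *\<^sub>R hyp_proj (v i) y + (s * (y \<bullet> v i)) *\<^sub>R v i"
  have sub: "?R \<subseteq> ?Q" using s by (auto simp: hbody_def)
  have fi: "?f y \<bullet> v i = t + s * (y \<bullet> v i)" for y
    using unit[OF i] by (simp add: inner_add_left hyp_proj_inner norm_eq_1)
  have f_eq: "?f y = hyp_proj (v i) y + ((h(i := t)) i + s * (y \<bullet> v i)) *\<^sub>R v i" for y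
    by (simp add: algebra_simps)
  have "?f -` (?Q - ?R) = tilted i (h(i := t)) s"
  proof -
    have "x \<in> hbody m v (h(i := c)) \<longleftrightarrow> x \<bullet> v i \<le> c \<and> (\<forall>j\<in>{..<m} - {i}. x \<bullet> v j \<le> h j)" for x c
      using i by (auto simp: hbody_def split: if_splits)
    then have "x \<in> ?Q - ?R \<longleftrightarrow> t < x \<bullet> v i \<and> x \<bullet> v i \<le> t + s \<and> (\<forall>j\<in>{..<m} - {i}. x \<bullet> v j \<le> h j)" for x
      by auto
    from this[of "?f _", unfolded fi]
    have "y \<in> ?f -` (?Q - ?R) \<longleftrightarrow> 0 < y \<bullet> v i \<and> y \<bullet> v i \<le> 1 \<and> (\<forall>j\<in>{..<m} - {i}. ?f y \<bullet> v j \<le> h j)" for y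
      unfolding vimage_eq using s by (simp add: zero_less_mult_iff)
    then show ?thesis unfolding tilted_def f_eq[symmetric] by auto
  qed
  then have "emeasure lborel (?Q - ?R) = ennreal (1 ^ (CARD('n) - 1) * s) * emeasure lborel (tilted i (h(i := t)) s)"
    using emeasure_lborel_affine_direction[OF unit[OF i], of 1 s "?Q - ?R" "t *\<^sub>R v i"] s by simp
  then have "measure lborel (?Q - ?R) = s * measure lborel (tilted i (h(i := t)) s)"
    using s by (simp add: measure_def enn2real_mult)
  moreover have "measure lborel (?Q - ?R) = measure lborel ?Q - measure lborel ?R"
    using sub emeasure_bounded_finite[OF bounded_hbody, of "h(i := t + s)"] by (intro measure_Diff) auto
  ultimately show ?thesis by (simp add: vol_def)
qed

lemma vol_DERIV:
  assumes i: "i < m" and h: "h \<in> orthant m" and t: "0 < t"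
  shows "((\<lambda>t. vol (h(i := t))) has_real_derivative area i (h(i := t))) (at t)"
proof -
  have ht: "h(i := t) \<in> orthant m" using h t by (auto simp: orthant_def)
  have "(\<lambda>s. (vol (h(i := t + s)) - vol (h(i := t))) / s) \<midarrow>0\<rightarrow> area i (h(i := t))"
    unfolding tendsto_at_iff_sequentially comp_def
  proof (intro allI impI)
    fix X :: "nat \<Rightarrow> real" assume X: "\<forall>n. X n \<in> UNIV - {0}" "X \<longlonglongrightarrow> 0"
    \<comment> \<open>The slab formula needs a positive step, so a negative increment is read from
      its lower end point; hence \<open>min 0 (X n)\<close> and the absolute value.\<close>
    have "(vol (h(i := t + X n)) - vol (h(i := t))) / X n
        = measure lborel (tilted i (h(i := t + min 0 (X n))) \<bar>X n\<bar>)" for n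
    proof (cases "X n > 0")
      case True
      then show ?thesis using vol_difference[OF i, of "X n" h t] by simp
    next
      case False
      then have "X n < 0" using X(1) by (metis DiffD2 insertI1 linorder_neqE_linordered_idom)
      then show ?thesis using vol_difference[OF i, of "- X n" h "t + X n"] by (simp add: field_simps min_def)
    qed
    moreover have "(\<lambda>n. measure lborel (tilted i (h(i := t + min 0 (X n))) \<bar>X n\<bar>)) \<longlonglongrightarrow> area i (h(i := t))"
    proof (rule tendsto_measure_tilted[OF i ht])
      have "(\<lambda>n. t + min 0 (X n)) \<longlonglongrightarrow> t + min 0 0" by (intro tendsto_intros X(2))
      then show "(\<lambda>n. (h(i := t + min 0 (X n))) j) \<longlonglongrightarrow> (h(i := t)) j" for j by simp
      show "(\<lambda>n. \<bar>X n\<bar>) \<longlonglongrightarrow> 0" using tendsto_rabs[OF X(2)] by simp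
    qed auto
    ultimately show "(\<lambda>n. (vol (h(i := t + X n)) - vol (h(i := t))) / X n) \<longlonglongrightarrow> area i (h(i := t))"
      by simp
  qed
  then show ?thesis by (simp add: DERIV_def)
qed

lemma m_pos: "0 < m"
proof (rule ccontr)
  assume "\<not> 0 < m"
  then have "(UNIV :: (real ^ 'n) set) = {0}" using spanning by simp
  then show False using nonzero_Basis SOME_Basis by (metis UNIV_I singletonD)
qed

text \<open>Monotonicity and scaling in one inequality, the form that yields continuity on the
  orthant.\<close>

lemma vol_homogeneous:
  assumes l: "0 < l" and le: "\<forall>i<m. h' i \<le> l * h i"
  shows "vol h' \<le> l ^ CARD('n) * vol h"
proof -
  have sub: "(\<lambda>x. l *\<^sub>R x) -` hbody m v h' \<subseteq> hbody m v h"
  proof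
    fix x assume x: "x \<in> (\<lambda>x. l *\<^sub>R x) -` hbody m v h'"
    have "x \<bullet> v i \<le> h i" if "i < m" for i
    proof -
      have "l * (x \<bullet> v i) \<le> h' i" using x that by (auto simp: hbody_def)
      then have "l * (x \<bullet> v i) \<le> l * h i" using le that by fastforce
      then show ?thesis using l by simp
    qed
    then show "x \<in> hbody m v h" by (simp add: hbody_def)
  qed
  have bor: "(\<lambda>x. l *\<^sub>R x) -` hbody m v h' \<in> sets borel"
    using measurable_sets[of "\<lambda>x. l *\<^sub>R x" borel borel "hbody m v h'"] by simp
  have "(\<lambda>x. 0 + l *\<^sub>R hyp_proj (v 0) x + (l * (x \<bullet> v 0)) *\<^sub>R v 0) = (\<lambda>x. l *\<^sub>R x)"
    by (auto simp: hyp_proj_def algebra_simps)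
  then have "emeasure lborel (hbody m v h') = ennreal (l ^ (CARD('n) - 1) * l) * emeasure lborel ((\<lambda>x. l *\<^sub>R x) -` hbody m v h')"
    using emeasure_lborel_affine_direction[OF unit[OF m_pos] l l, of "hbody m v h'" 0] by simp
  also have "l ^ (CARD('n) - 1) * l = l ^ CARD('n)"
    using dim_ge_2 by (metis One_nat_def less_le_trans one_less_numeral_iff power_minus_mult semiring_norm(76) less_trans zero_less_one)
  finally have "vol h' = l ^ CARD('n) * measure lborel ((\<lambda>x. l *\<^sub>R x) -` hbody m v h')"
    using l by (simp add: vol_def measure_def enn2real_mult)
  also have "\<dots> \<le> l ^ CARD('n) * vol h"
    unfolding vol_def using l sub bor emeasure_bounded_finite[OF bounded_hbody, of h]
    by (intro mult_left_mono measure_mono_fmeasurable) (auto simp: fmeasurable_def)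
  finally show ?thesis .
qed

lemma continuous_on_vol: "continuous_on (orthant m) vol"
  by (rule continuous_on_orthant_homogeneous) (rule vol_homogeneous)

text \<open>Joins the two notions of facet size: strict inequalities from the Gauss map, weak ones
  from the derivative of the volume. They differ by a null set.\<close>

lemma measure_cylinder_open_facet:
  assumes i: "i < m" and h: "h \<in> orthant m"
  shows "emeasure lborel (cylinder (v i) ((\<lambda>z. z + h i *\<^sub>R v i) -` open_facet m v h i)) = ennreal (area i h)"
proof -
  let ?C = "cylinder (v i) ((\<lambda>z. z + h i *\<^sub>R v i) -` open_facet m v h i)"
  have C: "?C = {y. 0 < y \<bullet> v i \<and> y \<bullet> v i \<le> 1 \<and>
     (\<forall>j\<in>{..<m} - {i}. lift i (h i) y \<bullet> v j < h j)}"
    using unit[OF i] hyp_proj_inner[OF unit[OF i]]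
    by (auto simp: cylinder_def open_facet_def inner_add_left norm_eq_1)
  have T: "tilted i h 0 = {y. 0 < y \<bullet> v i \<and> y \<bullet> v i \<le> 1 \<and>
     (\<forall>j\<in>{..<m} - {i}. lift i (h i) y \<bullet> v j \<le> h j)}"
    by (simp add: tilted_def)
  have "emeasure lborel ?C = emeasure lborel (tilted i h 0)"
  proof (rule emeasure_eq_AE)
    show "AE y in lborel. y \<in> ?C \<longleftrightarrow> y \<in> tilted i h 0"
      using AE_off_facet_hyperplanes[OF i h]
    proof eventually_elim
      fix y assume ne: "\<forall>j\<in>{..<m} - {i}. lift i (h i) y \<bullet> v j \<noteq> h j"
      show "y \<in> ?C \<longleftrightarrow> y \<in> tilted i h 0"
        unfolding C T using ne by (auto simp: less_le)
    qed
    show "?C \<in> sets lborel"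
      using measurable_sets[of "\<lambda>z. z + h i *\<^sub>R v i" borel borel "open_facet m v h i"] by simp
  qed auto
  also have "\<dots> = ennreal (area i h)"
  proof -
    obtain B where B: "0 < B"
      "\<And>i h s r y. i < m \<Longrightarrow> y \<in> tilted i h s \<Longrightarrow> (\<And>j. j < m \<Longrightarrow> h j \<le> r) \<Longrightarrow> \<bar>s\<bar> \<le> 0 \<Longrightarrow> norm y \<le> B * (r + 0) + 1"
      using bounded_tilted[of 0] by blast
    have "norm y \<le> B * (Max (h ` {..<m}) + 0) + 1" if "y \<in> tilted i h 0" for y
      by (rule B(2)[OF i that]) auto
    then have "bounded (tilted i h 0)" by (auto simp: bounded_iff)
    then show ?thesis
      using emeasure_bounded_finite[of "tilted i h 0"] by (simp add: area_def emeasure_eq_ennreal_measure)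
  qed
  finally show ?thesis .
qed

end

section \<open>Sections of the body and reduction to support numbers\<close>

context antipodal_normals
begin

lemma zero_in_hbody: "h \<in> orthant m \<Longrightarrow> 0 \<in> hbody m v h"
  by (auto simp: orthant_def hbody_def intro: less_imp_le)

lemma cball_subset_hbody:
  assumes "\<And>i. i < m \<Longrightarrow> c \<le> h i"
  shows "cball 0 c \<subseteq> hbody m v h"
proof
  fix x :: "real ^ 'n" assume x: "x \<in> cball 0 c"
  have "x \<bullet> v i \<le> h i" if "i < m" for i
    using Cauchy_Schwarz_ineq2[of x "v i"] unit[OF that] x assms[OF that] by simp
  then show "x \<in> hbody m v h" by (simp add: hbody_def)
qed

text \<open>It serves twice: \<open>L = UNIV\<close> gives the true support numbers, and the
  subspaces of a flag give the linking coordinates.\<close>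

definition section_support :: "(real ^ 'n) set \<Rightarrow> real ^ 'n \<Rightarrow> (nat \<Rightarrow> real) \<Rightarrow> real" where
  "section_support L z h = (SUP x\<in>hbody m v h \<inter> L. x \<bullet> z)"

lemma bdd_above_section: "bdd_above ((\<lambda>x. x \<bullet> z) ` (hbody m v h \<inter> L))"
proof -
  obtain B where B: "\<And>x. x \<in> hbody m v h \<Longrightarrow> norm x \<le> B" using bounded_hbody[of h] unfolding bounded_iff by blast
  show ?thesis
    by (rule bdd_aboveI2[of _ _ "B * norm z"])
      (metis B IntD1 Cauchy_Schwarz_ineq2 abs_le_D1 mult_right_mono norm_ge_zero order_trans)
qed

lemma section_support_upper: "x \<in> hbody m v h \<Longrightarrow> x \<in> L \<Longrightarrow> x \<bullet> z \<le> section_support L z h"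
  unfolding section_support_def by (intro cSUP_upper bdd_above_section) auto

lemma section_support_least:
  assumes "subspace L" "h \<in> orthant m" "\<And>x. x \<in> hbody m v h \<Longrightarrow> x \<in> L \<Longrightarrow> x \<bullet> z \<le> c"
  shows "section_support L z h \<le> c"
  unfolding section_support_def
  using zero_in_hbody[OF assms(2)] subspace_0[OF assms(1)] assms(3) by (intro cSUP_least) auto

lemma section_support_attained:
  assumes L: "subspace L" and h: "h \<in> orthant m"
  obtains x where "x \<in> hbody m v h" "x \<in> L" "x \<bullet> z = section_support L z h"
proof -
  have "compact (hbody m v h \<inter> L)" using compact_hbody closed_subspace[OF L] by (rule compact_Int_closed)
  moreover have "hbody m v h \<inter> L \<noteq> {}" using zero_in_hbody[OF h] subspace_0[OF L] by auto
  moreover have "continuous_on (hbody m v h \<inter> L) (\<lambda>x. x \<bullet> z)" by (intro continuous_intros)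
  ultimately obtain x where x: "x \<in> hbody m v h \<inter> L" "\<And>y. y \<in> hbody m v h \<inter> L \<Longrightarrow> y \<bullet> z \<le> x \<bullet> z"
    using continuous_attains_sup[of "hbody m v h \<inter> L" "\<lambda>x. x \<bullet> z"] by blast
  have "section_support L z h = x \<bullet> z"
    using x by (intro antisym section_support_least[OF L h] section_support_upper) auto
  then show ?thesis using that x(1) by auto
qed

lemma section_support_pos:
  assumes L: "subspace L" and h: "h \<in> orthant m" and z: "z \<in> L" "z \<noteq> 0"
  shows "0 < section_support L z h"
proof -
  define c where "c = Min (h ` {..<m})"
  have "0 < c" unfolding c_def using h m_pos by (subst Min_gr_iff) (auto simp: orthant_def)
  have "cball 0 c \<subseteq> hbody m v h" by (rule cball_subset_hbody) (auto simp: c_def)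
  moreover have "(c / norm z) *\<^sub>R z \<in> cball 0 c" using \<open>0 < c\<close> z by simp
  ultimately have "(c / norm z) *\<^sub>R z \<in> hbody m v h" by blast
  then have "(c / norm z) *\<^sub>R z \<bullet> z \<le> section_support L z h"
    using subspace_scale[OF L z(1)] by (rule section_support_upper)
  moreover have "0 < (c / norm z) *\<^sub>R z \<bullet> z" using \<open>0 < c\<close> z by simp
  ultimately show ?thesis by linarith
qed

lemma section_support_homogeneous:
  assumes L: "subspace L" and h: "h \<in> orthant m" "h' \<in> orthant m" and l: "0 < l" and le: "\<forall>i<m. h' i \<le> l * h i"
  shows "section_support L z h' \<le> l * section_support L z h"
proof (rule section_support_least[OF L h(2)])
  fix x assume x: "x \<in> hbody m v h'" "x \<in> L"
  have "(1 / l) *\<^sub>R x \<in> hbody m v h"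
    using x(1) le l by (auto simp: hbody_def field_simps intro: order_trans)
  then have "(1 / l) *\<^sub>R x \<bullet> z \<le> section_support L z h"
    using subspace_scale[OF L x(2)] by (rule section_support_upper)
  then show "x \<bullet> z \<le> l * section_support L z h" using l by (simp add: field_simps)
qed

lemma continuous_on_section_support: "subspace L \<Longrightarrow> continuous_on (orthant m) (section_support L z)"
  by (rule continuous_on_orthant_homogeneous[where d = 1]) (use section_support_homogeneous in simp)

text \<open>The value 1 from index \<open>m\<close> on fixes the idle coordinates, so that sets of
  reduced functions can be compact in the product topology.\<close>

definition reduce :: "(nat \<Rightarrow> real) \<Rightarrow> nat \<Rightarrow> real" where
  "reduce h i = (if i < m then section_support UNIV (v i) h else 1)"

lemma reduce_le: "h \<in> orthant m \<Longrightarrow> i < m \<Longrightarrow> reduce h i \<le> h i"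
  unfolding reduce_def by (auto intro!: section_support_least simp: hbody_def)

lemma reduce_orthant: "h \<in> orthant m \<Longrightarrow> reduce h \<in> orthant m"
  using unit by (force simp: orthant_def reduce_def intro!: section_support_pos)

lemma hbody_reduce:
  assumes "h \<in> orthant m"
  shows "hbody m v (reduce h) = hbody m v h"
proof
  show "hbody m v (reduce h) \<subseteq> hbody m v h"
    using reduce_le[OF assms] by (auto simp: hbody_def intro: order_trans)
  show "hbody m v h \<subseteq> hbody m v (reduce h)"
    using section_support_upper[of _ h UNIV] by (auto simp: hbody_def[of m v "reduce h"] reduce_def)
qed

lemma reduce_reduce: "h \<in> orthant m \<Longrightarrow> reduce (reduce h) = reduce h"
  by (rule ext) (simp add: reduce_def[of "reduce h"] reduce_def[of h] section_support_def hbody_reduce)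

lemma vol_reduce: "h \<in> orthant m \<Longrightarrow> vol (reduce h) = vol h"
  by (simp add: vol_def hbody_reduce)

lemma continuous_on_reduce: "continuous_on (orthant m) reduce"
proof (rule continuous_on_coordinatewise_then_product)
  show "continuous_on (orthant m) (\<lambda>h. reduce h i)" for i
    unfolding reduce_def using continuous_on_section_support[OF subspace_UNIV, of "v i"]
    by (cases "i < m") auto
qed

definition consistent :: "(nat \<Rightarrow> real) set" where
  "consistent = {h \<in> orthant m. reduce h = h}"

lemma consistent_orthant: "h \<in> consistent \<Longrightarrow> h \<in> orthant m"
  by (simp add: consistent_def)

text \<open>The convex hull of \<open>x\<close> and a ball of radius \<open>c\<close> has volume at
  least proportional to \<open>norm x\<close>, so a volume bound becomes a diameter bound.\<close>

lemma vol_lower_bound: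
  assumes c: "0 < c" "cball 0 c \<subseteq> hbody m v h" and x: "x \<in> hbody m v h"
  shows "norm x * measure lborel (cball (0 :: real ^ 'n) (min 1 (c / 4))) \<le> 4 * vol h"
proof (cases "x = 0")
  case False
  let ?\<rho> = "min 1 (c / 4)"
  define w where "w = x /\<^sub>R norm x"
  have w: "norm w = 1" "x = norm x *\<^sub>R w" using False by (auto simp: w_def)
  \<comment> \<open>An ellipsoid around the midpoint of the segment from 0 to \<open>x\<close>. With
    \<open>s = 1/2 + (y \<bullet> w) / 4\<close> between 1/4 and 3/4, the hull contains a disc of
    radius \<open>(1 - s) * c \<ge> c / 4\<close> around \<open>s *\<^sub>R x\<close>.\<close>
  define f where "f y = (1/2) *\<^sub>R x + 1 *\<^sub>R hyp_proj w y + ((norm x / 4) * (y \<bullet> w)) *\<^sub>R w" for y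
  have sub: "cball 0 ?\<rho> \<subseteq> f -` hbody m v h"
  proof
    fix y :: "real ^ 'n" assume y: "y \<in> cball 0 ?\<rho>"
    define s where "s = 1/2 + (y \<bullet> w) / 4"
    have "\<bar>y \<bullet> w\<bar> \<le> 1" using Cauchy_Schwarz_ineq2[of y w] w y by simp
    then have s: "1/4 \<le> s" "s \<le> 3/4" unfolding s_def by linarith+
    have "norm (hyp_proj w y) \<le> c / 4" using norm_hyp_proj_le[OF w(1), of y] y by simp
    moreover have "c * s \<le> c * (3/4)" using s c(1) by (intro mult_left_mono) auto
    ultimately have "c * s + norm (hyp_proj w y) \<le> c" by linarith
    then have "norm ((1 / (1 - s)) *\<^sub>R hyp_proj w y) \<le> c" using s by (simp add: field_simps)
    then have "(1 / (1 - s)) *\<^sub>R hyp_proj w y \<in> hbody m v h" using c(2) by auto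
    then have "s *\<^sub>R x + (1 - s) *\<^sub>R ((1 / (1 - s)) *\<^sub>R hyp_proj w y) \<in> hbody m v h"
      using x s by (intro convexD[OF convex_hbody]) auto
    moreover have "f y = s *\<^sub>R x + (1 - s) *\<^sub>R ((1 / (1 - s)) *\<^sub>R hyp_proj w y)"
    proof -
      have "((norm x / 4) * (y \<bullet> w)) *\<^sub>R w = ((y \<bullet> w) / 4) *\<^sub>R x" by (subst w(2)) simp
      then show ?thesis using s by (simp add: f_def s_def scaleR_add_left)
    qed
    ultimately show "y \<in> f -` hbody m v h" by simp
  qed
  have fm: "f -` hbody m v h \<in> sets borel"
    unfolding f_def using measurable_sets[of "\<lambda>y. (1/2) *\<^sub>R x + 1 *\<^sub>R hyp_proj w y + ((norm x / 4) * (y \<bullet> w)) *\<^sub>R w" borel borel "hbody m v h"]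
    by simp
  have "ennreal (norm x / 4) * emeasure lborel (cball (0 :: real ^ 'n) ?\<rho>) \<le> ennreal (norm x / 4) * emeasure lborel (f -` hbody m v h)"
    using sub fm by (intro mult_left_mono emeasure_mono) auto
  also have "\<dots> = emeasure lborel (hbody m v h)"
    unfolding f_def using emeasure_lborel_affine_direction[OF w(1), of 1 "norm x / 4" "hbody m v h" "(1/2) *\<^sub>R x"] False
    by simp
  also have "\<dots> = ennreal (vol h)"
    using emeasure_bounded_finite[OF bounded_hbody, of h] by (simp add: vol_def emeasure_eq_ennreal_measure)
  also have "emeasure lborel (cball (0 :: real ^ 'n) ?\<rho>) = ennreal (measure lborel (cball (0 :: real ^ 'n) ?\<rho>))"
    using emeasure_lborel_cball_finite[of "0 :: real ^ 'n" ?\<rho>] by (simp add: emeasure_eq_ennreal_measure)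
  finally have "norm x / 4 * measure lborel (cball (0 :: real ^ 'n) ?\<rho>) \<le> vol h"
    using vol_nonneg by (simp add: ennreal_mult[symmetric] ennreal_le_iff)
  then show ?thesis by simp
qed (use vol_nonneg in simp)

end

section \<open>The energy and its upward deformation\<close>

locale lp_energy = antipodal_normals m v for m :: nat and v :: "nat \<Rightarrow> real ^ 'n" +
  fixes \<alpha> :: "nat \<Rightarrow> real" and p :: real
  assumes \<alpha>_pos: "\<And>i. i < m \<Longrightarrow> 0 < \<alpha> i" and p_neg: "p < 0"
begin

definition energy :: "(nat \<Rightarrow> real) \<Rightarrow> real" where
  "energy h = vol h + (\<Sum>i<m. \<alpha> i / (- p) * h i powr p)"

definition grad :: "(nat \<Rightarrow> real) \<Rightarrow> nat \<Rightarrow> real" where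
  "grad h i = area i h - \<alpha> i * h i powr (p - 1)"

lemma coeff_pos: "i < m \<Longrightarrow> 0 < \<alpha> i / (- p)"
  using \<alpha>_pos p_neg by (simp add: field_simps)

lemma term_nonneg: "i \<in> {..<m} \<Longrightarrow> 0 \<le> \<alpha> i / (- p) * h i powr p"
  using coeff_pos by (intro mult_nonneg_nonneg less_imp_le[OF coeff_pos]) auto

lemma energy_nonneg: "0 \<le> energy h"
  unfolding energy_def by (intro add_nonneg_nonneg vol_nonneg sum_nonneg term_nonneg)

lemma energy_ge_term: "i < m \<Longrightarrow> \<alpha> i / (- p) * h i powr p \<le> energy h"
proof -
  assume i: "i < m"
  have "\<alpha> i / (- p) * h i powr p \<le> (\<Sum>i<m. \<alpha> i / (- p) * h i powr p)"
    by (rule member_le_sum[where f = "\<lambda>i. \<alpha> i / (- p) * h i powr p"]) (use i term_nonneg in blast)+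
  then show ?thesis using vol_nonneg[of h] by (simp add: energy_def)
qed

lemma energy_ge_vol: "vol h \<le> energy h"
proof -
  have "0 \<le> (\<Sum>i<m. \<alpha> i / (- p) * h i powr p)" by (intro sum_nonneg term_nonneg)
  then show ?thesis by (simp add: energy_def)
qed

text \<open>The volume is unchanged, while the support numbers decrease and \<open>powr p\<close> is
  decreasing for negative \<open>p\<close>.\<close>

lemma energy_reduce:
  assumes h: "h \<in> orthant m"
  shows "energy h \<le> energy (reduce h)"
  unfolding energy_def vol_reduce[OF h]
proof (intro add_left_mono sum_mono mult_left_mono)
  fix i assume i: "i \<in> {..<m}"
  show "h i powr p \<le> reduce h i powr p"
    using reduce_orthant[OF h] reduce_le[OF h] i p_neg
    by (intro powr_mono2') (auto simp: orthant_def)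
  show "0 \<le> \<alpha> i / (- p)" using coeff_pos i by (auto intro: less_imp_le)
qed

lemma continuous_on_energy: "continuous_on (orthant m) energy"
  unfolding energy_def[abs_def]
proof (intro continuous_intros continuous_on_vol)
  show "continuous_on (orthant m) (\<lambda>h. h i)" for i
    by (rule continuous_on_subset[OF continuous_on_product_coordinates]) auto
  show "\<And>i. i \<in> {..<m} \<Longrightarrow> \<forall>h\<in>orthant m. h i \<noteq> 0" by (force simp: orthant_def)
qed

lemma energy_DERIV:
  assumes i: "i < m" and h: "h \<in> orthant m" and t: "0 < t"
  shows "((\<lambda>t. energy (h(i := t))) has_real_derivative grad (h(i := t)) i) (at t)"
proof -
  have eq: "energy (h(i := t)) = vol (h(i := t)) + (\<alpha> i / (- p) * t powr p + (\<Sum>j\<in>{..<m} - {i}. \<alpha> j / (- p) * h j powr p))" for t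
    unfolding energy_def using i by (subst sum.remove[of "{..<m}" i]) (auto intro!: sum.cong)
  have d: "((\<lambda>t. t powr p) has_real_derivative p * t powr (p - 1)) (at t)"
    using t by (auto intro!: derivative_eq_intros simp: powr_diff)
  have "((\<lambda>t. energy (h(i := t))) has_real_derivative
      area i (h(i := t)) + (\<alpha> i / (- p) * (p * t powr (p - 1)) + 0)) (at t)"
    unfolding eq by (intro DERIV_add vol_DERIV[OF i h t] DERIV_const DERIV_cmult d)
  then show ?thesis using p_neg by (simp add: grad_def)
qed

lemma energy_mean_value:
  assumes i: "i < m" and h: "h \<in> orthant m" and ab: "0 < a" "0 < b"
  obtains z where "min a b \<le> z" "z \<le> max a b"
    "energy (h(i := b)) - energy (h(i := a)) = (b - a) * grad (h(i := z)) i"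
proof (cases "a = b")
  case True
  then show ?thesis using that[of a] by simp
next
  case False
  have mvt: "\<exists>z>a. z < b \<and> energy (h(i := b)) - energy (h(i := a)) = (b - a) * grad (h(i := z)) i"
    if "a < b" "0 < a" for a b
    using that by (intro MVT2 energy_DERIV[OF i h]) auto
  show ?thesis
  proof (cases "a < b")
    case True
    from mvt[OF this ab(1)] obtain z where "a < z" "z < b"
      "energy (h(i := b)) - energy (h(i := a)) = (b - a) * grad (h(i := z)) i" by blast
    then show ?thesis using that[of z] by simp
  next
    case False
    with \<open>a \<noteq> b\<close> have "b < a" by simp
    from mvt[OF this ab(2)] obtain z where "b < z" "z < a"
      "energy (h(i := a)) - energy (h(i := b)) = (a - b) * grad (h(i := z)) i" by blast
    then show ?thesis using that[of z] by (simp add: algebra_simps)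
  qed
qed

lemma tendsto_grad:
  assumes i: "i < m" and h: "h \<in> orthant m" and lim: "\<And>j. j < m \<Longrightarrow> (\<lambda>n. g n j) \<longlonglongrightarrow> h j"
  shows "(\<lambda>n. grad (g n) i) \<longlonglongrightarrow> grad h i"
proof -
  have "(\<lambda>n. area i (g n)) \<longlonglongrightarrow> area i h"
    using tendsto_measure_tilted[OF i h lim tendsto_const] by (simp add: area_def)
  moreover have "h i \<noteq> 0" using h i by (force simp: orthant_def)
  ultimately show ?thesis unfolding grad_def by (intro tendsto_intros lim i) auto
qed

lemma continuous_on_grad: "i < m \<Longrightarrow> continuous_on (orthant m) (\<lambda>h. grad h i)"
  by (rule continuous_on_sequentiallyI) (rule tendsto_grad, auto intro: tendsto_coordinate)

text \<open>Each summand blows up as its support number tends to 0, which gives \<open>c\<close> and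
  a ball of radius \<open>c\<close> in the body; the volume then bounds the diameter. Consistency
  turns this into a bound on the support numbers.\<close>

lemma energy_sublevel_bounds:
  obtains c M where "0 < c" "\<And>h i. h \<in> consistent \<Longrightarrow> energy h \<le> C \<Longrightarrow> i < m \<Longrightarrow> c \<le> h i \<and> h i \<le> M"
proof -
  \<comment> \<open>The maximum with 1 keeps \<open>d i\<close> positive for every \<open>C\<close>,
    so that its power with exponent \<open>1 / p\<close> is positive.\<close>
  define d where "d i = max 1 (C * (- p) / \<alpha> i)" for i
  define c where "c = Min ((\<lambda>i. d i powr (1 / p)) ` {..<m})"
  have c: "0 < c" unfolding c_def using m_pos by (subst Min_gr_iff) (auto simp: d_def)
  define k where "k = measure lborel (cball (0 :: real ^ 'n) (min 1 (c / 4)))"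
  have k: "0 < k" unfolding k_def using c by (simp add: content_cball)
  show ?thesis
  proof
    show "0 < c" by (rule c)
    fix h i assume h: "h \<in> consistent" and E: "energy h \<le> C" and i: "i < m"
    have h0: "h \<in> orthant m" using h by (rule consistent_orthant)
    have lower: "c \<le> h j" if j: "j < m" for j
    proof -
      have "\<alpha> j / (- p) * h j powr p \<le> C" using energy_ge_term[OF j, of h] E by simp
      then have "h j powr p \<le> C * (- p) / \<alpha> j"
        using \<alpha>_pos[OF j] p_neg by (simp add: field_simps)
      then have "h j powr p \<le> d j" by (simp add: d_def)
      moreover have hj: "0 < h j" using h0 j by (simp add: orthant_def)
      ultimately have "d j powr (1 / p) \<le> (h j powr p) powr (1 / p)"
        using p_neg by (intro powr_mono2') auto
      also have "\<dots> = h j" using hj p_neg by (simp add: powr_powr)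
      finally have "d j powr (1 / p) \<le> h j" .
      moreover have "c \<le> d j powr (1 / p)" unfolding c_def using j by (intro Min_le) auto
      ultimately show ?thesis by simp
    qed
    obtain x where x: "x \<in> hbody m v h" "x \<bullet> v i = section_support UNIV (v i) h"
      using section_support_attained[OF subspace_UNIV h0, where z = "v i"] by blast
    have "reduce h = h" using h by (simp add: consistent_def)
    then have "h i = reduce h i" by simp
    also have "\<dots> = x \<bullet> v i" unfolding reduce_def using i x(2) by simp
    also have "x \<bullet> v i \<le> norm x" using Cauchy_Schwarz_ineq2[of x "v i"] unit[OF i] by simp
    also have "norm x \<le> 4 * C / k"
    proof -
      have "norm x * k \<le> 4 * vol h"
        unfolding k_def by (rule vol_lower_bound[OF c cball_subset_hbody x(1)]) (use lower in auto)
      also have "\<dots> \<le> 4 * C" using energy_ge_vol[of h] E by simp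
      finally show ?thesis using k by (simp add: field_simps)
    qed
    finally show "c \<le> h i \<and> h i \<le> 4 * C / k" using lower[OF i] by simp
  qed
qed

text \<open>The sublevel lies in a product of compact intervals, with singletons \<open>{1}\<close>
  at the idle indices. The bound \<open>c > 0\<close> keeps this product inside the orthant, where
  energy and reduction are known to be continuous, so the conditions are closed.\<close>

lemma compact_energy_sublevel: "compact {h \<in> consistent. energy h \<le> C}"
proof -
  obtain c M where cM: "0 < c" "\<And>h i. h \<in> consistent \<Longrightarrow> energy h \<le> C \<Longrightarrow> i < m \<Longrightarrow> c \<le> h i \<and> h i \<le> M"
    using energy_sublevel_bounds by blast
  define B where "B = PiE UNIV (\<lambda>i. if i < m then {c..M} else {1::real})"
  have "compactin (product_topology (\<lambda>_. euclidean) UNIV) B"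
    unfolding B_def by (subst compactin_PiE) auto
  then have B: "compact B" by (simp add: euclidean_product_topology)
  have "c \<le> h i" if "h \<in> B" "i < m" for h i
  proof -
    have "h i \<in> (if i < m then {c..M} else {1})"
      using that(1) unfolding B_def by (rule PiE_mem) simp
    then show ?thesis using that(2) by simp
  qed
  then have Bo: "B \<subseteq> orthant m" using cM(1) by (force simp: orthant_def)
  have clB: "closed B" using B by (rule compact_imp_closed)
  have 1: "closed (B \<inter> energy -` {..C})"
    by (intro continuous_closed_preimage continuous_on_subset[OF continuous_on_energy Bo] clB) auto
  have 2: "closed (B \<inter> (\<lambda>h. reduce h i - h i) -` {0})" for i
  proof (intro continuous_closed_preimage clB continuous_intros)
    show "continuous_on B (\<lambda>h. reduce h i)"
      by (rule continuous_on_product_then_coordinatewise[OF continuous_on_subset[OF continuous_on_reduce Bo]])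
    show "continuous_on B (\<lambda>h. h i)"
      by (rule continuous_on_subset[OF continuous_on_product_coordinates]) auto
  qed
  have "{h \<in> consistent. energy h \<le> C} = (B \<inter> energy -` {..C}) \<inter> (\<Inter>i. B \<inter> (\<lambda>h. reduce h i - h i) -` {0})"
  proof (intro equalityI subsetI)
    fix h assume h: "h \<in> {h \<in> consistent. energy h \<le> C}"
    then have r: "reduce h = h" by (simp add: consistent_def)
    have "reduce h i = 1" if "\<not> i < m" for i using that by (simp add: reduce_def)
    then have "h i = 1" if "\<not> i < m" for i using r that by simp
    then have "h i \<in> (if i < m then {c..M} else {1})" for i using cM(2)[of h i] h by simp
    then have "h \<in> B" unfolding B_def by blast
    then show "h \<in> (B \<inter> energy -` {..C}) \<inter> (\<Inter>i. B \<inter> (\<lambda>h. reduce h i - h i) -` {0})"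
      using h r by auto
  next
    fix h assume h: "h \<in> (B \<inter> energy -` {..C}) \<inter> (\<Inter>i. B \<inter> (\<lambda>h. reduce h i - h i) -` {0})"
    then have "reduce h = h" by (intro ext) auto
    then show "h \<in> {h \<in> consistent. energy h \<le> C}" using h Bo by (auto simp: consistent_def)
  qed
  moreover have "compact (B \<inter> ((B \<inter> energy -` {..C}) \<inter> (\<Inter>i. B \<inter> (\<lambda>h. reduce h i - h i) -` {0})))"
    by (intro compact_Int_closed B closed_Int 1 closed_INT ballI 2)
  ultimately show ?thesis by (simp add: Int_absorb1 inf.coboundedI1 le_infI1)
qed

section \<open>Gradient ascent followed by reduction\<close>

definition push :: "real \<Rightarrow> (nat \<Rightarrow> real) \<Rightarrow> nat \<Rightarrow> real" where
  "push s h i = (if i < m then h i + s * grad h i else h i)"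

text \<open>Only derivatives in single coordinates are available. A sequence of counterexamples has
  a convergent subsequence, along which the energy increments divided by the step tend to the
  squared length of the gradient at the limit, which is positive.\<close>

lemma push_increases_energy:
  assumes crit: "\<And>h. h \<in> consistent \<Longrightarrow> \<exists>i<m. grad h i \<noteq> 0"
  obtains \<epsilon> where "0 < \<epsilon>"
    "\<And>h s. h \<in> consistent \<Longrightarrow> energy h \<le> C \<Longrightarrow> 0 < s \<Longrightarrow> s \<le> \<epsilon> \<Longrightarrow> push s h \<in> orthant m \<and> energy h < energy (push s h)"
proof (rule ccontr)
  assume neg: "\<not> thesis"
  have "\<exists>h s. h \<in> consistent \<and> energy h \<le> C \<and> 0 < s \<and> s \<le> 1 / real (Suc n) \<and>
      \<not> (push s h \<in> orthant m \<and> energy h < energy (push s h))" for n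
    using neg that[of "1 / real (Suc n)"] by force
  then obtain f s where f: "\<And>n. f n \<in> consistent" "\<And>n. energy (f n) \<le> C"
    and s: "\<And>n. 0 < s n" "\<And>n. s n \<le> 1 / real (Suc n)"
    and bad: "\<And>n. \<not> (push (s n) (f n) \<in> orthant m \<and> energy (f n) < energy (push (s n) (f n)))"
    by metis
  have slim: "s \<longlonglongrightarrow> 0"
    by (rule real_tendsto_sandwich[OF _ _ tendsto_const LIMSEQ_inverse_real_of_nat])
      (use s in \<open>auto intro!: always_eventually less_imp_le simp: inverse_eq_divide\<close>)
  have "seq_compact {h \<in> consistent. energy h \<le> C}"
    by (rule compact_imp_seq_compact[OF compact_energy_sublevel])
  then obtain a r where a: "a \<in> consistent" and r: "strict_mono (r :: nat \<Rightarrow> nat)" and lim: "(f \<circ> r) \<longlonglongrightarrow> a"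
    using f unfolding seq_compact_def by (metis (mono_tags, lifting) mem_Collect_eq)
  have ao: "a \<in> orthant m" using a by (rule consistent_orthant)
  define x where "x n = f (r n)" for n
  define t where "t n = s (r n)" for n
  have xlim: "(\<lambda>n. x n j) \<longlonglongrightarrow> a j" for j
    using tendsto_coordinate[OF lim, of j] by (simp add: x_def)
  have tlim: "t \<longlonglongrightarrow> 0" using LIMSEQ_subseq_LIMSEQ[OF slim r] by (simp add: t_def[abs_def] o_def)
  have tpos: "0 < t n" for n by (simp add: t_def s)
  have glim: "(\<lambda>n. grad (x n) j) \<longlonglongrightarrow> grad a j" if "j < m" for j
    by (rule tendsto_grad[OF that ao xlim])
  have plim: "(\<lambda>n. push (t n) (x n) j) \<longlonglongrightarrow> a j" if "j < m" for j
  proof -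
    have "(\<lambda>n. x n j + t n * grad (x n) j) \<longlonglongrightarrow> a j + 0 * grad a j"
      by (intro tendsto_intros xlim tlim glim that)
    then show ?thesis using that by (simp add: push_def)
  qed
  have xo: "x n \<in> orthant m" for n unfolding x_def using f consistent_orthant by blast
  have "\<forall>\<^sub>F n in sequentially. \<forall>j\<in>{..<m}. 0 < push (t n) (x n) j"
    using order_tendstoD(1)[OF plim] ao by (intro eventually_ball_finite) (auto simp: orthant_def)
  then have ev_orthant: "\<forall>\<^sub>F n in sequentially. push (t n) (x n) \<in> orthant m"
    by eventually_elim (simp add: orthant_def)
  \<comment> \<open>The first \<open>j\<close> coordinates are already pushed, the others not yet;
    passing from \<open>j\<close> to \<open>Suc j\<close> changes one coordinate, so the mean value
    theorem applies and the increments telescope.\<close>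
  define H where "H n j i = (if i < j then push (t n) (x n) i else x n i)" for n j i
  \<comment> \<open>The energy identity is conditional because the mean value theorem is available
    only once the pushed vector lies in the orthant, which holds eventually.\<close>
  define between where "between n j z \<longleftrightarrow> min (x n j) (push (t n) (x n) j) \<le> z \<and> z \<le> max (x n j) (push (t n) (x n) j) \<and>
      (push (t n) (x n) \<in> orthant m \<longrightarrow>
        energy (H n (Suc j)) - energy (H n j) = t n * grad (x n) j * grad ((H n j)(j := z)) j)" for n j z
  have "\<exists>z. between n j z"
    if j: "j < m" for n j
  proof (cases "push (t n) (x n) \<in> orthant m")
    case True
    have Ho: "H n j \<in> orthant m" using True xo[of n] by (auto simp: orthant_def H_def)
    have "0 < x n j" "0 < push (t n) (x n) j" using True xo[of n] j by (auto simp: orthant_def)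
    then obtain z where z: "min (x n j) (push (t n) (x n) j) \<le> z" "z \<le> max (x n j) (push (t n) (x n) j)"
      "energy ((H n j)(j := push (t n) (x n) j)) - energy ((H n j)(j := x n j))
        = (push (t n) (x n) j - x n j) * grad ((H n j)(j := z)) j"
      using energy_mean_value[OF j Ho] by metis
    moreover have "(H n j)(j := push (t n) (x n) j) = H n (Suc j)"
      by (auto simp: H_def fun_eq_iff less_Suc_eq)
    moreover have "(H n j)(j := x n j) = H n j" by (auto simp: H_def)
    ultimately show ?thesis using j by (intro exI[of _ z]) (simp add: push_def between_def)
  qed (auto simp: between_def intro!: exI[of _ "x n j"])
  note ex = this
  define z where "z n j = (SOME w. between n j w)" for n j
  have between: "between n j (z n j)" if "j < m" for n j
    unfolding z_def by (rule someI_ex) (rule ex[OF that])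
  have z: "min (x n j) (push (t n) (x n) j) \<le> z n j" "z n j \<le> max (x n j) (push (t n) (x n) j)"
    "push (t n) (x n) \<in> orthant m \<Longrightarrow>
        energy (H n (Suc j)) - energy (H n j) = t n * grad (x n) j * grad ((H n j)(j := z n j)) j"
    if "j < m" for n j
    using between[OF that, of n] by (auto simp: between_def)
  have zlim: "(\<lambda>n. z n j) \<longlonglongrightarrow> a j" if j: "j < m" for j
  proof (rule real_tendsto_sandwich)
    show "(\<lambda>n. min (x n j) (push (t n) (x n) j)) \<longlonglongrightarrow> a j"
      using tendsto_min[OF xlim[of j] plim[OF j]] by simp
    show "(\<lambda>n. max (x n j) (push (t n) (x n) j)) \<longlonglongrightarrow> a j"
      using tendsto_max[OF xlim[of j] plim[OF j]] by simp
  qed (use z j in auto)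
  have "(\<lambda>n. \<Sum>j<m. grad (x n) j * grad ((H n j)(j := z n j)) j) \<longlonglongrightarrow> (\<Sum>j<m. grad a j * grad a j)"
  proof (intro tendsto_intros glim tendsto_grad[OF _ ao])
    fix j i assume j: "j \<in> {..<m}" and i: "i < m"
    show "(\<lambda>n. ((H n j)(j := z n j)) i) \<longlonglongrightarrow> a i"
      using zlim[of j] plim[OF i] xlim[of i] i j by (cases "i = j"; cases "i < j") (auto simp: H_def)
  qed auto
  moreover have "0 < (\<Sum>j<m. grad a j * grad a j)"
  proof -
    obtain i where i: "i < m" "grad a i \<noteq> 0" using crit[OF a] by blast
    show ?thesis
      by (rule sum_pos2[of _ i]) (use i in \<open>auto simp: zero_less_mult_iff linorder_neq_iff\<close>)
  qed
  ultimately have "\<forall>\<^sub>F n in sequentially. 0 < (\<Sum>j<m. grad (x n) j * grad ((H n j)(j := z n j)) j)"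
    by (rule order_tendstoD(1))
  with ev_orthant have "\<forall>\<^sub>F n in sequentially. push (t n) (x n) \<in> orthant m \<and> energy (x n) < energy (push (t n) (x n))"
  proof eventually_elim
    fix n assume po: "push (t n) (x n) \<in> orthant m"
      and pos: "0 < (\<Sum>j<m. grad (x n) j * grad ((H n j)(j := z n j)) j)"
    have "energy (H n m) - energy (H n 0) = (\<Sum>j<m. energy (H n (Suc j)) - energy (H n j))"
      by (rule sum_lessThan_telescope[symmetric])
    also have "\<dots> = t n * (\<Sum>j<m. grad (x n) j * grad ((H n j)(j := z n j)) j)"
      using z(3) po by (simp add: sum_distrib_left mult.assoc)
    also have "\<dots> > 0" using tpos pos by simp
    moreover have "H n 0 = x n" "H n m = push (t n) (x n)" by (auto simp: H_def push_def)
    ultimately show "push (t n) (x n) \<in> orthant m \<and> energy (x n) < energy (push (t n) (x n))" using po by simp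
  qed
  then obtain n where "push (t n) (x n) \<in> orthant m \<and> energy (x n) < energy (push (t n) (x n))"
    using eventually_happens'[OF sequentially_bot] by blast
  then show False using bad[of "r n"] by (simp add: x_def t_def)
qed

text \<open>A push damped by a function of the energy, then a reduction, which never loses energy.
  The gain is positive and continuous on the compact set \<open>energy h \<le> C\<close>, hence
  bounded below by some \<open>\<delta>\<close>.\<close>

lemma upward_deformation:
  assumes crit: "\<And>h. h \<in> consistent \<Longrightarrow> \<exists>i<m. grad h i \<noteq> 0"
  obtains D \<delta> where "0 < \<delta>" "continuous_on consistent D"
    "\<And>h. h \<in> consistent \<Longrightarrow> D h \<in> consistent"
    "\<And>h. h \<in> consistent \<Longrightarrow> energy h \<le> C \<Longrightarrow> energy h + \<delta> \<le> energy (D h)"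
    "\<And>h. h \<in> consistent \<Longrightarrow> energy h \<le> energy (D h)"
    "\<And>h. h \<in> consistent \<Longrightarrow> C + 1 \<le> energy h \<Longrightarrow> D h = h"
proof -
  obtain \<epsilon> where \<epsilon>: "0 < \<epsilon>"
    "\<And>h s. h \<in> consistent \<Longrightarrow> energy h \<le> C + 1 \<Longrightarrow> 0 < s \<Longrightarrow> s \<le> \<epsilon> \<Longrightarrow> push s h \<in> orthant m \<and> energy h < energy (push s h)"
    using push_increases_energy[OF crit] by blast
  \<comment> \<open>Full step \<open>\<epsilon>\<close> up to energy \<open>C\<close>, no step from
    \<open>C + 1\<close> on. The push must still be valid in between, so \<open>\<epsilon>\<close>
    was taken for the level \<open>C + 1\<close>.\<close>
  define cutoff where "cutoff h = \<epsilon> * max 0 (min 1 (C + 1 - energy h))" for h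
  define D where "D h = reduce (push (cutoff h) h)" for h
  have co: "continuous_on consistent f" if "continuous_on (orthant m) f" for f :: "(nat \<Rightarrow> real) \<Rightarrow> real"
    by (rule continuous_on_subset[OF that]) (use consistent_orthant in blast)
  have cutoff: "0 \<le> cutoff h" "cutoff h \<le> \<epsilon>" "cutoff h = 0 \<longleftrightarrow> C + 1 \<le> energy h" for h
    using \<epsilon>(1) by (auto simp: cutoff_def max_def min_def mult_le_cancel_left1)
  have push0: "push 0 h = h" for h by (auto simp: push_def)
  have push: "push (cutoff h) h \<in> orthant m \<and> energy h \<le> energy (push (cutoff h) h) \<and>
      (energy h < C + 1 \<longrightarrow> energy h < energy (push (cutoff h) h))" if h: "h \<in> consistent" for h
  proof (cases "C + 1 \<le> energy h")
    case True
    then show ?thesis using cutoff(3)[of h] h push0 consistent_orthant by simp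
  next
    case False
    then have "0 < cutoff h" using cutoff(1,3)[of h] by linarith
    then show ?thesis using \<epsilon>(2)[OF h _ _ cutoff(2)] False by force
  qed
  have D_in: "D h \<in> consistent" if h: "h \<in> consistent" for h
    using push[OF h] unfolding D_def consistent_def by (simp add: reduce_orthant reduce_reduce)
  have D_ge: "energy (push (cutoff h) h) \<le> energy (D h)" if h: "h \<in> consistent" for h
    unfolding D_def using push[OF h] by (simp add: energy_reduce)
  have cont_coord: "continuous_on consistent (\<lambda>h. h i)" for i
    by (rule continuous_on_subset[OF continuous_on_product_coordinates]) auto
  have cont_push: "continuous_on consistent (\<lambda>h. push (cutoff h) h)"
  proof (rule continuous_on_coordinatewise_then_product)
    fix i
    show "continuous_on consistent (\<lambda>h. push (cutoff h) h i)"
      unfolding push_def cutoff_def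
      by (cases "i < m") (auto intro!: continuous_intros cont_coord co[OF continuous_on_energy] co[OF continuous_on_grad])
  qed
  have cont_D: "continuous_on consistent D"
    unfolding D_def
    by (rule continuous_on_compose2[OF continuous_on_reduce cont_push]) (use push in auto)
  let ?K = "{h \<in> consistent. energy h \<le> C}"
  have "\<exists>\<delta>>0. \<forall>h\<in>?K. energy h + \<delta> \<le> energy (D h)"
  proof (cases "?K = {}")
    case True
    then show ?thesis by (intro exI[of _ 1]) auto
  next
    case False
    have "continuous_on consistent (\<lambda>h. energy (D h) - energy h)"
      by (intro continuous_intros co[OF continuous_on_energy] continuous_on_compose2[OF continuous_on_energy cont_D])
        (use D_in consistent_orthant in auto)
    then have "continuous_on ?K (\<lambda>h. energy (D h) - energy h)"
      by (rule continuous_on_subset) auto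
    then obtain a where a: "a \<in> ?K" "\<And>h. h \<in> ?K \<Longrightarrow> energy (D a) - energy a \<le> energy (D h) - energy h"
      using continuous_attains_inf[OF compact_energy_sublevel False] by blast
    have "0 < energy (D a) - energy a" using push[of a] D_ge[of a] a(1) by force
    then show ?thesis using a(2) by (intro exI[of _ "energy (D a) - energy a"]) force
  qed
  then obtain \<delta> where \<delta>: "0 < \<delta>" "\<And>h. h \<in> ?K \<Longrightarrow> energy h + \<delta> \<le> energy (D h)" by blast
  show ?thesis
  proof
    show "energy h \<le> energy (D h)" if "h \<in> consistent" for h
      using push[OF that] D_ge[OF that] by linarith
    show "D h = h" if "h \<in> consistent" "C + 1 \<le> energy h" for h
      using cutoff(3)[of h] that by (simp add: D_def push0 consistent_def)
  qed (use \<delta> cont_D D_in in auto)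
qed

end

section \<open>Linking: existence of a critical point\<close>

text \<open>Taking inner products with the \<open>b k\<close> is injective because they span, and
  surjective because there are as many of them as dimensions; \<open>d\<close> is the dual
  basis.\<close>

lemma spanning_family_dual:
  fixes b :: "'n \<Rightarrow> real ^ 'n"
  assumes span: "span (range b) = UNIV"
  obtains d where "\<And>j k. b j \<bullet> d k = (if j = k then 1 else 0)" "\<And>y. y = (\<Sum>k\<in>UNIV. (y \<bullet> d k) *\<^sub>R b k)"
proof -
  define f where "f y = (\<chi> k. y \<bullet> b k)" for y :: "real ^ 'n"
  have lin: "linear f" by (rule linearI) (auto simp: f_def vec_eq_iff inner_add_left)
  have "inj f"
  proof (rule linear_injective_0[OF lin, THEN iffD2], intro allI impI)
    fix y assume "f y = 0"
    then have z: "y \<bullet> b k = 0" for k by (simp add: f_def vec_eq_iff)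
    have "y \<in> span (range b)" using span by simp
    then have "y \<bullet> y = 0"
      by (rule span_induct[where P = "\<lambda>w. y \<bullet> w = 0"]) (auto simp: z intro: subspace_hyperplane)
    then show "y = 0" by simp
  qed
  then have "surj f" by (rule linear_injective_imp_surjective[OF lin]) simp
  then have "\<exists>y. f y = axis k 1" for k by (metis surjD)
  then obtain d where d: "\<And>k. f (d k) = axis k 1" by metis
  have dual: "b j \<bullet> d k = (if j = k then 1 else 0)" for j k
  proof -
    have "f (d k) $ j = axis k 1 $ j" using d by simp
    then show ?thesis by (simp add: f_def axis_def inner_commute)
  qed
  have "y = (\<Sum>k\<in>UNIV. (y \<bullet> d k) *\<^sub>R b k)" for y
  proof -
    have "id y = (\<Sum>k\<in>UNIV. (y \<bullet> d k) *\<^sub>R b k)"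
    proof (rule linear_eq_on[where B = "range b" and f = id and g = "\<lambda>y. \<Sum>k\<in>UNIV. (y \<bullet> d k) *\<^sub>R b k"])
      show "linear (\<lambda>y. \<Sum>k\<in>UNIV. (y \<bullet> d k) *\<^sub>R b k)"
        by (rule linearI) (auto simp: inner_add_left scaleR_add_left sum.distrib scaleR_sum_right)
      show "y \<in> span (range b)" using span by simp
      fix z assume "z \<in> range b"
      then obtain j where "z = b j" by auto
      have "(\<Sum>k\<in>UNIV. (b j \<bullet> d k) *\<^sub>R b k) = (\<Sum>k\<in>UNIV. if k = j then b j else 0)"
        by (intro sum.cong) (auto simp: dual)
      then show "id z = (\<Sum>k\<in>UNIV. (z \<bullet> d k) *\<^sub>R b k)" using \<open>z = b j\<close> by simp
    qed (rule linear_id)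
    then show ?thesis by simp
  qed
  with dual show ?thesis using that by blast
qed

section \<open>The sheet of parallelepipeds and its coordinates\<close>

locale lp_energy_basis = lp_energy m v \<alpha> p for m :: nat and v :: "nat \<Rightarrow> real ^ 'n" and \<alpha> p +
  fixes b d :: "'n \<Rightarrow> real ^ 'n" and e :: "'n \<Rightarrow> nat"
  assumes b_in: "\<And>k. b k \<in> v ` {..<m}"
    and dual: "\<And>j k. b j \<bullet> d k = (if j = k then 1 else 0)"
    and expand: "\<And>y. y = (\<Sum>k\<in>UNIV. (y \<bullet> d k) *\<^sub>R b k)"
    and e_bij: "bij_betw e UNIV {..<CARD('n)}"
begin

text \<open>Decreasing from the whole space at \<open>r = 0\<close> to the zero space at
  \<open>r = CARD('n)\<close>; \<open>e\<close> fixes the order of the basis.\<close>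

definition flag :: "nat \<Rightarrow> (real ^ 'n) set" where
  "flag r = {x. \<forall>j. e j < r \<longrightarrow> x \<bullet> b j = 0}"

definition signed :: "'n \<times> bool \<Rightarrow> real ^ 'n" where
  "signed q = (if snd q then b (fst q) else - b (fst q))"

text \<open>The coordinates reached by the successive sections of the body along the flag; they retract
  the support numbers onto those of the parallelepipeds with facet normals \<open>b k\<close> and \<open>- b k\<close>.\<close>

definition coords :: "(nat \<Rightarrow> real) \<Rightarrow> real ^ ('n \<times> bool)" where
  "coords h = (\<chi> q. section_support (flag (e (fst q))) (signed q) h)"

text \<open>The support function at \<open>v i\<close> of the parallelepiped
  \<open>- x $ (k, False) \<le> y \<bullet> b k \<le> x $ (k, True)\<close>, with \<open>v i\<close>
  expanded in the basis. The value 1 at idle indices matches \<open>reduce\<close>.\<close>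

definition sheet :: "real ^ ('n \<times> bool) \<Rightarrow> nat \<Rightarrow> real" where
  "sheet x i = (if i < m then \<Sum>k\<in>UNIV. max (v i \<bullet> d k) 0 * x $ (k, True) + max (- (v i \<bullet> d k)) 0 * x $ (k, False) else 1)"

definition pos :: "(real ^ ('n \<times> bool)) set" where
  "pos = {x. \<forall>q. 0 < x $ q}"

lemma subspace_flag: "subspace (flag r)"
  by (auto simp: subspace_def flag_def inner_add_left)

lemma inner_expand: "y \<bullet> w = (\<Sum>k\<in>UNIV. (w \<bullet> d k) * (y \<bullet> b k))"
proof -
  have "y \<bullet> w = y \<bullet> (\<Sum>k\<in>UNIV. (w \<bullet> d k) *\<^sub>R b k)" using expand[of w] by simp
  then show ?thesis by (simp add: inner_sum_right)
qed

lemma prescribed_inner: "(\<Sum>k\<in>UNIV. t k *\<^sub>R d k) \<bullet> b j = t j"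
proof -
  have "(\<Sum>k\<in>UNIV. t k *\<^sub>R d k) \<bullet> b j = (\<Sum>k\<in>UNIV. if k = j then t j else 0)"
    unfolding inner_sum_left using dual by (intro sum.cong) (auto simp: inner_commute[of "d _"])
  then show ?thesis by simp
qed

text \<open>Antipodality provides \<open>- b k\<close> among the normals, so the parameters of the
  sheet occur among its support numbers.\<close>

lemma sheet_at_basis: "\<exists>i<m. v i = signed q \<and> sheet x i = x $ q"
proof -
  obtain k s where q: "q = (k, s)" by (cases q)
  obtain i where i: "i < m" "v i = signed q"
  proof (cases s)
    case True
    then show ?thesis using b_in[of k] that q by (auto simp: signed_def)
  next
    case False
    then show ?thesis using b_in[of k] antipodal that q by (fastforce simp: signed_def)
  qed
  have "sheet x i = (\<Sum>l\<in>UNIV. if l = k then x $ q else 0)"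
    unfolding sheet_def if_P[OF i(1)] by (intro sum.cong refl) (auto simp: dual i(2) q signed_def)
  then show ?thesis using i by auto
qed

lemma ex_nonzero_coefficient: "i < m \<Longrightarrow> \<exists>k. v i \<bullet> d k \<noteq> 0"
proof (rule ccontr)
  assume i: "i < m" and "\<not> (\<exists>k. v i \<bullet> d k \<noteq> 0)"
  then have "v i = 0" using expand[of "v i"] by simp
  then show False using unit[OF i] by simp
qed

text \<open>The constraints with normals \<open>b k\<close> and \<open>- b k\<close> imply all
  others, term by term in the basis expansion of \<open>v i\<close>.\<close>

lemma hbody_sheet:
  assumes x: "x \<in> pos"
  shows "hbody m v (sheet x) = {y. \<forall>k. - x $ (k, False) \<le> y \<bullet> b k \<and> y \<bullet> b k \<le> x $ (k, True)}"
proof (intro equalityI subsetI)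
  fix y assume y: "y \<in> hbody m v (sheet x)"
  have "- x $ (k, False) \<le> y \<bullet> b k \<and> y \<bullet> b k \<le> x $ (k, True)" for k
  proof
    have "y \<bullet> signed (k, s) \<le> x $ (k, s)" for s
    proof -
      obtain i where "i < m" "v i = signed (k, s)" "sheet x i = x $ (k, s)" using sheet_at_basis by blast
      then show ?thesis using y unfolding hbody_def by fastforce
    qed
    from this[of True] this[of False]
    show "- x $ (k, False) \<le> y \<bullet> b k" "y \<bullet> b k \<le> x $ (k, True)" by (auto simp: signed_def)
  qed
  then show "y \<in> {y. \<forall>k. - x $ (k, False) \<le> y \<bullet> b k \<and> y \<bullet> b k \<le> x $ (k, True)}" by blast
next
  fix y assume y: "y \<in> {y. \<forall>k. - x $ (k, False) \<le> y \<bullet> b k \<and> y \<bullet> b k \<le> x $ (k, True)}"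
  have "y \<bullet> v i \<le> sheet x i" if i: "i < m" for i
  proof -
    have "c * (y \<bullet> b k) \<le> max c 0 * x $ (k, True) + max (- c) 0 * x $ (k, False)" for c k
    proof (cases "0 \<le> c")
      case True
      then show ?thesis using y by (simp add: max_def mult_left_mono)
    next
      case False
      then have "(- c) * (- (y \<bullet> b k)) \<le> (- c) * x $ (k, False)"
        using y by (intro mult_left_mono) (auto simp: minus_le_iff)
      then show ?thesis using False by (simp add: max_def)
    qed
    then show ?thesis
      unfolding sheet_def using i by (subst inner_expand) (auto intro!: sum_mono)
  qed
  then show "y \<in> hbody m v (sheet x)" by (simp add: hbody_def)
qed

lemma sheet_attained:
  assumes x: "x \<in> pos" and i: "i < m"
  obtains y where "y \<in> hbody m v (sheet x)" "y \<bullet> v i = sheet x i"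
proof -
  \<comment> \<open>The vertex of the parallelepiped selected by the signs of the coefficients of
    \<open>v i\<close>.\<close>
  define y where "y = (\<Sum>k\<in>UNIV. (if 0 \<le> v i \<bullet> d k then x $ (k, True) else - x $ (k, False)) *\<^sub>R d k)"
  have yb: "y \<bullet> b k = (if 0 \<le> v i \<bullet> d k then x $ (k, True) else - x $ (k, False))" for k
    unfolding y_def by (rule prescribed_inner)
  have xp: "0 < x $ q" for q using x unfolding pos_def by blast
  have "- x $ (k, False) \<le> y \<bullet> b k \<and> y \<bullet> b k \<le> x $ (k, True)" for k
    using xp[of "(k, True)"] xp[of "(k, False)"] by (simp add: yb)
  then have "y \<in> hbody m v (sheet x)" by (simp add: hbody_sheet[OF x])
  moreover have "y \<bullet> v i = sheet x i"
    unfolding sheet_def using i by (subst inner_expand) (auto simp: yb max_def intro!: sum.cong)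
  ultimately show ?thesis using that by blast
qed

lemma sheet_consistent:
  assumes x: "x \<in> pos"
  shows "sheet x \<in> consistent"
proof -
  have xp: "0 < x $ q" for q using x unfolding pos_def by blast
  have "0 < sheet x i" if i: "i < m" for i
  proof -
    obtain k where k: "v i \<bullet> d k \<noteq> 0" using ex_nonzero_coefficient[OF i] by blast
    have "0 < (\<Sum>k\<in>UNIV. max (v i \<bullet> d k) 0 * x $ (k, True) + max (- (v i \<bullet> d k)) 0 * x $ (k, False))"
    proof (rule sum_pos2[of _ k])
      show "0 < max (v i \<bullet> d k) 0 * x $ (k, True) + max (- (v i \<bullet> d k)) 0 * x $ (k, False)"
        using k xp[of "(k, True)"] xp[of "(k, False)"] by (auto simp: max_def mult_neg_pos)
    qed (auto intro!: add_nonneg_nonneg mult_nonneg_nonneg less_imp_le[OF xp])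
    then show ?thesis using i by (simp add: sheet_def)
  qed
  then have o: "sheet x \<in> orthant m" by (simp add: orthant_def)
  have "reduce (sheet x) i = sheet x i" for i
  proof (cases "i < m")
    case True
    obtain y where y: "y \<in> hbody m v (sheet x)" "y \<bullet> v i = sheet x i" by (rule sheet_attained[OF x True])
    have "sheet x i \<le> section_support UNIV (v i) (sheet x)"
      using section_support_upper[OF y(1) UNIV_I, of "v i"] y(2) by simp
    then show ?thesis using reduce_le[OF o True] True by (simp add: reduce_def)
  qed (simp add: reduce_def sheet_def)
  then show ?thesis using o by (auto simp: consistent_def)
qed

text \<open>Sectioning does not change these supports for a parallelepiped: the multiple of
  \<open>d k\<close> on the facet in question already lies in the section, since \<open>d k\<close>
  is orthogonal to all other \<open>b j\<close>.\<close>

lemma coords_sheet: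
  assumes x: "x \<in> pos"
  shows "coords (sheet x) = x"
proof -
  have xp: "0 < x $ q" for q using x unfolding pos_def by blast
  have o: "sheet x \<in> orthant m" using sheet_consistent[OF x] by (rule consistent_orthant)
  have "section_support (flag (e k)) (signed (k, s)) (sheet x) = x $ (k, s)" for k s
  proof (rule antisym)
    show "section_support (flag (e k)) (signed (k, s)) (sheet x) \<le> x $ (k, s)"
    proof (rule section_support_least[OF subspace_flag o])
      fix y assume "y \<in> hbody m v (sheet x)"
      then have "- x $ (k, False) \<le> y \<bullet> b k \<and> y \<bullet> b k \<le> x $ (k, True)" by (simp add: hbody_sheet[OF x])
      then show "y \<bullet> signed (k, s) \<le> x $ (k, s)" by (cases s) (auto simp: signed_def)
    qed
    define t where "t j = (if j = k then (if s then x $ (k, s) else - x $ (k, s)) else 0)" for j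
    define y where "y = (\<Sum>j\<in>UNIV. t j *\<^sub>R d j)"
    have yb: "y \<bullet> b j = t j" for j unfolding y_def by (rule prescribed_inner)
    have "- x $ (j, False) \<le> t j \<and> t j \<le> x $ (j, True)" for j
      using xp[of "(j, True)"] xp[of "(j, False)"] xp[of "(k, s)"] by (cases s) (auto simp: t_def)
    then have "y \<in> hbody m v (sheet x)" by (simp add: hbody_sheet[OF x] yb)
    moreover have "y \<in> flag (e k)" by (auto simp: flag_def yb t_def)
    ultimately have "y \<bullet> signed (k, s) \<le> section_support (flag (e k)) (signed (k, s)) (sheet x)"
      by (rule section_support_upper)
    then show "x $ (k, s) \<le> section_support (flag (e k)) (signed (k, s)) (sheet x)"
      by (cases s) (auto simp: signed_def yb t_def)
  qed
  then show ?thesis by (auto simp: coords_def vec_eq_iff)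
qed

lemma continuous_on_sheet: "continuous_on S sheet"
proof (rule continuous_on_coordinatewise_then_product)
  show "continuous_on S (\<lambda>x. sheet x i)" for i
    unfolding sheet_def by (cases "i < m") (auto intro!: continuous_intros)
qed

lemma continuous_on_coords: "continuous_on (orthant m) coords"
  unfolding coords_def by (intro continuous_on_vec_lambda continuous_on_section_support subspace_flag)

text \<open>The normalisation bounds the support numbers from below, hence the sum of powers from
  above; it also bounds the body, hence the volume.\<close>

lemma energy_bounded_on_linking_set:
  obtains C where "\<And>h. h \<in> consistent \<Longrightarrow> coords h = (\<chi> q. 1) \<Longrightarrow> energy h \<le> C"
proof -
  define c where "c = Min ((\<lambda>(i, k). \<bar>v i \<bullet> d k\<bar>) ` {(i, k). i < m \<and> v i \<bullet> d k \<noteq> 0})"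
  define Z where "Z = {h \<in> consistent. coords h = (\<chi> q. 1)}"
  \<comment> \<open>Last in the order of the flag: for this \<open>k\<close> the section by
    \<open>flag (e k)\<close> kills the earlier terms of \<open>x \<bullet> v i\<close>, and the
    later coefficients vanish, so a single term is left in the lower bound.\<close>
  have last: "\<exists>k. v i \<bullet> d k \<noteq> 0 \<and> (\<forall>j. e k < e j \<longrightarrow> v i \<bullet> d j = 0)" if i: "i < m" for i
  proof -
    have "\<exists>k. v i \<bullet> d k \<noteq> 0" by (rule ex_nonzero_coefficient[OF i])
    moreover have "e k < Suc (CARD('n))" for k using e_bij by (auto simp: bij_betw_def less_Suc_eq)
    ultimately obtain k where "v i \<bullet> d k \<noteq> 0" "\<And>j. v i \<bullet> d j \<noteq> 0 \<Longrightarrow> e j \<le> e k"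
      using ex_has_greatest_nat[of "\<lambda>k. v i \<bullet> d k \<noteq> 0" _ e "Suc (CARD('n))"] by blast
    then show ?thesis by (metis leD)
  qed
  have fin: "finite {(i, k). i < m \<and> v i \<bullet> d k \<noteq> 0}"
    by (rule finite_subset[of _ "{..<m} \<times> UNIV"]) auto
  have c_le: "c \<le> \<bar>v i \<bullet> d k\<bar>" if "i < m" "v i \<bullet> d k \<noteq> 0" for i k
    unfolding c_def using fin that by (intro Min_le) auto
  have c: "0 < c"
  proof -
    have "{(i, k). i < m \<and> v i \<bullet> d k \<noteq> 0} \<noteq> {}" using last[OF m_pos] m_pos by auto
    then show ?thesis unfolding c_def using fin by (subst Min_gr_iff) auto
  qed
  have sec: "section_support (flag (e k)) (signed (k, s)) h = 1" if h: "h \<in> Z" for h k s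
  proof -
    have "coords h $ (k, s) = 1" using h by (simp add: Z_def)
    then show ?thesis by (simp add: coords_def)
  qed
  have lower: "c \<le> h i" if h: "h \<in> Z" and i: "i < m" for h i
  proof -
    have ho: "h \<in> orthant m" using h by (simp add: Z_def consistent_orthant)
    obtain k where k: "v i \<bullet> d k \<noteq> 0" "\<And>j. e k < e j \<Longrightarrow> v i \<bullet> d j = 0" using last[OF i] by blast
    define s where "s = (0 < v i \<bullet> d k)"
    obtain x where x: "x \<in> hbody m v h" "x \<in> flag (e k)" "x \<bullet> signed (k, s) = section_support (flag (e k)) (signed (k, s)) h"
      using section_support_attained[OF subspace_flag ho] by blast
    have "x \<bullet> v i = (\<Sum>j\<in>UNIV. (v i \<bullet> d j) * (x \<bullet> b j))" by (rule inner_expand)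
    also have "\<dots> = (\<Sum>j\<in>UNIV. if j = k then (v i \<bullet> d k) * (x \<bullet> b k) else 0)"
    proof (rule sum.cong[OF refl])
      fix j
      have "e j \<noteq> e k" if "j \<noteq> k" using e_bij that by (auto simp: bij_betw_def inj_on_def)
      then have "j = k \<or> e j < e k \<or> e k < e j" by linarith
      then show "(v i \<bullet> d j) * (x \<bullet> b j) = (if j = k then (v i \<bullet> d k) * (x \<bullet> b k) else 0)"
        using k(2)[of j] x(2) by (auto simp: flag_def)
    qed
    also have "\<dots> = \<bar>v i \<bullet> d k\<bar>"
      using x(3) sec[OF h, of k s] k(1) by (auto simp: s_def signed_def split: if_splits)
    finally have "c \<le> x \<bullet> v i" using c_le[OF i k(1)] by simp
    also have "x \<bullet> v i \<le> h i" using x(1) i by (simp add: hbody_def)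
    finally show ?thesis .
  qed
  \<comment> \<open>Descending along the flag index from the zero space: a bound on the section by
    \<open>flag (Suc r)\<close> gives one on the larger section by \<open>flag r\<close>, and
    \<open>r = 0\<close> is the whole body.\<close>
  have bound: "r \<le> CARD('n) \<Longrightarrow> \<exists>\<rho>. \<forall>h\<in>Z. \<forall>x\<in>hbody m v h \<inter> flag r. norm x \<le> \<rho>" for r
  proof (induction rule: inc_induct)
    case base
    have "norm x \<le> 0" if "x \<in> flag (CARD('n))" for x
    proof -
      have "e j < CARD('n)" for j using e_bij by (auto simp: bij_betw_def)
      then have "x \<bullet> b j = 0" for j using that by (simp add: flag_def)
      then have "x \<bullet> x = 0" by (subst inner_expand) simp
      then show ?thesis by simp
    qed
    then show ?case by (intro exI[of _ 0]) auto
  next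
    case (step r)
    obtain \<rho> where \<rho>: "\<forall>h\<in>Z. \<forall>x\<in>hbody m v h \<inter> flag (Suc r). norm x \<le> \<rho>" using step by blast
    have "r \<in> range e" using e_bij step(2) by (simp add: bij_betw_def)
    then obtain k where k: "e k = r" by auto
    have dk: "d k \<noteq> 0" using dual[of k k] by auto
    define w where "w = (c / norm (d k)) *\<^sub>R d k"
    define a where "a = c / norm (d k)"
    have a: "0 < a" using c dk by (simp add: a_def)
    have wb: "w \<bullet> b j = (if j = k then a else 0)" for j
      by (simp add: w_def a_def inner_commute[of "d k"] dual)
    have nw: "norm w = c" using c dk by (simp add: w_def)
    show ?case
    proof (intro exI[of _ "((a + 1) * \<rho> + c) / a"] ballI)
      fix h x assume h: "h \<in> Z" and x: "x \<in> hbody m v h \<inter> flag r"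
      have ho: "h \<in> orthant m" using h by (simp add: Z_def consistent_orthant)
      define t where "t = x \<bullet> b k"
      have "x \<bullet> signed (k, s) \<le> 1" for s
        using section_support_upper[of x h "flag (e k)" "signed (k, s)"] x k sec[OF h, of k s] by simp
      from this[of True] this[of False] have t: "\<bar>t\<bar> \<le> 1" by (auto simp: signed_def t_def)
      \<comment> \<open>\<open>z\<close> lies in the ball of radius \<open>c\<close>, hence in the
        body, and its component along \<open>b k\<close> has the sign opposite to that of
        \<open>x\<close>. The weights in \<open>y\<close> make the two cancel, so \<open>y\<close>
        lies in the next flag space, and \<open>x\<close> is recovered from \<open>y\<close> and
        \<open>z\<close>.\<close>
      define z where "z = (- sgn t) *\<^sub>R w"
      have "norm z \<le> c" using nw c by (simp add: z_def sgn_if)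
      then have z: "z \<in> hbody m v h" using cball_subset_hbody[of c h] lower[OF h] by auto
      define y where "y = (a / (a + \<bar>t\<bar>)) *\<^sub>R x + (\<bar>t\<bar> / (a + \<bar>t\<bar>)) *\<^sub>R z"
      have pos: "0 < a + \<bar>t\<bar>" using a by simp
      have "y \<in> hbody m v h"
        unfolding y_def using x z a pos
        by (intro convexD[OF convex_hbody]) (auto simp: add_divide_distrib[symmetric])
      moreover have "y \<in> flag (Suc r)"
      proof -
        have "y \<bullet> b j = 0" if "e j < Suc r" for j
        proof (cases "j = k")
          case True
          have "y \<bullet> b k = (a * t + \<bar>t\<bar> * (- sgn t * a)) / (a + \<bar>t\<bar>)"
            by (simp add: y_def z_def wb inner_add_left inner_diff_left t_def diff_divide_distrib mult.assoc)
          also have "\<dots> = 0" by (simp add: sgn_if)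
          finally show ?thesis using True by simp
        next
          case False
          then have "e j \<noteq> e k" using e_bij by (auto simp: bij_betw_def inj_on_def)
          then have "x \<bullet> b j = 0" using x that k by (auto simp: flag_def less_Suc_eq)
          then show ?thesis using False by (simp add: y_def z_def wb inner_add_left inner_diff_left)
        qed
        then show ?thesis by (simp add: flag_def)
      qed
      ultimately have ny: "norm y \<le> \<rho>" using \<rho> h by blast
      have "a *\<^sub>R x = (a + \<bar>t\<bar>) *\<^sub>R y - \<bar>t\<bar> *\<^sub>R z"
        using pos by (simp add: y_def scaleR_add_right)
      then have "a * norm x = norm ((a + \<bar>t\<bar>) *\<^sub>R y - \<bar>t\<bar> *\<^sub>R z)"
        using a by (metis abs_of_pos norm_scaleR)
      also have "\<dots> \<le> (a + \<bar>t\<bar>) * norm y + \<bar>t\<bar> * norm z"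
        using norm_triangle_ineq4[of "(a + \<bar>t\<bar>) *\<^sub>R y" "\<bar>t\<bar> *\<^sub>R z"] pos by simp
      also have "\<dots> \<le> (a + 1) * \<rho> + 1 * c"
        using t a ny \<open>norm z \<le> c\<close> c by (intro add_mono mult_mono) auto
      finally show "norm x \<le> ((a + 1) * \<rho> + c) / a" using a by (simp add: field_simps)
    qed
  qed
  obtain \<rho> where \<rho>: "\<And>h x. h \<in> Z \<Longrightarrow> x \<in> hbody m v h \<Longrightarrow> norm x \<le> \<rho>"
    using bound[of 0] by (auto simp: flag_def)
  show ?thesis
  proof
    fix h assume "h \<in> consistent" "coords h = (\<chi> q. 1)"
    then have h: "h \<in> Z" by (simp add: Z_def)
    have "hbody m v h \<subseteq> cball 0 \<rho>" using \<rho>[OF h] by auto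
    then have "vol h \<le> measure lborel (cball (0 :: real ^ 'n) \<rho>)"
      unfolding vol_def using emeasure_lborel_cball_finite[of "0 :: real ^ 'n" \<rho>]
      by (intro measure_mono_fmeasurable) (auto simp: fmeasurable_def)
    moreover have "(\<Sum>i<m. \<alpha> i / (- p) * h i powr p) \<le> (\<Sum>i<m. \<alpha> i / (- p) * c powr p)"
    proof (intro sum_mono mult_left_mono)
      fix i assume "i \<in> {..<m}"
      then show "h i powr p \<le> c powr p" using lower[OF h] c p_neg by (intro powr_mono2') auto
      show "0 \<le> \<alpha> i / (- p)" using coeff_pos \<open>i \<in> {..<m}\<close> by (auto intro: less_imp_le)
    qed
    ultimately show "energy h \<le> measure lborel (cball (0 :: real ^ 'n) \<rho>) + (\<Sum>i<m. \<alpha> i / (- p) * c powr p)"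
      by (simp add: energy_def)
  qed
qed

lemma sheet_sublevel_bounded:
  obtains c M where "0 < c" "\<And>x. x \<in> pos \<Longrightarrow> energy (sheet x) \<le> C \<Longrightarrow> x \<in> cbox (\<chi> q. c) (\<chi> q. M)"
proof -
  obtain c M where cM: "0 < c" "\<And>h i. h \<in> consistent \<Longrightarrow> energy h \<le> C \<Longrightarrow> i < m \<Longrightarrow> c \<le> h i \<and> h i \<le> M"
    using energy_sublevel_bounds by blast
  have "c \<le> x $ q \<and> x $ q \<le> M" if x: "x \<in> pos" and E: "energy (sheet x) \<le> C" for x q
  proof -
    obtain i where "i < m" "sheet x i = x $ q" using sheet_at_basis by blast
    then show ?thesis using cM(2)[OF sheet_consistent[OF x] E, of i] by simp
  qed
  then show ?thesis using that[OF cM(1), of M] by (auto simp: mem_box_cart)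
qed

lemma critical_point_exists_if_basis: "\<exists>h\<in>consistent. \<forall>i<m. grad h i = 0"
proof (rule ccontr)
  assume "\<not> ?thesis"
  then have crit: "\<And>h. h \<in> consistent \<Longrightarrow> \<exists>i<m. grad h i \<noteq> 0" by blast
  obtain C where C: "\<And>h. h \<in> consistent \<Longrightarrow> coords h = (\<chi> q. 1) \<Longrightarrow> energy h \<le> C"
    using energy_bounded_on_linking_set by blast
  obtain D \<delta> where \<delta>: "0 < \<delta>" and D: "continuous_on consistent D"
    "\<And>h. h \<in> consistent \<Longrightarrow> D h \<in> consistent"
    "\<And>h. h \<in> consistent \<Longrightarrow> energy h \<le> C \<Longrightarrow> energy h + \<delta> \<le> energy (D h)"
    "\<And>h. h \<in> consistent \<Longrightarrow> energy h \<le> energy (D h)"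
    "\<And>h. h \<in> consistent \<Longrightarrow> C + 1 \<le> energy h \<Longrightarrow> D h = h"
    by (rule upward_deformation[where C = C], erule crit, rule that)
  have in_consistent: "(D ^^ k) h \<in> consistent" if "h \<in> consistent" for k h
    by (induction k) (use that D(2) in auto)
  have cont: "continuous_on consistent (D ^^ k)" for k
  proof (induction k)
    case (Suc k)
    have "continuous_on consistent (\<lambda>h. D ((D ^^ k) h))"
      by (rule continuous_on_compose2[OF D(1) Suc]) (use in_consistent in auto)
    then show ?case by (simp add: o_def)
  qed (simp add: id_def)
  have fixed: "(D ^^ k) h = h" if "h \<in> consistent" "C + 1 \<le> energy h" for k h
    by (induction k) (use that D(5) in auto)
  \<comment> \<open>Below level \<open>C\<close> each application gains \<open>\<delta>\<close>, and
    the energy starts nonnegative; so a number of iterations independent of \<open>h\<close> lifts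
    everything above \<open>C\<close>.\<close>
  have raise: "C < energy ((D ^^ k) h) \<or> real k * \<delta> \<le> energy ((D ^^ k) h)" if h: "h \<in> consistent" for k h
  proof (induction k)
    case 0
    show ?case using energy_nonneg by simp
  next
    case (Suc k)
    let ?g = "(D ^^ k) h"
    have g: "?g \<in> consistent" by (rule in_consistent[OF h])
    show ?case
    proof (cases "energy ?g \<le> C")
      case True
      then have "real k * \<delta> \<le> energy ?g" using Suc by simp
      then have "real (Suc k) * \<delta> \<le> energy (D ?g)" using D(3)[OF g True] by (simp add: algebra_simps)
      then show ?thesis by simp
    next
      case False
      then show ?thesis using D(4)[OF g] by simp
    qed
  qed
  obtain K :: nat where K: "C < real K * \<delta>" using reals_Archimedean3[OF \<delta>] by blast
  have high: "C < energy ((D ^^ K) h)" if "h \<in> consistent" for h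
    using raise[OF that, of K] K by linarith
  obtain c M where cM: "0 < c" "\<And>x. x \<in> pos \<Longrightarrow> energy (sheet x) \<le> C + 1 \<Longrightarrow> x \<in> cbox (\<chi> q. c) (\<chi> q. M)"
    using sheet_sublevel_bounded by blast
  let ?box = "cbox (\<chi> q. c) (\<chi> q. M) :: (real ^ ('n \<times> bool)) set"
  have box_pos: "?box \<subseteq> pos"
  proof
    fix x assume "x \<in> ?box"
    then have "c \<le> x $ q" for q by (simp only: mem_box_cart vec_lambda_beta)
    then have "0 < x $ q" for q using cM(1) less_le_trans by blast
    then show "x \<in> pos" unfolding pos_def by blast
  qed
  define f where "f x = coords ((D ^^ K) (sheet x))" for x
  have fix_f: "f x = x" if x: "x \<in> pos" "x \<notin> ?box" for x
  proof -
    have "C + 1 \<le> energy (sheet x)" using cM(2)[OF x(1)] x(2) by linarith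
    then show ?thesis using fixed[OF sheet_consistent[OF x(1)]] coords_sheet[OF x(1)] by (simp add: f_def)
  qed
  have cont_f: "continuous_on pos f"
    unfolding f_def
  proof (rule continuous_on_compose2[OF continuous_on_coords])
    show "continuous_on pos (\<lambda>x. (D ^^ K) (sheet x))"
      by (rule continuous_on_compose2[OF cont continuous_on_sheet]) (use sheet_consistent in auto)
    show "(\<lambda>x. (D ^^ K) (sheet x)) ` pos \<subseteq> orthant m"
      using in_consistent sheet_consistent consistent_orthant by blast
  qed
  \<comment> \<open>The displacement vanishes on \<open>pos\<close> outside the box, so extending it
    by 0 keeps it continuous, and it is bounded. Brouwer then applies on a large ball to
    \<open>G\<close> plus the all-ones vector, and a fixed point in \<open>pos\<close> solves
    \<open>f x = (\<chi> q. 1)\<close>.\<close>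
  define G where "G x = (if x \<in> pos then x - f x else 0)" for x
  have "open (\<Inter>q. {x :: real ^ ('n \<times> bool). 0 < x $ q})"
    by (intro open_INT ballI open_Collect_less continuous_intros) auto
  moreover have "pos = (\<Inter>q. {x. 0 < x $ q})" unfolding pos_def by blast
  ultimately have open_pos: "open pos" by simp
  have "continuous_on (pos \<union> (- ?box)) G"
  proof (rule continuous_on_open_Un[OF open_pos])
    show "continuous_on pos G"
      by (rule continuous_on_eq[of _ "\<lambda>x. x - f x"]) (auto simp: G_def intro!: continuous_intros cont_f)
    show "continuous_on (- ?box) G"
      by (rule continuous_on_eq[of _ "\<lambda>x. 0"]) (auto simp: G_def fix_f)
  qed auto
  moreover have "pos \<union> (- ?box) = UNIV" using box_pos by auto
  ultimately have cont_G: "continuous_on UNIV G" by simp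
  have "compact (G ` ?box)"
    by (intro compact_continuous_image compact_cbox continuous_on_subset[OF cont_G]) auto
  then have "bounded (G ` ?box)" by (rule compact_imp_bounded)
  then obtain B where B: "0 < B" "\<forall>y\<in>G ` ?box. norm y \<le> B" unfolding bounded_pos by blast
  have GB: "norm (G x) \<le> B" for x
  proof (cases "x \<in> ?box")
    case True
    then show ?thesis using B(2) by blast
  next
    case False
    then have "G x = 0" using fix_f[of x] by (simp add: G_def)
    then show ?thesis using B(1) by simp
  qed
  let ?one = "(\<chi> q. 1) :: real ^ ('n \<times> bool)"
  let ?T = "cball 0 (B + norm ?one) :: (real ^ ('n \<times> bool)) set"
  obtain x where x: "x \<in> ?T" "G x + ?one = x"
  proof (rule brouwer[of ?T "\<lambda>x. G x + ?one"])
    show "continuous_on ?T (\<lambda>x. G x + ?one)"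
      by (intro continuous_intros continuous_on_subset[OF cont_G]) auto
    show "(\<lambda>x. G x + ?one) \<in> ?T \<rightarrow> ?T"
    proof
      fix x assume "x \<in> ?T"
      show "G x + ?one \<in> ?T"
        using norm_triangle_ineq[of "G x" ?one] GB[of x] by simp
    qed
    show "?T \<noteq> {}" using B(1) by (simp add: add_nonneg_nonneg not_less)
  qed auto
  have "x \<in> pos"
  proof (rule ccontr)
    assume "x \<notin> pos"
    then have "x = ?one" using x(2) by (simp add: G_def)
    then show False using \<open>x \<notin> pos\<close> by (simp add: pos_def)
  qed
  then have "f x = ?one" using x(2) by (simp add: G_def algebra_simps)
  then have "energy ((D ^^ K) (sheet x)) \<le> C"
    unfolding f_def using in_consistent[OF sheet_consistent[OF \<open>x \<in> pos\<close>]] C by blast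
  then show False using high[OF sheet_consistent[OF \<open>x \<in> pos\<close>]] by simp
qed

end

context lp_energy
begin

theorem critical_point_exists: "\<exists>h\<in>consistent. \<forall>i<m. grad h i = 0"
proof -
  obtain B where B: "B \<subseteq> v ` {..<m}" "independent B" "v ` {..<m} \<subseteq> span B" "card B = dim (v ` {..<m})"
    by (rule basis_exists)
  have "dim (v ` {..<m}) = CARD('n)"
    using spanning by (metis dim_span dim_UNIV DIM_cart DIM_real mult.right_neutral)
  have fin: "finite B" using B(1) finite_surj by blast
  then obtain b :: "'n \<Rightarrow> real ^ 'n" where b: "bij_betw b UNIV B"
    using finite_same_card_bij[of "UNIV :: 'n set" B] B(4) \<open>dim (v ` {..<m}) = CARD('n)\<close> by auto
  have "span (range b) = UNIV"
  proof -
    have "span (v ` {..<m}) \<subseteq> span B" using B(3) by (simp add: span_minimal)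
    then show ?thesis using spanning b by (auto simp: bij_betw_def)
  qed
  then obtain d where d: "\<And>j k. b j \<bullet> d k = (if j = k then 1 else 0)" "\<And>y. y = (\<Sum>k\<in>UNIV. (y \<bullet> d k) *\<^sub>R b k)"
    using spanning_family_dual by blast
  obtain e where e: "bij_betw e (UNIV :: 'n set) {..<CARD('n)}"
    using ex_bij_betw_finite_nat[of "UNIV :: 'n set"] by (auto simp: atLeast0LessThan)
  interpret lp_energy_basis m v \<alpha> p b d e
    by standard (use b B(1) d e in \<open>auto simp: bij_betw_def\<close>)
  show ?thesis by (rule critical_point_exists_if_basis)
qed

end

section \<open>Sufficiency of the spanning condition\<close>

lemma polytope_with_Lp_surface_area_measure:
  fixes u :: "nat \<Rightarrow> real ^ 'n"
  assumes n: "CARD('n) \<ge> 2" and p: "p < 0"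
    and unit: "\<And>i. i \<in> {1..N} \<Longrightarrow> u i \<in> sphere 0 1"
    and distinct: "\<And>i j. i \<in> {1..N} \<Longrightarrow> j \<in> {1..N} \<Longrightarrow> i \<noteq> j \<Longrightarrow> u i \<noteq> u j \<and> u i \<noteq> - u j"
    and ab: "\<And>i. i \<in> {1..N} \<Longrightarrow> a i > 0 \<and> b i > 0"
    and span: "span (u ` {1..N}) = UNIV"
  shows "\<exists>K. polytope K \<and> 0 \<in> interior K \<and> Lp_surface_area_measure p K = antipodal_measure N u a b"
proof -
  define m where "m = N + N"
  \<comment> \<open>Index \<open>i < N\<close> carries \<open>u (Suc i)\<close> and index
    \<open>N + i\<close> its negative; the shift by one reconciles \<open>{..<m}\<close> with
    \<open>{1..N}\<close>.\<close>
  define v where "v i = (if i < N then u (Suc i) else - u (Suc (i - N)))" for i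
  define \<beta> where "\<beta> i = (if i < N then a (Suc i) else b (Suc (i - N)))" for i
  have idx: "Suc i \<in> {1..N}" if "i < N" for i using that by simp
  have v_unit: "norm (v i) = 1" if "i < m" for i
    using unit[of "Suc i"] unit[of "Suc (i - N)"] that by (auto simp: v_def m_def)
  have \<beta>_pos: "0 < \<beta> i" if "i < m" for i
    using ab[of "Suc i"] ab[of "Suc (i - N)"] that by (auto simp: \<beta>_def m_def)
  have nz: "u i \<noteq> - u i" if "i \<in> {1..N}" for i
  proof
    assume "u i = - u i"
    then have "u i = 0" by (simp add: vec_eq_iff)
    then show False using unit[OF that] by simp
  qed
  have inj: "inj_on v {..<m}"
  proof (rule inj_onI)
    fix i j assume i: "i \<in> {..<m}" and j: "j \<in> {..<m}" and eq: "v i = v j"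
    let ?f = "\<lambda>i. Suc (if i < N then i else i - N)"
    have fi: "?f i \<in> {1..N}" and fj: "?f j \<in> {1..N}" using i j by (auto simp: m_def)
    have "u (?f i) = u (?f j) \<or> u (?f i) = - u (?f j)"
      using eq minus_equation_iff[of "u (?f i)" "u (?f j)"] by (auto simp: v_def split: if_splits)
    then have ff: "?f i = ?f j" using distinct[OF fi fj] by blast
    have "i < N \<longleftrightarrow> j < N"
    proof (rule ccontr)
      assume "\<not> ?thesis"
      then have "u (?f i) = - u (?f j)"
        using eq minus_equation_iff[of "u (?f i)" "u (?f j)"] by (auto simp: v_def split: if_splits)
      then show False using nz[OF fj] ff by simp
    qed
    then show "i = j" using ff i j by (auto split: if_splits)
  qed
  have "\<exists>\<kappa>>0. \<forall>c E. E \<in> sets borel \<longrightarrow> E \<subseteq> {x. x \<bullet> v i = c} \<longrightarrow>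
      hausdorff (CARD('n) - 1) E = ennreal \<kappa> * emeasure lborel (cylinder (v i) ((\<lambda>z. z + c *\<^sub>R v i) -` E))"
    if "i < m" for i
    using hausdorff_hyperplane_constant[OF n v_unit[OF that]] by metis
  then obtain \<kappa> where \<kappa>: "\<And>i. i < m \<Longrightarrow> 0 < \<kappa> i"
    "\<And>i c E. i < m \<Longrightarrow> E \<in> sets borel \<Longrightarrow> E \<subseteq> {x. x \<bullet> v i = c} \<Longrightarrow>
      hausdorff (CARD('n) - 1) E = ennreal (\<kappa> i) * emeasure lborel (cylinder (v i) ((\<lambda>z. z + c *\<^sub>R v i) -` E))"
    by metis
  have split: "(\<Sum>i<N + M. f i) = (\<Sum>i<N. f i) + (\<Sum>i<M. f (N + i))" for f :: "nat \<Rightarrow> ennreal" and M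
    by (induction M) (auto simp: add.assoc)
  \<comment> \<open>Dividing by \<open>\<kappa> i\<close> compensates in advance for the factor
    between the cylinder volume \<open>area\<close> and Hausdorff measure.\<close>
  interpret lp_energy m v "\<lambda>i. \<beta> i / \<kappa> i" p
  proof
    show "\<exists>j<m. v j = - v i" if "i < m" for i
      using that by (intro exI[of _ "if i < N then i + N else i - N"]) (auto simp: v_def m_def)
    show "span (v ` {..<m}) = UNIV"
    proof -
      have "u i \<in> v ` {..<m}" if "i \<in> {1..N}" for i
        using that by (intro image_eqI[of _ _ "i - 1"]) (auto simp: v_def m_def)
      then have "u ` {1..N} \<subseteq> v ` {..<m}" by blast
      then show ?thesis using span_mono span by blast
    qed
  qed (use v_unit inj n \<beta>_pos \<kappa>(1) p in auto)
  obtain h where h: "h \<in> consistent" "\<And>i. i < m \<Longrightarrow> grad h i = 0" using critical_point_exists by blast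
  have ho: "h \<in> orthant m" using h(1) by (rule consistent_orthant)
  have hp: "0 < h i" if "i < m" for i using ho that by (simp add: orthant_def)
  let ?K = "hbody m v h"
  \<comment> \<open>Consistency identifies \<open>h i\<close> with the support value at which the
    density is evaluated.\<close>
  have supp: "support_fun ?K (v i) = h i" if "i < m" for i
  proof -
    have "reduce h i = h i" using h(1) by (simp add: consistent_def)
    then show ?thesis using that by (simp add: reduce_def section_support_def support_fun_def)
  qed
  have facet: "ennreal (support_fun ?K (v i) powr (1 - p)) * hausdorff (CARD('n) - 1) (open_facet m v h i) = ennreal (\<beta> i)"
    if i: "i < m" for i
  proof -
    have "open_facet m v h i \<subseteq> {x. x \<bullet> v i = h i}" by (auto simp: open_facet_def)
    then have "hausdorff (CARD('n) - 1) (open_facet m v h i) = ennreal (\<kappa> i) * ennreal (area i h)"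
      by (simp only: \<kappa>(2)[OF i open_facet_borel] measure_cylinder_open_facet[OF i ho])
    also have "\<dots> = ennreal (\<beta> i * h i powr (p - 1))"
      using h(2)[OF i] \<kappa>(1)[OF i] by (simp add: grad_def flip: ennreal_mult')
    finally have "ennreal (support_fun ?K (v i) powr (1 - p)) * hausdorff (CARD('n) - 1) (open_facet m v h i)
        = ennreal (h i powr (1 - p) * (\<beta> i * h i powr (p - 1)))"
      by (simp add: supp[OF i] ennreal_mult')
    moreover have "h i powr (1 - p) * (\<beta> i * h i powr (p - 1)) = \<beta> i"
      using hp[OF i] by (simp add: powr_diff field_simps)
    ultimately show ?thesis by simp
  qed
  have "Lp_surface_area_measure p ?K = antipodal_measure N u a b"
  proof (rule measure_eqI)
    fix \<omega> assume "\<omega> \<in> sets (Lp_surface_area_measure p ?K)"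
    then have \<omega>: "\<omega> \<in> sets sphere_borel" by simp
    have "emeasure (Lp_surface_area_measure p ?K) \<omega> = (\<Sum>i<m. indicator \<omega> (v i) *
        ennreal (support_fun ?K (v i) powr (1 - p)) * hausdorff (DIM(real ^ 'n) - 1) (open_facet m v h i))"
      by (rule emeasure_Lp_surface_area_measure_hbody[OF v_unit inj bounded_hbody \<omega>])
    also have "\<dots> = (\<Sum>i<m. indicator \<omega> (v i) * ennreal (\<beta> i))"
    proof (rule sum.cong[OF refl])
      fix i assume "i \<in> {..<m}"
      then show "indicator \<omega> (v i) * ennreal (support_fun ?K (v i) powr (1 - p)) *
          hausdorff (DIM(real ^ 'n) - 1) (open_facet m v h i) = indicator \<omega> (v i) * ennreal (\<beta> i)"
        using facet[of i] by (simp add: mult.assoc)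
    qed
    also have "\<dots> = (\<Sum>i<N. indicator \<omega> (v i) * ennreal (\<beta> i)) + (\<Sum>i<N. indicator \<omega> (v (N + i)) * ennreal (\<beta> (N + i)))"
      unfolding m_def by (rule split)
    also have "\<dots> = (\<Sum>i<N. ennreal (a (Suc i)) * indicator \<omega> (u (Suc i)) + ennreal (b (Suc i)) * indicator \<omega> (- u (Suc i)))"
      by (simp add: v_def \<beta>_def sum.distrib mult.commute)
    also have "\<dots> = (\<Sum>i=1..N. ennreal (a i) * indicator \<omega> (u i) + ennreal (b i) * indicator \<omega> (- u i))"
      by (rule sum.reindex_bij_witness[of _ "\<lambda>i. i - 1" Suc]) auto
    finally show "emeasure (Lp_surface_area_measure p ?K) \<omega> = emeasure (antipodal_measure N u a b) \<omega>"
      by (simp add: emeasure_antipodal_measure[OF \<omega>])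
  qed simp
  moreover have "polytope ?K"
    using bounded_hbody polyhedron_hbody by (simp add: polytope_eq_bounded_polyhedron)
  moreover have "0 \<in> interior ?K"
    using interior_hbody[of m v h] v_unit hp by force
  ultimately show ?thesis by blast
qed

theorem theorem1p2:
  fixes p :: real and N :: nat
    and u :: "nat \<Rightarrow> real ^ 'n"
    and \<alpha>plus \<alpha>minus :: "nat \<Rightarrow> real"
  assumes "CARD('n) \<ge> 2"
    and "p < 0"
    and "\<And>i. i \<in> {1..N} \<Longrightarrow> u i \<in> sphere 0 1"
    and "\<And>i j. i \<in> {1..N} \<Longrightarrow> j \<in> {1..N} \<Longrightarrow> i \<noteq> j \<Longrightarrow> u i \<noteq> u j \<and> u i \<noteq> - u j"
    and "\<And>i. i \<in> {1..N} \<Longrightarrow> \<alpha>plus i > 0 \<and> \<alpha>minus i > 0"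
  shows "(\<exists>K :: (real ^ 'n) set. polytope K \<and> 0 \<in> interior K \<and>
            Lp_surface_area_measure p K = antipodal_measure N u \<alpha>plus \<alpha>minus)
         \<longleftrightarrow> span (u ` {1..N}) = UNIV"
proof
  assume "\<exists>K :: (real ^ 'n) set. polytope K \<and> 0 \<in> interior K \<and>
            Lp_surface_area_measure p K = antipodal_measure N u \<alpha>plus \<alpha>minus"
  then show "span (u ` {1..N}) = UNIV"
    using span_if_Lp_surface_area_measure_antipodal[OF assms(1)] by blast
next
  assume "span (u ` {1..N}) = UNIV"
  then show "\<exists>K :: (real ^ 'n) set. polytope K \<and> 0 \<in> interior K \<and>
            Lp_surface_area_measure p K = antipodal_measure N u \<alpha>plus \<alpha>minus"
    by (intro polytope_with_Lp_surface_area_measure assms)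
qed

end
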